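(* Fix $d\in\mathbb N$ and $\lambda\in(0,\infty)$. For each $n$ let $F_n\in\mathcal C_d^{\mathsf R}\cap L^4(\mathbb P)$, and let $\theta_n\in\mathbb R$ be deterministic with $F_n+\theta_n\in\mathbb N_0$ almost surely. Suppose that $\mathcal M(F_n)\to0$. Then the following assertions are equivalent: (i) The first four moments $\mathbb E[(F_n+\theta_n)^k]$, $k=1,2,3,4$, converge respectively to $\lambda$, $\lambda^2+\lambda$, $\lambda^3+3\lambda^2+\lambda$, $\lambda^4+6\lambda^3+7\lambda^2+\lambda$. (ii) $(\theta_n,m_2(F_n),\mathcal R(F_n))\to(\lambda,\lambda,0)$. (iii) $d_{\mathrm{TV}}(F_n+\theta_n,P_\lambda)\to0$ and the family $\{(F_n+\theta_n)^4\}_{n\ge1}$ is uniformly integrable.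
   Context: $\mathbb N=\{1,2,\dots\}$, $\mathbb N_0=\mathbb N\cup\{0\}$, $m_k(X)=\mathbb E[X^k]$, $P_\lambda$ is a Poisson random variable with mean $\lambda$. For $\mathbb N_0$-valued variables, $d_{\mathrm{TV}}(X,Y)=\sup_{A\subseteq\mathbb N_0}|\mathbb P(X\in A)-\mathbb P(Y\in A)|$. $(X_k)_{k\ge1}$ are independent with $\mathbb P(X_k=1)=p_k\in(0,1)$, $\mathbb P(X_k=-1)=q_k=1-p_k$, and $Y_k=(X_k-p_k+q_k)/(2\sqrt{p_kq_k})$. For $d\ge1$, the $d$-th Rademacher chaos $\mathcal C_d^{\mathsf R}$ is the set of all $Q_d(f;Y)=\sum_{i_1,\dots,i_d\in\mathbb N}f(i_1,\dots,i_d)Y_{i_1}\cdots Y_{i_d}$, where $f:\mathbb N^d\to\mathbb R$ is symmetric, square-summable and vanishes whenever two of its arguments coincide. For $F=Q_d(f;Y)$ put $\mathrm{Inf}_k(F)=\sum_{i_1,\dots,i_{d-1}}f(i_1,\dots,i_{d-1},k)^2$ (equal to $f(k)^2$ if $d=1$) and $\mathcal M(F)=\sup_{k\ge1}\mathrm{Inf}_k(F)$. For a centered $F\in L^4(\mathbb P)$, $\mathcal R(F)=m_4(F)-3m_2(F)^2-2m_3(F)+m_2(F)$. *)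

theory Defs
  imports "HOL-Probability.Probability"
begin

text \<open>
  The Rademacher sequence is indexed by the type \<^typ>\<open>nat\<close>, i.e. from 0 instead of from 1;
  this is a mere relabelling. An index tuple \<open>(i\<^sub>1, \<dots>, i\<^sub>d)\<close> is a list of length \<open>d\<close>,
  and the values of a kernel on lists of any other length are irrelevant.
\<close>

locale rademacher_sequence = prob_space M
  for M :: "'a measure" and p :: "nat \<Rightarrow> real" and X :: "nat \<Rightarrow> 'a \<Rightarrow> real" +
  assumes p_pos: "0 < p k" and p_less_1: "p k < 1"
    and indep: "indep_vars (\<lambda>_. borel) X UNIV"
    and prob_X_pos: "prob {\<omega> \<in> space M. X k \<omega> = 1} = p k"
    and prob_X_neg: "prob {\<omega> \<in> space M. X k \<omega> = - 1} = 1 - p k"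

definition normalized_rademacher :: "(nat \<Rightarrow> real) \<Rightarrow> (nat \<Rightarrow> 'a \<Rightarrow> real) \<Rightarrow> nat \<Rightarrow> 'a \<Rightarrow> real" where
  "normalized_rademacher p X k \<omega> = (X k \<omega> - p k + (1 - p k)) / (2 * sqrt (p k * (1 - p k)))"

definition chaos_kernel :: "nat \<Rightarrow> (nat list \<Rightarrow> real) \<Rightarrow> bool" where
  "chaos_kernel d f \<longleftrightarrow>
     (\<forall>xs ys. length xs = d \<longrightarrow> mset ys = mset xs \<longrightarrow> f ys = f xs) \<and>
     (\<lambda>xs. (f xs)\<^sup>2) summable_on {xs. length xs = d} \<and>
     (\<forall>xs. length xs = d \<longrightarrow> \<not> distinct xs \<longrightarrow> f xs = 0)"

text \<open>
  \<open>is_chaos M Y d f F\<close> says that \<open>F\<close> is (a version of) \<open>Q\<^sub>d(f; Y)\<close>. The infinite series defining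
  \<open>Q\<^sub>d(f; Y)\<close> is understood as an unconditional sum in \<open>L\<^sup>2\<close>, i.e. as the limit of
  the net of partial sums over finite sets of index tuples, so that \<open>F\<close> is determined up to null sets.
\<close>

definition is_chaos ::
  "'a measure \<Rightarrow> (nat \<Rightarrow> 'a \<Rightarrow> real) \<Rightarrow> nat \<Rightarrow> (nat list \<Rightarrow> real) \<Rightarrow> ('a \<Rightarrow> real) \<Rightarrow> bool" where
  "is_chaos M Y d f F \<longleftrightarrow>
     chaos_kernel d f \<and> F \<in> borel_measurable M \<and> integrable M (\<lambda>\<omega>. (F \<omega>)\<^sup>2) \<and>
     ((\<lambda>A. \<integral>\<omega>. (F \<omega> - (\<Sum>xs\<in>A. f xs * (\<Prod>j<d. Y (xs ! j) \<omega>)))\<^sup>2 \<partial>M) \<longlongrightarrow> 0)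
       (finite_subsets_at_top {xs. length xs = d})"

definition influence :: "nat \<Rightarrow> (nat list \<Rightarrow> real) \<Rightarrow> nat \<Rightarrow> real" where
  "influence d f k = (\<Sum>\<^sub>\<infinity>xs\<in>{xs. length xs = d - 1}. (f (xs @ [k]))\<^sup>2)"

definition max_influence :: "nat \<Rightarrow> (nat list \<Rightarrow> real) \<Rightarrow> real" where
  "max_influence d f = (SUP k. influence d f k)"

definition moment :: "'a measure \<Rightarrow> nat \<Rightarrow> ('a \<Rightarrow> real) \<Rightarrow> real" where
  "moment M k Z = (\<integral>\<omega>. Z \<omega> ^ k \<partial>M)"

definition moment_R :: "'a measure \<Rightarrow> ('a \<Rightarrow> real) \<Rightarrow> real" where
  "moment_R M F = moment M 4 F - 3 * (moment M 2 F)\<^sup>2 - 2 * moment M 3 F + moment M 2 F"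

text \<open>
  Total variation distance between the laws of two real random variables that
  are almost surely \<open>\<nat>\<close>-valued and may live on different probability spaces.
\<close>

definition tv_dist :: "'a measure \<Rightarrow> ('a \<Rightarrow> real) \<Rightarrow> 'b measure \<Rightarrow> ('b \<Rightarrow> real) \<Rightarrow> real" where
  "tv_dist M Z N W =
     (SUP A::nat set. \<bar>measure M {\<omega> \<in> space M. Z \<omega> \<in> real ` A} -
                       measure N {\<omega> \<in> space N. W \<omega> \<in> real ` A}\<bar>)"

definition uniformly_integrable :: "'a measure \<Rightarrow> 'i set \<Rightarrow> ('i \<Rightarrow> 'a \<Rightarrow> real) \<Rightarrow> bool" where
  "uniformly_integrable M I Z \<longleftrightarrow>
     (\<forall>i\<in>I. Z i \<in> borel_measurable M) \<and>
     ((\<lambda>K::real. SUP i\<in>I. \<integral>\<^sup>+\<omega>. ennreal \<bar>Z i \<omega>\<bar> * indicator {\<omega>. \<bar>Z i \<omega>\<bar> > K} \<omega> \<partial>M) \<longlongrightarrow> 0) at_top"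

end

theory Submission
  imports Defs "HOL-Combinatorics.Multiset_Permutations"
begin

text \<open>
  Let \<open>Z = F + \<theta>\<close> be a chaos of order \<open>d\<close> shifted into the natural numbers. Realise the Rademacher
  sequence as the coordinates of a product of two-point spaces and let each coordinate be resampled
  at rate one. This is a reversible dynamics, and its generator \<open>L\<close> acts on a Walsh function of degree
  \<open>j\<close> as multiplication by \<open>- j\<close>; in particular \<open>L F = - d F\<close>. Let \<open>u\<close> and \<open>v\<close> be the rates at which \<open>Z\<close>
  goes up and down by one, and suppose for the moment that there are no other jumps. Then
  \<open>u - v = L F = - d F\<close>, and \<open>u + v = 2 \<Gamma>\<close> with the carre du champ \<open>\<Gamma> = L (F\<^sup>2) / 2 - F L F\<close>. If
  \<open>\<Gamma>\<close> is close to \<open>d E[F\<^sup>2] + d F / 2\<close>, then \<open>u\<close> is close to \<open>d E[F\<^sup>2]\<close> and \<open>v\<close> to \<open>d (E[F\<^sup>2] + F)\<close>. With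
  \<open>\<theta>\<close> and \<open>E[F\<^sup>2]\<close> close to \<open>\<lambda>\<close> these are, up to the factor \<open>d\<close>, the birth rate \<open>\<lambda>\<close> and the death
  rate \<open>Z\<close> of the immigration-death process, whose stationary law is Poisson. Precisely, stationarity
  \<open>E[L h(Z)] = 0\<close> for the indicator \<open>h\<close> of \<open>{..j}\<close> becomes \<open>(j + 1) P(Z = j + 1) - \<lambda> P(Z = j) \<rightarrow> 0\<close>,
  and together with tightness these relations force the Poisson limit.

  The closeness of \<open>\<Gamma>\<close> is where the fourth moment enters. Since \<open>L F = - d F\<close>,
  \<open>\<Gamma> - d F / 2 = (L + 2 d)(F\<^sup>2 - F) / 2\<close>. The square \<open>F\<^sup>2\<close> has Walsh degree at most \<open>2 d\<close>, and the factor
  \<open>L + 2 d\<close> kills the part of degree \<open>2 d\<close>, so that the variance of \<open>\<Gamma> - d F / 2\<close> is at most \<open>d\<^sup>2 (E[(F\<^sup>2 - F)\<^sup>2] - E[F\<^sup>2]\<^sup>2 - t)\<close>, where \<open>t\<close> is the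
  squared norm of that part. Up to the influences, \<open>t\<close> is at least \<open>2 E[F\<^sup>2]\<^sup>2\<close>
  (\<open>top_degree_lower_bound\<close>), and what remains in the parentheses is exactly the functional
  \<open>E[F\<^sup>4] - 2 E[F\<^sup>3] + E[F\<^sup>2] - 3 E[F\<^sup>2]\<^sup>2\<close> (\<open>defect_second_moment\<close>). The same estimate has two further
  consequences. Integrated against \<open>F\<close>, it shows that \<open>E[F\<^sup>3]\<close> is close to \<open>E[F\<^sup>2]\<close>
  (\<open>third_moment_bound\<close>), so that control of the functional amounts to control of all four moments.
  Integrated against \<open>F\<^sup>2\<close>, it shows that the fourth powers of the increments of \<open>Z\<close>
  sum up, in the mean, to little more than their squares (\<open>fourth_differences_bound\<close>). As the increments of \<open>Z\<close> are
  integers, \<open>\<delta>\<^sup>4 - \<delta>\<^sup>2\<close> is nonnegative and bounds the contribution of jumps other than \<open>1\<close> and \<open>- 1\<close>.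

  The partial sums of an infinite chaos are polynomials, for which all this is algebra, but they are
  not integer valued. The moment estimates are therefore proved for the partial sums and carried to the
  limit, and only the balance of births and deaths is drawn up for the limit itself
  (\<open>birth_death_balance\<close>).
\<close>

section \<open>Disjoint blocks and the top-degree lower bound\<close>

lemma sum_influences:
  fixes c :: "'i set \<Rightarrow> real"
  assumes V: "finite V" and deg: "\<And>S. c S \<noteq> 0 \<Longrightarrow> card S = d"
  shows "(\<Sum>i\<in>V. \<Sum>S | S \<subseteq> V \<and> i \<in> S. (c S)\<^sup>2) = d * (\<Sum>S\<in>Pow V. (c S)\<^sup>2)"
proof -
  have "(\<Sum>i\<in>V. \<Sum>S | S \<subseteq> V \<and> i \<in> S. (c S)\<^sup>2) = (\<Sum>i\<in>V. \<Sum>S\<in>Pow V. if i \<in> S then (c S)\<^sup>2 else 0)"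
  proof (rule sum.cong[OF refl])
    fix i
    have "{S. S \<subseteq> V \<and> i \<in> S} = {S \<in> Pow V. i \<in> S}" by auto
    moreover have "(\<Sum>S\<in>{S \<in> Pow V. i \<in> S}. (c S)\<^sup>2) = (\<Sum>S\<in>Pow V. if i \<in> S then (c S)\<^sup>2 else 0)"
      using V by (intro sum.inter_filter) auto
    ultimately show "(\<Sum>S | S \<subseteq> V \<and> i \<in> S. (c S)\<^sup>2) = (\<Sum>S\<in>Pow V. if i \<in> S then (c S)\<^sup>2 else 0)"
      by simp
  qed
  also have "\<dots> = (\<Sum>S\<in>Pow V. \<Sum>i\<in>V. if i \<in> S then (c S)\<^sup>2 else 0)"
    by (rule sum.swap)
  also have "\<dots> = (\<Sum>S\<in>Pow V. d * (c S)\<^sup>2)"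
  proof (rule sum.cong[OF refl])
    fix S assume "S \<in> Pow V"
    then have "(\<Sum>i\<in>V. if i \<in> S then (c S)\<^sup>2 else 0) = (\<Sum>i\<in>S. (c S)\<^sup>2)"
      using V by (simp add: sum.If_cases Int_absorb1)
    also have "\<dots> = d * (c S)\<^sup>2"
      using deg[of S] by (cases "c S = 0") auto
    finally show "(\<Sum>i\<in>V. if i \<in> S then (c S)\<^sup>2 else 0) = d * (c S)\<^sup>2" .
  qed
  finally show ?thesis by (simp add: sum_distrib_left)
qed

lemma sum_le_sum_over_witness:
  fixes g :: "'b \<Rightarrow> real"
  assumes "finite V" "finite Q" and nn: "\<And>q. q \<in> Q \<Longrightarrow> 0 \<le> g q" and w: "\<And>q. q \<in> Q \<Longrightarrow> \<exists>i\<in>V. P i q"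
  shows "(\<Sum>q\<in>Q. g q) \<le> (\<Sum>i\<in>V. \<Sum>q | q \<in> Q \<and> P i q. g q)"
proof -
  have "(\<Sum>q\<in>Q. g q) \<le> (\<Sum>q\<in>Q. \<Sum>i\<in>V. if P i q then g q else 0)"
    proof (rule sum_mono)
      fix q assume q: "q \<in> Q"
      then obtain i where i: "i \<in> V" "P i q" using w by blast
      have "g q = (if P i q then g q else 0)" using i by simp
      also have "\<dots> \<le> (\<Sum>i\<in>V. if P i q then g q else 0)"
        using i nn[OF q] assms(1) by (intro member_le_sum) auto
      finally show "g q \<le> (\<Sum>i\<in>V. if P i q then g q else 0)" .
    qed
    also have "\<dots> = (\<Sum>i\<in>V. \<Sum>q\<in>Q. if P i q then g q else 0)" by (rule sum.swap)
    also have "\<dots> = (\<Sum>i\<in>V. \<Sum>q | q \<in> Q \<and> P i q. g q)"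
      using assms(2) by (auto intro!: sum.cong simp: sum.inter_filter)
    finally show ?thesis .
qed

text \<open>A set with \<open>d\<close> elements has \<open>2\<^sup>d\<close> ordered splittings into two parts.\<close>
lemma sum_split_pairs_le:
  fixes c :: "'i set \<Rightarrow> real"
  assumes V: "finite V" and deg: "\<And>S. c S \<noteq> 0 \<Longrightarrow> card S = d"
  shows "(\<Sum>(A,B) | A \<subseteq> V \<and> B \<subseteq> V \<and> A \<inter> B = {} \<and> i \<in> A \<union> B. (c (A \<union> B))\<^sup>2)
    \<le> 2 ^ d * (\<Sum>S | S \<subseteq> V \<and> i \<in> S. (c S)\<^sup>2)"
proof -
  have "(\<Sum>(A,B) | A \<subseteq> V \<and> B \<subseteq> V \<and> A \<inter> B = {} \<and> i \<in> A \<union> B. (c (A \<union> B))\<^sup>2)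
      = (\<Sum>(S,A)\<in>Sigma {S. S \<subseteq> V \<and> i \<in> S} Pow. (c S)\<^sup>2)"
    by (rule sum.reindex_bij_witness[where i = "\<lambda>(S,A). (A, S - A)" and j = "\<lambda>(A,B). (A \<union> B, A)"])
       (auto simp: Un_absorb1)
  also have "\<dots> = (\<Sum>S | S \<subseteq> V \<and> i \<in> S. \<Sum>A\<in>Pow S. (c S)\<^sup>2)"
    using V by (subst sum.Sigma) (auto intro: finite_subset)
  also have "\<dots> = (\<Sum>S | S \<subseteq> V \<and> i \<in> S. 2 ^ d * (c S)\<^sup>2)"
  proof (rule sum.cong[OF refl])
    fix S assume "S \<in> {S. S \<subseteq> V \<and> i \<in> S}"
    then have "finite S" using V finite_subset by auto
    then show "(\<Sum>A\<in>Pow S. (c S)\<^sup>2) = 2 ^ d * (c S)\<^sup>2"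
      using deg[of S] by (cases "c S = 0") (auto simp: card_Pow)
  qed
  finally show ?thesis by (simp add: sum_distrib_left)
qed

text \<open>
  Two subsets \<open>S\<close> and \<open>T\<close> of \<open>W\<close> cut \<open>W\<close> into the blocks \<open>S \<inter> T\<close>, \<open>S - T\<close>, \<open>T - S\<close> and a remainder, and
  each of the four sets in the expanded square is a union of two of them.
\<close>
lemma sum_squares_as_disjoint_quadruples:
  fixes c :: "'i set \<Rightarrow> real"
  assumes V: "finite V"
  shows "(\<Sum>W\<in>Pow V. (\<Sum>S\<in>Pow W. c S * c (W - S))\<^sup>2) =
    (\<Sum>(A,B,C,D) | A \<subseteq> V \<and> B \<subseteq> V \<and> C \<subseteq> V \<and> D \<subseteq> V \<and> A \<inter> D = {} \<and> (A \<union> D) \<inter> (B \<union> C) = {} \<and> B \<inter> C = {}.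
      (c (A \<union> B) * c (B \<union> D)) * (c (A \<union> C) * c (C \<union> D)))"
proof -
  have "(\<Sum>W\<in>Pow V. (\<Sum>S\<in>Pow W. c S * c (W - S))\<^sup>2) =
     (\<Sum>W\<in>Pow V. \<Sum>(S,T)\<in>Pow W \<times> Pow W. (c S * c (W - S)) * (c T * c (W - T)))"
    by (simp add: power2_eq_square sum_product sum.cartesian_product)
  also have "\<dots> = (\<Sum>(W,S,T)\<in>Sigma (Pow V) (\<lambda>W. Pow W \<times> Pow W). (c S * c (W - S)) * (c T * c (W - T)))"
    using V by (subst sum.Sigma) (auto intro: finite_subset)
  also have "\<dots> = (\<Sum>(A,B,C,D) | A \<subseteq> V \<and> B \<subseteq> V \<and> C \<subseteq> V \<and> D \<subseteq> V \<and> A \<inter> D = {} \<and> (A \<union> D) \<inter> (B \<union> C) = {} \<and> B \<inter> C = {}.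
      (c (A \<union> B) * c (B \<union> D)) * (c (A \<union> C) * c (C \<union> D)))"
  proof (rule sum.reindex_bij_witness[where
        i = "\<lambda>(A,B,C,D). (A \<union> B \<union> C \<union> D, A \<union> B, A \<union> C)" and
        j = "\<lambda>(W,S,T). (S \<inter> T, S - T, T - S, W - S - T)"], goal_cases)
    case (5 a)
    then obtain W S T where a: "a = (W,S,T)" "S \<subseteq> W" "T \<subseteq> W" by auto
    have "S \<inter> T \<union> (S - T) = S" "S \<inter> T \<union> (T - S) = T" "(T - S) \<union> (W - S - T) = W - S"
      "(S - T) \<union> (W - S - T) = W - T" using a by auto
    then show ?case unfolding a by simp
  qed auto
  finally show ?thesis .
qed

text \<open>
  The right-hand side is the squared norm of the part of degree \<open>2 d\<close> of the square of a homogeneous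
  sum with coefficients \<open>c\<close>. In the expansion over quadruples of disjoint blocks, the terms with
  \<open>A = {}\<close> and those with \<open>B = {}\<close> each give the sum of \<open>(c S)\<^sup>2 (c T)\<^sup>2\<close> over disjoint \<open>S\<close> and \<open>T\<close>, which is
  the square of the norm up to influences. In the remaining terms the summand is a function of
  \<open>(A, B, D)\<close> times the same function of \<open>(A, C, D)\<close>; without the constraint that \<open>B\<close> and \<open>C\<close> are disjoint
  these terms would form a sum of squares, namely of norms of contractions. The terms to be added for
  this have a point \<open>i\<close> in \<open>B \<inter> C\<close>, and by the inequality of arithmetic and geometric means they are
  bounded by a multiple of the squared influence of \<open>i\<close>. The sum of all squared influences is at most
  \<open>m\<close> times the total influence, which is \<open>d\<close> times the squared norm.
\<close>
lemma top_degree_lower_bound: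
  fixes c :: "'i set \<Rightarrow> real"
  assumes V: "finite V" and deg: "\<And>S. c S \<noteq> 0 \<Longrightarrow> card S = d" and d: "d \<ge> 1"
    and m: "\<And>i. i \<in> V \<Longrightarrow> (\<Sum>S | S \<subseteq> V \<and> i \<in> S. (c S)\<^sup>2) \<le> m"
  shows "2 * (\<Sum>S\<in>Pow V. (c S)\<^sup>2)\<^sup>2 - (4 ^ d + 2) * d * m * (\<Sum>S\<in>Pow V. (c S)\<^sup>2)
    \<le> (\<Sum>W\<in>Pow V. (\<Sum>S\<in>Pow W. c S * c (W - S))\<^sup>2)"
proof -
  define I where "I i = (\<Sum>S | S \<subseteq> V \<and> i \<in> S. (c S)\<^sup>2)" for i
  define s where "s = (\<Sum>S\<in>Pow V. (c S)\<^sup>2)"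
  have finV: "finite {S. S \<subseteq> V \<and> Q S}" for Q using V by auto
  have I0: "0 \<le> I i" for i unfolding I_def by (intro sum_nonneg) auto
  have I2: "(\<Sum>i\<in>V. (I i)\<^sup>2) \<le> d * m * s"
  proof -
    have "(\<Sum>i\<in>V. (I i)\<^sup>2) \<le> (\<Sum>i\<in>V. m * I i)"
      using m I0 by (intro sum_mono) (simp add: power2_eq_square[of "I _"] I_def[symmetric] mult_right_mono)
    also have "\<dots> = d * m * s"
      using sum_influences[of V c d, OF V deg] by (simp add: I_def s_def sum_distrib_left[symmetric])
    finally show ?thesis .
  qed
  define quad where "quad = (\<lambda>(A,B,C,D). (c (A \<union> B) * c (B \<union> D)) * (c (A \<union> C) * c (C \<union> D)))"
  define Q where "Q = {(A,B,C,D). A \<subseteq> V \<and> B \<subseteq> V \<and> C \<subseteq> V \<and> D \<subseteq> V \<and> A \<inter> D = {} \<and> (A \<union> D) \<inter> (B \<union> C) = {}}"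
  define Q0 where "Q0 = {q \<in> Q. case q of (A,B,C,D) \<Rightarrow> B \<inter> C = {}}"
  have finQ: "finite Q"
    by (rule finite_subset[of _ "Pow V \<times> Pow V \<times> Pow V \<times> Pow V"]) (use V in \<open>auto simp: Q_def\<close>)
  have card_eqs: "card A + card B = d \<and> card B + card D = d \<and> card A + card C = d \<and> card C + card D = d"
    if "(A,B,C,D) \<in> Q" "quad (A,B,C,D) \<noteq> 0" for A B C D
  proof -
    have fin: "finite A" "finite B" "finite C" "finite D" using that(1) V finite_subset by (auto simp: Q_def)
    have "card (A \<union> B) = d" "card (B \<union> D) = d" "card (A \<union> C) = d" "card (C \<union> D) = d"
      using that(2) deg by (auto simp: quad_def)
    moreover have "A \<inter> B = {}" "B \<inter> D = {}" "A \<inter> C = {}" "C \<inter> D = {}" using that(1) by (auto simp: Q_def)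
    ultimately show ?thesis using fin by (auto simp: card_Un_disjoint)
  qed
  have tot: "(\<Sum>W\<in>Pow V. (\<Sum>S\<in>Pow W. c S * c (W - S))\<^sup>2) = sum quad Q0"
    unfolding sum_squares_as_disjoint_quadruples[OF V] quad_def Q0_def Q_def
    by (rule sum.cong) auto
  \<comment> \<open>\<open>S = T\<close> corresponds to \<open>B = {}\<close>, and \<open>S = W - T\<close> to \<open>A = {}\<close>.\<close>
  define Qa where "Qa = {q \<in> Q0. case q of (A,B,C,D) \<Rightarrow> A = {}}"
  define Qb where "Qb = {q \<in> Q0. case q of (A,B,C,D) \<Rightarrow> A \<noteq> {} \<and> B = {}}"
  define Qr where "Qr = {q \<in> Q0. case q of (A,B,C,D) \<Rightarrow> A \<noteq> {} \<and> B \<noteq> {}}"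
  have fins: "finite Q0" "finite Qa" "finite Qb" "finite Qr"
    using finQ by (auto simp: Q0_def Qa_def Qb_def Qr_def)
  have split: "sum quad Q0 = sum quad Qa + sum quad Qb + sum quad Qr"
  proof -
    have "Q0 = Qa \<union> Qb \<union> Qr" by (auto simp: Qa_def Qb_def Qr_def)
    moreover have "Qa \<inter> Qb = {}" "(Qa \<union> Qb) \<inter> Qr = {}" by (auto simp: Qa_def Qb_def Qr_def)
    ultimately show ?thesis using fins by (simp add: sum.union_disjoint)
  qed
  define dis where "dis = (\<Sum>(S,T) | S \<subseteq> V \<and> T \<subseteq> V \<and> S \<inter> T = {}. (c S)\<^sup>2 * (c T)\<^sup>2)"
  have c_empty: "c {} = 0" using deg[of "{}"] d by auto
  have qa: "sum quad Qa = dis"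
  proof -
    have "dis = (\<Sum>(S,T)\<in>{(S,T). S \<subseteq> V \<and> T \<subseteq> V \<and> S \<inter> T = {}}. quad ({},S,T,{}))"
      unfolding dis_def by (intro sum.cong) (auto simp: quad_def power2_eq_square)
    also have "\<dots> = sum quad ((\<lambda>(S,T). ({},S,T,{})) ` {(S,T). S \<subseteq> V \<and> T \<subseteq> V \<and> S \<inter> T = {}})"
      by (subst sum.reindex) (auto simp: inj_on_def split: prod.splits intro!: sum.cong)
    also have "\<dots> = sum quad Qa"
    proof (rule sum.mono_neutral_left[OF fins(2)])
      show "(\<lambda>(S,T). ({},S,T,{})) ` {(S,T). S \<subseteq> V \<and> T \<subseteq> V \<and> S \<inter> T = {}} \<subseteq> Qa"
        by (auto simp: Qa_def Q0_def Q_def)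
      show "\<forall>q\<in>Qa - (\<lambda>(S,T). ({},S,T,{})) ` {(S,T). S \<subseteq> V \<and> T \<subseteq> V \<and> S \<inter> T = {}}. quad q = 0"
      proof
        fix q assume q: "q \<in> Qa - (\<lambda>(S,T). ({},S,T,{})) ` {(S,T). S \<subseteq> V \<and> T \<subseteq> V \<and> S \<inter> T = {}}"
        obtain A B C D where abcd: "q = (A,B,C,D)" by (cases q) auto
        have *: "A = {}" "(A,B,C,D) \<in> Q" "D \<noteq> {}"
          using q unfolding abcd by (auto simp: Qa_def Q0_def Q_def image_iff)
        then have "finite D" using V finite_subset by (auto simp: Q_def)
        then show "quad q = 0" using card_eqs[OF *(2)] * unfolding abcd by (metis add_cancel_right_right card.empty card_0_eq add.commute)
      qed
    qed
    finally show ?thesis by simp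
  qed
  have qb: "sum quad Qb = dis"
  proof -
    have "dis = (\<Sum>(S,T)\<in>{(S,T). S \<subseteq> V \<and> T \<subseteq> V \<and> S \<inter> T = {} \<and> S \<noteq> {}}. (c S)\<^sup>2 * (c T)\<^sup>2)"
      unfolding dis_def
      by (rule sum.mono_neutral_right, rule finite_subset[of _ "Pow V \<times> Pow V"]) (use V in \<open>auto simp: c_empty\<close>)
    also have "\<dots> = (\<Sum>(S,T)\<in>{(S,T). S \<subseteq> V \<and> T \<subseteq> V \<and> S \<inter> T = {} \<and> S \<noteq> {}}. quad (S,{},{},T))"
      unfolding dis_def by (intro sum.cong) (auto simp: quad_def power2_eq_square)
    also have "\<dots> = sum quad ((\<lambda>(S,T). (S,{},{},T)) ` {(S,T). S \<subseteq> V \<and> T \<subseteq> V \<and> S \<inter> T = {} \<and> S \<noteq> {}})"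
      by (subst sum.reindex) (auto simp: inj_on_def split: prod.splits intro!: sum.cong)
    also have "\<dots> = sum quad Qb"
    proof (rule sum.mono_neutral_left[OF fins(3)])
      show "(\<lambda>(S,T). (S,{},{},T)) ` {(S,T). S \<subseteq> V \<and> T \<subseteq> V \<and> S \<inter> T = {} \<and> S \<noteq> {}} \<subseteq> Qb"
        by (auto simp: Qb_def Q0_def Q_def)
      show "\<forall>q\<in>Qb - (\<lambda>(S,T). (S,{},{},T)) ` {(S,T). S \<subseteq> V \<and> T \<subseteq> V \<and> S \<inter> T = {} \<and> S \<noteq> {}}. quad q = 0"
      proof
        fix q assume q: "q \<in> Qb - (\<lambda>(S,T). (S,{},{},T)) ` {(S,T). S \<subseteq> V \<and> T \<subseteq> V \<and> S \<inter> T = {} \<and> S \<noteq> {}}"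
        obtain A B C D where abcd: "q = (A,B,C,D)" by (cases q) auto
        have *: "B = {}" "(A,B,C,D) \<in> Q" "C \<noteq> {}"
          using q unfolding abcd by (auto simp: Qb_def Q0_def Q_def image_iff)
        then have "finite C" using V finite_subset by (auto simp: Q_def)
        then show "quad q = 0" using card_eqs[OF *(2)] * unfolding abcd by (metis add_cancel_right_right card.empty card_0_eq add.commute)
      qed
    qed
    finally show ?thesis by simp
  qed
  have dis_ge: "s\<^sup>2 - d * m * s \<le> dis"
  proof -
    define P where "P = {(S,T). S \<subseteq> V \<and> T \<subseteq> V \<and> S \<inter> T \<noteq> {}}"
    have P: "finite P" by (rule finite_subset[of _ "Pow V \<times> Pow V"]) (use V in \<open>auto simp: P_def\<close>)
    have "s\<^sup>2 = (\<Sum>(S,T)\<in>Pow V \<times> Pow V. (c S)\<^sup>2 * (c T)\<^sup>2)"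
      by (simp add: s_def power2_eq_square sum_product sum.cartesian_product)
    also have "Pow V \<times> Pow V = {(S,T). S \<subseteq> V \<and> T \<subseteq> V \<and> S \<inter> T = {}} \<union> P" by (auto simp: P_def)
    also have "(\<Sum>(S,T)\<in>\<dots>. (c S)\<^sup>2 * (c T)\<^sup>2) = dis + (\<Sum>(S,T)\<in>P. (c S)\<^sup>2 * (c T)\<^sup>2)"
      unfolding dis_def
      by (rule sum.union_disjoint, rule finite_subset[of _ "Pow V \<times> Pow V"]) (use V P in \<open>auto simp: P_def\<close>)
    finally have "s\<^sup>2 = dis + (\<Sum>(S,T)\<in>P. (c S)\<^sup>2 * (c T)\<^sup>2)" .
    moreover have "(\<Sum>q\<in>P. case q of (S,T) \<Rightarrow> (c S)\<^sup>2 * (c T)\<^sup>2) \<le>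
        (\<Sum>i\<in>V. \<Sum>q | q \<in> P \<and> i \<in> fst q \<inter> snd q. case q of (S,T) \<Rightarrow> (c S)\<^sup>2 * (c T)\<^sup>2)"
      by (rule sum_le_sum_over_witness[OF V P]) (auto simp: P_def)
    moreover have "\<dots> = (\<Sum>i\<in>V. (I i)\<^sup>2)"
    proof (rule sum.cong[OF refl])
      fix i assume "i \<in> V"
      show "(\<Sum>q | q \<in> P \<and> i \<in> fst q \<inter> snd q. case q of (S,T) \<Rightarrow> (c S)\<^sup>2 * (c T)\<^sup>2) = (I i)\<^sup>2"
        unfolding I_def power2_eq_square[of "sum _ _"] sum_product sum.cartesian_product
        by (rule sum.cong) (auto simp: P_def)
    qed
    ultimately show ?thesis using I2 by linarith
  qed
  \<comment> \<open>Without the constraint \<open>B \<inter> C = {}\<close>, the blocks \<open>B\<close> and \<open>C\<close> range over the same sets.\<close>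
  define E where "E = {q \<in> Q. case q of (A,B,C,D) \<Rightarrow> A \<noteq> {} \<and> B \<noteq> {} \<and> C \<noteq> {}}"
  define E1 where "E1 = {q \<in> E. case q of (A,B,C,D) \<Rightarrow> B \<inter> C \<noteq> {}}"
  have finE: "finite E" "finite E1" using finQ by (auto simp: E_def E1_def)
  have qr: "sum quad Qr = sum quad E - sum quad E1"
  proof -
    have "sum quad Qr = sum quad (E - E1)"
    proof (rule sum.mono_neutral_right[OF fins(4)])
      show "E - E1 \<subseteq> Qr" by (auto simp: E_def E1_def Qr_def Q0_def)
      show "\<forall>q\<in>Qr - (E - E1). quad q = 0"
      proof
        fix q assume q: "q \<in> Qr - (E - E1)"
        obtain A B C D where abcd: "q = (A,B,C,D)" by (cases q) auto
        have *: "C = {}" "B \<noteq> {}" "(A,B,C,D) \<in> Q"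
          using q unfolding abcd by (auto simp: Qr_def Q0_def E_def E1_def)
        then have "finite B" using V finite_subset by (auto simp: Q_def)
        then show "quad q = 0" using card_eqs[OF *(3)] * unfolding abcd by (metis add_cancel_right_right card.empty card_0_eq)
      qed
    qed
    also have "\<dots> = sum quad E - sum quad E1"
      by (rule sum_diff[OF finE(1)]) (auto simp: E1_def)
    finally show ?thesis .
  qed
  have e: "0 \<le> sum quad E"
  proof -
    define AD where "AD = {(A,D). A \<subseteq> V \<and> D \<subseteq> V \<and> A \<inter> D = {} \<and> A \<noteq> {}}"
    define BB where "BB = (\<lambda>(A,D). {B. B \<subseteq> V \<and> B \<noteq> {} \<and> (A \<union> D) \<inter> B = {}})"
    have fAD: "finite AD" by (rule finite_subset[of _ "Pow V \<times> Pow V"]) (use V in \<open>auto simp: AD_def\<close>)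
    have fBB: "finite (BB ad)" for ad by (cases ad) (use V in \<open>auto simp: BB_def\<close>)
    have "sum quad E = (\<Sum>(ad,bc)\<in>Sigma AD (\<lambda>ad. BB ad \<times> BB ad). quad (fst ad, fst bc, snd bc, snd ad))"
      by (rule sum.reindex_bij_witness[where i = "\<lambda>((A,D),(B,C)). (A,B,C,D)" and j = "\<lambda>(A,B,C,D). ((A,D),(B,C))"])
         (auto simp: E_def Q_def AD_def BB_def)
    also have "\<dots> = (\<Sum>ad\<in>AD. \<Sum>bc\<in>BB ad \<times> BB ad. quad (fst ad, fst bc, snd bc, snd ad))"
      using fAD fBB by (subst sum.Sigma) auto
    also have "\<dots> = (\<Sum>ad\<in>AD. (\<Sum>B\<in>BB ad. c (fst ad \<union> B) * c (B \<union> snd ad))\<^sup>2)"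
      by (auto simp: quad_def power2_eq_square sum_product sum.cartesian_product split_beta intro!: sum.cong)
    also have "\<dots> \<ge> 0" by (intro sum_nonneg) auto
    finally show ?thesis .
  qed
  have e1: "sum quad E1 \<le> 4 ^ d * real d * m * s"
  proof -
    have "sum quad E1 \<le> (\<Sum>q\<in>E1. \<bar>quad q\<bar>)" by (intro sum_mono) auto
    also have "\<dots> \<le> (\<Sum>i\<in>V. \<Sum>q | q \<in> E1 \<and> (case q of (A,B,C,D) \<Rightarrow> i \<in> B \<inter> C). \<bar>quad q\<bar>)"
    proof (rule sum_le_sum_over_witness[OF V finE(2)])
      fix q assume q: "q \<in> E1"
      obtain A B C D where abcd: "q = (A,B,C,D)" by (cases q) auto
      have "B \<subseteq> V" "B \<inter> C \<noteq> {}" using q unfolding abcd E1_def E_def Q_def by simp_all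
      then show "\<exists>i\<in>V. case q of (A,B,C,D) \<Rightarrow> i \<in> B \<inter> C" unfolding abcd by auto
    qed simp
    also have "\<dots> \<le> (\<Sum>i\<in>V. 4 ^ d * (I i)\<^sup>2)"
    proof (rule sum_mono)
      fix i assume "i \<in> V"
      define Ei where "Ei = {q \<in> E1. case q of (A,B,C,D) \<Rightarrow> i \<in> B \<inter> C}"
      define T where "T = {(A,B). A \<subseteq> V \<and> B \<subseteq> V \<and> A \<inter> B = {} \<and> i \<in> A \<union> B}"
      have T: "finite T" by (rule finite_subset[of _ "Pow V \<times> Pow V"]) (use V in \<open>auto simp: T_def\<close>)
      define u where "u = (\<lambda>(A,B). (c (A \<union> B))\<^sup>2)"
      have u0: "0 \<le> u x" for x by (auto simp: u_def split: prod.splits)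
      have uT: "sum u T \<le> 2 ^ d * I i"
        using sum_split_pairs_le[of V c d i, OF V deg] by (simp add: u_def T_def I_def)
      have prod_le: "sum (\<lambda>q. u (f q) * u (g q)) Ei \<le> 4 ^ d * (I i)\<^sup>2"
        if inj: "inj_on (\<lambda>q. (f q, g q)) Ei" and im: "\<And>q. q \<in> Ei \<Longrightarrow> f q \<in> T \<and> g q \<in> T"
        for f g :: "'i set \<times> 'i set \<times> 'i set \<times> 'i set \<Rightarrow> 'i set \<times> 'i set"
      proof -
        have "sum (\<lambda>q. u (f q) * u (g q)) Ei = sum (\<lambda>(x,y). u x * u y) ((\<lambda>q. (f q, g q)) ` Ei)"
          by (subst sum.reindex[OF inj]) (simp add: o_def)
        also have "\<dots> \<le> sum (\<lambda>(x,y). u x * u y) (T \<times> T)"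
          by (rule sum_mono2) (use T im u0 in \<open>auto intro!: mult_nonneg_nonneg\<close>)
        also have "\<dots> = sum u T * sum u T" by (simp add: sum_product sum.cartesian_product)
        also have "\<dots> \<le> (2 ^ d * I i) * (2 ^ d * I i)"
          using uT u0 I0 by (intro mult_mono) (auto intro!: sum_nonneg)
        also have "\<dots> = 4 ^ d * (I i)\<^sup>2"
          by (simp add: power2_eq_square power_mult_distrib[symmetric] ac_simps flip: mult.assoc)
        finally show ?thesis .
      qed
      have "(\<Sum>q\<in>Ei. \<bar>quad q\<bar>) \<le> (\<Sum>q\<in>Ei. 1/2 * (case q of (A,B,C,D) \<Rightarrow> u (A,B) * u (D,C)) + 1/2 * (case q of (A,B,C,D) \<Rightarrow> u (A,C) * u (D,B)))"
      proof (rule sum_mono)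
        fix q :: "'i set \<times> 'i set \<times> 'i set \<times> 'i set"
        obtain A B C D where abcd: "q = (A,B,C,D)" by (cases q) auto
        have "\<bar>quad q\<bar> = \<bar>c (A \<union> B) * c (C \<union> D)\<bar> * \<bar>c (A \<union> C) * c (B \<union> D)\<bar>"
          by (simp add: abcd quad_def abs_mult ac_simps)
        also have "\<dots> \<le> 1/2 * (c (A \<union> B) * c (C \<union> D))\<^sup>2 + 1/2 * (c (A \<union> C) * c (B \<union> D))\<^sup>2"
          using sum_squares_bound[of "\<bar>c (A \<union> B) * c (C \<union> D)\<bar>" "\<bar>c (A \<union> C) * c (B \<union> D)\<bar>"]
          by (simp add: power_mult_distrib)
        also have "\<dots> = 1/2 * (u (A,B) * u (D,C)) + 1/2 * (u (A,C) * u (D,B))"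
          by (simp add: u_def power_mult_distrib Un_commute)
        finally show "\<bar>quad q\<bar> \<le> 1/2 * (case q of (A,B,C,D) \<Rightarrow> u (A,B) * u (D,C)) + 1/2 * (case q of (A,B,C,D) \<Rightarrow> u (A,C) * u (D,B))"
          by (simp add: abcd)
      qed
      also have "\<dots> = 1/2 * (\<Sum>q\<in>Ei. u ((\<lambda>(A,B,C,D). (A,B)) q) * u ((\<lambda>(A,B,C,D). (D,C)) q))
          + 1/2 * (\<Sum>q\<in>Ei. u ((\<lambda>(A,B,C,D). (A,C)) q) * u ((\<lambda>(A,B,C,D). (D,B)) q))"
        by (auto simp: sum.distrib sum_distrib_left split_beta intro!: arg_cong2[of _ _ _ _ "(+)"] sum.cong)
      also have "\<dots> \<le> 1/2 * (4 ^ d * (I i)\<^sup>2) + 1/2 * (4 ^ d * (I i)\<^sup>2)"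
        by (intro add_mono mult_left_mono prod_le)
           (auto simp: inj_on_def Ei_def E1_def E_def Q_def T_def)
      finally show "(\<Sum>q | q \<in> E1 \<and> (case q of (A,B,C,D) \<Rightarrow> i \<in> B \<inter> C). \<bar>quad q\<bar>) \<le> 4 ^ d * (I i)\<^sup>2"
        by (simp add: Ei_def mult.commute)
    qed
    also have "\<dots> = 4 ^ d * (\<Sum>i\<in>V. (I i)\<^sup>2)" by (simp add: sum_distrib_left)
    also have "\<dots> \<le> 4 ^ d * (d * m * s)" using I2 by (intro mult_left_mono) auto
    finally show ?thesis by (simp add: ac_simps)
  qed
  have "(4 ^ d + 2) * real d * m * s = 4 ^ d * real d * m * s + 2 * (real d * m * s)" by (simp add: algebra_simps)
  then show ?thesis
    unfolding tot split qa qb qr s_def[symmetric] using e e1 dis_ge by linarith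
qed

section \<open>Square-integrable functions\<close>

lemma integrable_mult_of_squares:
  fixes u v :: "'a \<Rightarrow> real"
  assumes [measurable]: "u \<in> borel_measurable M" "v \<in> borel_measurable M"
    and "integrable M (\<lambda>x. (u x)\<^sup>2)" "integrable M (\<lambda>x. (v x)\<^sup>2)"
  shows "integrable M (\<lambda>x. u x * v x)"
proof (rule Bochner_Integration.integrable_bound)
  show "integrable M (\<lambda>x. (u x)\<^sup>2 + (v x)\<^sup>2)" using assms by simp
  show "AE x in M. norm (u x * v x) \<le> norm ((u x)\<^sup>2 + (v x)\<^sup>2)"
  proof (rule AE_I2)
    fix x
    have "\<bar>u x * v x\<bar> \<le> (u x)\<^sup>2 + (v x)\<^sup>2"
      using sum_squares_bound[of "\<bar>u x\<bar>" "\<bar>v x\<bar>"] abs_ge_zero[of "u x * v x"]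
      unfolding abs_mult power2_abs by linarith
    then show "norm (u x * v x) \<le> norm ((u x)\<^sup>2 + (v x)\<^sup>2)" by simp
  qed
qed measurable

lemma integrable_square_sum:
  fixes u v :: "'a \<Rightarrow> real"
  assumes [measurable]: "u \<in> borel_measurable M" "v \<in> borel_measurable M"
    and "integrable M (\<lambda>x. (u x)\<^sup>2)" "integrable M (\<lambda>x. (v x)\<^sup>2)"
  shows "integrable M (\<lambda>x. (u x + v x)\<^sup>2)" "integrable M (\<lambda>x. (u x - v x)\<^sup>2)"
  using integrable_mult_of_squares[OF assms] assms(3,4)
  by (simp_all add: power2_sum power2_diff mult.assoc)

lemma Cauchy_Schwarz_integral:
  fixes u v :: "'a \<Rightarrow> real"
  assumes meas [measurable]: "u \<in> borel_measurable M" "v \<in> borel_measurable M"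
    and int: "integrable M (\<lambda>x. (u x)\<^sup>2)" "integrable M (\<lambda>x. (v x)\<^sup>2)"
  shows "(\<integral>x. u x * v x \<partial>M)\<^sup>2 \<le> (\<integral>x. (u x)\<^sup>2 \<partial>M) * (\<integral>x. (v x)\<^sup>2 \<partial>M)"
proof -
  define a b c where "a = (\<integral>x. (u x)\<^sup>2 \<partial>M)" and "b = (\<integral>x. u x * v x \<partial>M)" and "c = (\<integral>x. (v x)\<^sup>2 \<partial>M)"
  have uv: "integrable M (\<lambda>x. u x * v x)" by (rule integrable_mult_of_squares[OF assms])
  have quad: "0 \<le> a + 2 * t * b + t\<^sup>2 * c" for t
  proof -
    have "0 \<le> (\<integral>x. (u x + t * v x)\<^sup>2 \<partial>M)" by (intro Bochner_Integration.integral_nonneg) simp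
    also have "\<dots> = (\<integral>x. (u x)\<^sup>2 + 2 * t * (u x * v x) + t\<^sup>2 * (v x)\<^sup>2 \<partial>M)"
      by (intro Bochner_Integration.integral_cong) (auto simp: power2_sum power_mult_distrib)
    also have "\<dots> = a + 2 * t * b + t\<^sup>2 * c"
      using int uv by (simp add: a_def b_def c_def)
    finally show ?thesis .
  qed
  have "0 \<le> c" unfolding c_def by (intro Bochner_Integration.integral_nonneg) simp
  show ?thesis
  proof (cases "c = 0")
    case True
    have "b = 0"
    proof (rule ccontr)
      assume "b \<noteq> 0"
      then have "2 * (- (a + 1) / (2 * b)) * b = - (a + 1)" by simp
      then show False using quad[of "- (a + 1) / (2 * b)"] unfolding True by (simp only:)
    qed
    then show ?thesis using True by (simp add: a_def b_def c_def)
  next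
    case False
    then have "0 < c" using \<open>0 \<le> c\<close> by simp
    then have "0 \<le> a - b\<^sup>2 / c"
      using quad[of "- b / c"] by (simp add: power2_eq_square field_simps)
    then show ?thesis using \<open>0 < c\<close> by (simp add: a_def b_def c_def field_simps)
  qed
qed

lemma Cauchy_Schwarz_integral_sqrt:
  fixes u v :: "'a \<Rightarrow> real"
  assumes "u \<in> borel_measurable M" "v \<in> borel_measurable M"
    and "integrable M (\<lambda>x. (u x)\<^sup>2)" "integrable M (\<lambda>x. (v x)\<^sup>2)"
  shows "\<bar>\<integral>x. u x * v x \<partial>M\<bar> \<le> sqrt (\<integral>x. (u x)\<^sup>2 \<partial>M) * sqrt (\<integral>x. (v x)\<^sup>2 \<partial>M)"
  using real_sqrt_le_mono[OF Cauchy_Schwarz_integral[OF assms]] by (simp add: real_sqrt_mult)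


definition square_integrable :: "'a measure \<Rightarrow> ('a \<Rightarrow> real) \<Rightarrow> bool" where
  "square_integrable M u \<longleftrightarrow> u \<in> borel_measurable M \<and> integrable M (\<lambda>x. (u x)\<^sup>2)"

lemma L2_measurable: "square_integrable M u \<Longrightarrow> u \<in> borel_measurable M"
  and L2_integrable_sq: "square_integrable M u \<Longrightarrow> integrable M (\<lambda>x. (u x)\<^sup>2)"
  by (simp_all add: square_integrable_def)

lemma L2_integrable_mult: "square_integrable M u \<Longrightarrow> square_integrable M v \<Longrightarrow> integrable M (\<lambda>x. u x * v x)"
  unfolding square_integrable_def by (intro integrable_mult_of_squares) auto

lemma L2_add: "square_integrable M u \<Longrightarrow> square_integrable M v \<Longrightarrow> square_integrable M (\<lambda>x. u x + v x)"
  and L2_diff: "square_integrable M u \<Longrightarrow> square_integrable M v \<Longrightarrow> square_integrable M (\<lambda>x. u x - v x)"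
  and L2_cmult: "square_integrable M u \<Longrightarrow> square_integrable M (\<lambda>x. a * u x)"
  unfolding square_integrable_def by (auto intro: integrable_square_sum simp: power_mult_distrib)

lemma L2_zero: "square_integrable M (\<lambda>x. 0)"
  by (simp add: square_integrable_def)

lemma L2_sum: "(\<And>i. i \<in> I \<Longrightarrow> square_integrable M (u i)) \<Longrightarrow> square_integrable M (\<lambda>x. \<Sum>i\<in>I. u i x)"
  by (induction I rule: infinite_finite_induct) (auto intro: L2_add L2_zero)

lemma L2_Cauchy_Schwarz:
  "square_integrable M u \<Longrightarrow> square_integrable M v \<Longrightarrow> \<bar>\<integral>x. u x * v x \<partial>M\<bar> \<le> sqrt (\<integral>x. (u x)\<^sup>2 \<partial>M) * sqrt (\<integral>x. (v x)\<^sup>2 \<partial>M)"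
  unfolding square_integrable_def by (intro Cauchy_Schwarz_integral_sqrt) auto

lemma (in prob_space) L2_integrable: "square_integrable M u \<Longrightarrow> integrable M u"
  using L2_integrable_mult[of M u "\<lambda>_. 1"] by (simp add: square_integrable_def)

lemma (in prob_space) integral_abs_le_L2: 
  assumes "square_integrable M u" shows "(\<integral>x. \<bar>u x\<bar> \<partial>M) \<le> sqrt (\<integral>x. (u x)\<^sup>2 \<partial>M)"
proof -
  have "square_integrable M (\<lambda>x. \<bar>u x\<bar>)" "square_integrable M (\<lambda>_. 1)" using assms by (auto simp: square_integrable_def)
  from L2_Cauchy_Schwarz[OF this] show ?thesis by (simp add: prob_space)
qed

lemma (in prob_space) integrable_power_of_fourth:
  fixes u :: "'a \<Rightarrow> real"
  assumes [measurable]: "u \<in> borel_measurable M" and u4: "integrable M (\<lambda>x. u x ^ 4)" and "j \<le> 4"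
  shows "integrable M (\<lambda>x. u x ^ j)"
proof (rule Bochner_Integration.integrable_bound)
  show "integrable M (\<lambda>x. 1 + u x ^ 4)" using u4 by simp
  show "AE x in M. norm (u x ^ j) \<le> norm (1 + u x ^ 4)"
  proof (rule AE_I2)
    fix x
    have "\<bar>u x\<bar> ^ j \<le> 1 + \<bar>u x\<bar> ^ 4"
    proof (cases "\<bar>u x\<bar> \<le> 1")
      case True
      then have "\<bar>u x\<bar> ^ j \<le> 1" by (intro power_le_one) auto
      then show ?thesis by (rule order_trans) simp
    next
      case False
      then have "\<bar>u x\<bar> ^ j \<le> \<bar>u x\<bar> ^ 4" using assms(3) by (intro power_increasing) auto
      then show ?thesis by simp
    qed
    then show "norm (u x ^ j) \<le> norm (1 + u x ^ 4)" by (simp add: power_abs)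
  qed
qed measurable

definition L2_tendsto :: "'a measure \<Rightarrow> (nat \<Rightarrow> 'a \<Rightarrow> real) \<Rightarrow> ('a \<Rightarrow> real) \<Rightarrow> bool" where
  "L2_tendsto M u u0 \<longleftrightarrow> (\<forall>n. square_integrable M (u n)) \<and> square_integrable M u0 \<and> (\<lambda>n. \<integral>x. (u n x - u0 x)\<^sup>2 \<partial>M) \<longlonglongrightarrow> 0"

lemma L2_tendsto_const: "square_integrable M u \<Longrightarrow> L2_tendsto M (\<lambda>_. u) u"
  by (simp add: L2_tendsto_def)

lemma L2_tendsto_cmult: "L2_tendsto M u u0 \<Longrightarrow> L2_tendsto M (\<lambda>n x. a * u n x) (\<lambda>x. a * u0 x)"
  unfolding L2_tendsto_def
  by (auto simp: L2_cmult right_diff_distrib[symmetric] power_mult_distrib intro!: tendsto_mult_right_zero)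

lemma L2_tendsto_add:
  assumes u: "L2_tendsto M u u0" and v: "L2_tendsto M v v0"
  shows "L2_tendsto M (\<lambda>n x. u n x + v n x) (\<lambda>x. u0 x + v0 x)"
proof -
  have *: "square_integrable M (\<lambda>x. u n x - u0 x)" "square_integrable M (\<lambda>x. v n x - v0 x)" for n
    using u v by (auto simp: L2_tendsto_def intro: L2_diff)
  have "(\<lambda>n. \<integral>x. ((u n x + v n x) - (u0 x + v0 x))\<^sup>2 \<partial>M) \<longlonglongrightarrow> 0"
  proof (rule tendsto_sandwich[OF _ _ tendsto_const])
    have "(\<lambda>n. 2 * (\<integral>x. (u n x - u0 x)\<^sup>2 \<partial>M) + 2 * (\<integral>x. (v n x - v0 x)\<^sup>2 \<partial>M)) \<longlonglongrightarrow> 2 * 0 + 2 * 0"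
      using u v by (intro tendsto_intros) (auto simp: L2_tendsto_def)
    then show "(\<lambda>n. 2 * (\<integral>x. (u n x - u0 x)\<^sup>2 \<partial>M) + 2 * (\<integral>x. (v n x - v0 x)\<^sup>2 \<partial>M)) \<longlonglongrightarrow> 0" by simp
    show "\<forall>\<^sub>F n in sequentially. (\<integral>x. ((u n x + v n x) - (u0 x + v0 x))\<^sup>2 \<partial>M)
        \<le> 2 * (\<integral>x. (u n x - u0 x)\<^sup>2 \<partial>M) + 2 * (\<integral>x. (v n x - v0 x)\<^sup>2 \<partial>M)"
    proof (rule always_eventually, rule allI)
      fix n
      have "(\<integral>x. ((u n x + v n x) - (u0 x + v0 x))\<^sup>2 \<partial>M) \<le> (\<integral>x. 2 * (u n x - u0 x)\<^sup>2 + 2 * (v n x - v0 x)\<^sup>2 \<partial>M)"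
      proof (rule integral_mono)
        have "square_integrable M (\<lambda>x. (u n x - u0 x) + (v n x - v0 x))" using * by (rule L2_add)
        then show "integrable M (\<lambda>x. ((u n x + v n x) - (u0 x + v0 x))\<^sup>2)"
          by (simp add: square_integrable_def algebra_simps)
        show "integrable M (\<lambda>x. 2 * (u n x - u0 x)\<^sup>2 + 2 * (v n x - v0 x)\<^sup>2)"
          using *[of n, THEN L2_integrable_sq] by simp
        fix x
        show "((u n x + v n x) - (u0 x + v0 x))\<^sup>2 \<le> 2 * (u n x - u0 x)\<^sup>2 + 2 * (v n x - v0 x)\<^sup>2"
          using zero_le_power2[of "(u n x - u0 x) - (v n x - v0 x)"] by (simp add: power2_eq_square algebra_simps)
      qed
      also have "\<dots> = 2 * (\<integral>x. (u n x - u0 x)\<^sup>2 \<partial>M) + 2 * (\<integral>x. (v n x - v0 x)\<^sup>2 \<partial>M)"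
        using *[of n, THEN L2_integrable_sq] by simp
      finally show "(\<integral>x. ((u n x + v n x) - (u0 x + v0 x))\<^sup>2 \<partial>M) \<le> \<dots>" .
    qed
  qed auto
  then show ?thesis using u v by (auto simp: L2_tendsto_def intro: L2_add)
qed

lemma L2_tendsto_sum:
  "(\<And>i. i \<in> I \<Longrightarrow> L2_tendsto M (u i) (u0 i)) \<Longrightarrow> L2_tendsto M (\<lambda>n x. \<Sum>i\<in>I. u i n x) (\<lambda>x. \<Sum>i\<in>I. u0 i x)"
  by (induction I rule: infinite_finite_induct) (auto intro: L2_tendsto_add L2_tendsto_const L2_zero)

lemma L2_tendsto_inner:
  assumes u: "L2_tendsto M u u0" and v: "L2_tendsto M v v0"
  shows "(\<lambda>n. \<integral>x. u n x * v n x \<partial>M) \<longlonglongrightarrow> (\<integral>x. u0 x * v0 x \<partial>M)"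
proof (rule LIM_zero_cancel)
  define e f where "e n = (\<integral>x. (u n x - u0 x)\<^sup>2 \<partial>M)" and "f n = (\<integral>x. (v n x - v0 x)\<^sup>2 \<partial>M)" for n
  define a b where "a = (\<integral>x. (u0 x)\<^sup>2 \<partial>M)" and "b = (\<integral>x. (v0 x)\<^sup>2 \<partial>M)"
  have L: "square_integrable M (\<lambda>x. u n x - u0 x)" "square_integrable M (\<lambda>x. v n x - v0 x)" "square_integrable M u0" "square_integrable M v0" "square_integrable M (u n)" "square_integrable M (v n)" for n
    using u v by (auto simp: L2_tendsto_def intro: L2_diff)
  have "e \<longlonglongrightarrow> 0" "f \<longlonglongrightarrow> 0" using u v by (auto simp: L2_tendsto_def e_def[abs_def] f_def[abs_def])
  then have "(\<lambda>n. sqrt (e n) * sqrt (f n) + sqrt (e n) * sqrt b + sqrt a * sqrt (f n)) \<longlonglongrightarrow> sqrt 0 * sqrt 0 + sqrt 0 * sqrt b + sqrt a * sqrt 0"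
    by (intro tendsto_intros)
  then have lim: "(\<lambda>n. sqrt (e n) * sqrt (f n) + sqrt (e n) * sqrt b + sqrt a * sqrt (f n)) \<longlonglongrightarrow> 0" by simp
  show "(\<lambda>n. (\<integral>x. u n x * v n x \<partial>M) - (\<integral>x. u0 x * v0 x \<partial>M)) \<longlonglongrightarrow> 0"
  proof (rule Lim_null_comparison[OF always_eventually lim], rule allI)
    fix n
    note L = L(1)[of n] L(2)[of n] L(3) L(4) L(5)[of n] L(6)[of n]
    have "(\<integral>x. u n x * v n x \<partial>M) - (\<integral>x. u0 x * v0 x \<partial>M)
        = (\<integral>x. (u n x - u0 x) * (v n x - v0 x) + (u n x - u0 x) * v0 x + u0 x * (v n x - v0 x) \<partial>M)"
      by (subst Bochner_Integration.integral_diff[symmetric])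
         (auto intro!: L2_integrable_mult L Bochner_Integration.integral_cong simp: algebra_simps)
    also have "\<dots> = (\<integral>x. (u n x - u0 x) * (v n x - v0 x) \<partial>M) + (\<integral>x. (u n x - u0 x) * v0 x \<partial>M) + (\<integral>x. u0 x * (v n x - v0 x) \<partial>M)"
      using L2_integrable_mult[OF L(1) L(2)] L2_integrable_mult[OF L(1) L(4)] L2_integrable_mult[OF L(3) L(2)] by simp
    finally show "norm ((\<integral>x. u n x * v n x \<partial>M) - (\<integral>x. u0 x * v0 x \<partial>M)) \<le> sqrt (e n) * sqrt (f n) + sqrt (e n) * sqrt b + sqrt a * sqrt (f n)"
      using L2_Cauchy_Schwarz[OF L(1) L(2)] L2_Cauchy_Schwarz[OF L(1) L(4)] L2_Cauchy_Schwarz[OF L(3) L(2)]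
      unfolding e_def f_def a_def b_def real_norm_def by linarith
  qed
qed

lemma L2_tendsto_norm:
  "L2_tendsto M u u0 \<Longrightarrow> (\<lambda>n. \<integral>x. (u n x)\<^sup>2 \<partial>M) \<longlonglongrightarrow> (\<integral>x. (u0 x)\<^sup>2 \<partial>M)"
  using L2_tendsto_inner[of M u u0 u u0] by (simp add: power2_eq_square)

section \<open>The biased cube, its coordinate flips and its Walsh functions\<close>

definition flip :: "nat \<Rightarrow> (nat \<Rightarrow> bool) \<Rightarrow> nat \<Rightarrow> bool" where
  "flip k x = x(k := \<not> x k)"

lemma flip_flip [simp]: "flip k (flip k x) = x"
  by (auto simp: flip_def)

locale biased_cube =
  fixes p :: "nat \<Rightarrow> real"
  assumes p_gt_0: "0 < p k" and p_lt_1: "p k < 1"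
begin

definition cube :: "(nat \<Rightarrow> bool) measure" where
  "cube = PiM UNIV (\<lambda>k. measure_pmf (bernoulli_pmf (p k)))"

sublocale prob_space cube
  unfolding cube_def by (intro prob_space_PiM) (simp add: prob_space_measure_pmf)

lemma space_cube [simp]: "space cube = UNIV"
  by (simp add: cube_def space_PiM)

text \<open>The probability that a fresh draw of coordinate \<open>k\<close> differs from its present value.\<close>
definition rate :: "nat \<Rightarrow> (nat \<Rightarrow> bool) \<Rightarrow> real" where
  "rate k x = (if x k then 1 - p k else p k)"

lemma rate_pos: "0 < rate k x" and rate_le_1: "rate k x \<le> 1"
  using p_gt_0[of k] p_lt_1[of k] by (auto simp: rate_def)

lemma coordinate_measurable [measurable]: "(\<lambda>x. x k) \<in> cube \<rightarrow>\<^sub>M count_space UNIV"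
proof -
  have "(\<lambda>x. x k) \<in> cube \<rightarrow>\<^sub>M measure_pmf (bernoulli_pmf (p k))"
    unfolding cube_def by (rule measurable_component_singleton) simp
  then show ?thesis by simp
qed

lemma rate_measurable [measurable]: "rate k \<in> borel_measurable cube"
  unfolding rate_def by measurable

lemma upd_measurable: "(\<lambda>x. x(k := b)) \<in> cube \<rightarrow>\<^sub>M cube"
  unfolding cube_def
proof (rule measurable_PiM_single')
  fix i :: nat
  have "(\<lambda>x. (x(k := b)) i) = (if i = k then (\<lambda>x. b) else (\<lambda>x. x i))" by auto
  then show "(\<lambda>x. (x(k := b)) i) \<in> PiM UNIV (\<lambda>k. measure_pmf (bernoulli_pmf (p k))) \<rightarrow>\<^sub>M measure_pmf (bernoulli_pmf (p i))"
    using measurable_component_singleton[of i UNIV "\<lambda>k. measure_pmf (bernoulli_pmf (p k))"]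
    by (auto simp del: measurable_pmf_measure1 measurable_pmf_measure2)
qed auto

lemma flip_measurable [measurable]: "flip k \<in> cube \<rightarrow>\<^sub>M cube"
proof -
  have "flip k = (\<lambda>x. if x k then x(k := False) else x(k := True))" by (auto simp: flip_def)
  then show ?thesis using upd_measurable by (auto intro!: measurable_If)
qed

lemma nn_integral_cube_resample:
  assumes g [measurable]: "g \<in> borel_measurable cube"
  shows "(\<integral>\<^sup>+x. g x \<partial>cube) = (\<integral>\<^sup>+x. g (x(k := True)) \<partial>cube) * p k + (\<integral>\<^sup>+x. g (x(k := False)) \<partial>cube) * (1 - p k)"
proof -
  let ?B = "measure_pmf (bernoulli_pmf (p k))"
  have eq: "distr (?B \<Otimes>\<^sub>M cube) cube (\<lambda>(b, x). x(k := b)) = cube"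
    using distr_pair_PiM_eq_PiM[of UNIV "\<lambda>k. measure_pmf (bernoulli_pmf (p k))" k]
    by (simp add: cube_def prob_space_measure_pmf)
  have m [measurable]: "(\<lambda>(b, x). x(k := b)) \<in> ?B \<Otimes>\<^sub>M cube \<rightarrow>\<^sub>M cube"
  proof -
    have "(\<lambda>(b, x). x(k := b)) = (\<lambda>bx. if fst bx then (snd bx)(k := True) else (snd bx)(k := False))"
      by (auto simp: fun_eq_iff)
    moreover have "\<dots> \<in> ?B \<Otimes>\<^sub>M cube \<rightarrow>\<^sub>M cube"
      by (intro measurable_If measurable_compose[OF measurable_snd upd_measurable]) simp
    ultimately show ?thesis by simp
  qed
  have "(\<integral>\<^sup>+x. g x \<partial>cube) = (\<integral>\<^sup>+x. g x \<partial>distr (?B \<Otimes>\<^sub>M cube) cube (\<lambda>(b, x). x(k := b)))"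
    by (simp only: eq)
  also have "\<dots> = (\<integral>\<^sup>+bx. g ((\<lambda>(b, x). x(k := b)) bx) \<partial>(?B \<Otimes>\<^sub>M cube))"
    by (rule nn_integral_distr) auto
  also have "\<dots> = (\<integral>\<^sup>+b. \<integral>\<^sup>+x. g (x(k := b)) \<partial>cube \<partial>?B)"
    by (subst nn_integral_fst[symmetric]) (auto simp: split_beta)
  also have "\<dots> = (\<integral>\<^sup>+x. g (x(k := True)) \<partial>cube) * p k + (\<integral>\<^sup>+x. g (x(k := False)) \<partial>cube) * (1 - p k)"
    using p_gt_0[of k] p_lt_1[of k] by (simp add: nn_integral_bernoulli_pmf)
  finally show ?thesis .
qed

lemma nn_integral_flip:
  assumes g [measurable]: "g \<in> borel_measurable cube"
  shows "(\<integral>\<^sup>+x. ennreal (rate k x) * g (flip k x) \<partial>cube) = (\<integral>\<^sup>+x. ennreal (rate k x) * g x \<partial>cube)"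
proof -
  have [measurable]: "(\<lambda>x. g (x(k := b))) \<in> borel_measurable cube" for b
    by (rule measurable_compose[OF upd_measurable g])
  have f: "flip k (x(k := b)) = x(k := \<not> b)" for x b by (auto simp: flip_def)
  show ?thesis
    using p_gt_0[of k] p_lt_1[of k]
    by (subst (1 2) nn_integral_cube_resample[of _ k])
       (auto simp: f rate_def nn_integral_cmult ac_simps)
qed

lemma density_flip_invariant:
  "distr (density cube (\<lambda>x. ennreal (rate k x))) (density cube (\<lambda>x. ennreal (rate k x))) (flip k) = density cube (\<lambda>x. ennreal (rate k x))"
proof (rule measure_eqI)
  fix A assume "A \<in> sets (distr (density cube (\<lambda>x. ennreal (rate k x))) (density cube (\<lambda>x. ennreal (rate k x))) (flip k))"
  then have A [measurable]: "A \<in> sets cube" by simp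
  have "emeasure (distr (density cube (\<lambda>x. ennreal (rate k x))) (density cube (\<lambda>x. ennreal (rate k x))) (flip k)) A
      = emeasure (density cube (\<lambda>x. ennreal (rate k x))) (flip k -` A \<inter> UNIV)"
    by (subst emeasure_distr) auto
  also have "\<dots> = (\<integral>\<^sup>+x. ennreal (rate k x) * indicator (flip k -` A \<inter> UNIV) x \<partial>cube)"
    using measurable_sets[OF flip_measurable A, of k] by (subst emeasure_density) auto
  also have "\<dots> = (\<integral>\<^sup>+x. ennreal (rate k x) * indicator A (flip k x) \<partial>cube)"
    by (intro nn_integral_cong) (auto simp: indicator_def)
  also have "\<dots> = (\<integral>\<^sup>+x. ennreal (rate k x) * indicator A x \<partial>cube)"
    by (rule nn_integral_flip) auto
  also have "\<dots> = emeasure (density cube (\<lambda>x. ennreal (rate k x))) A"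
    by (subst emeasure_density) auto
  finally show "emeasure (distr (density cube (\<lambda>x. ennreal (rate k x))) (density cube (\<lambda>x. ennreal (rate k x))) (flip k)) A
      = emeasure (density cube (\<lambda>x. ennreal (rate k x))) A" .
qed simp

text \<open>
  Detailed balance: the cube weighted with \<open>rate k\<close> is invariant under \<open>flip k\<close>. The symmetry of the
  generator and the stationarity of the cube are both instances.
\<close>
lemma integral_flip:
  fixes g :: "(nat \<Rightarrow> bool) \<Rightarrow> real"
  assumes g [measurable]: "g \<in> borel_measurable cube"
  shows "(\<integral>x. rate k x * g (flip k x) \<partial>cube) = (\<integral>x. rate k x * g x \<partial>cube)"
    and "integrable cube (\<lambda>x. rate k x * g (flip k x)) \<longleftrightarrow> integrable cube (\<lambda>x. rate k x * g x)"
proof -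
  let ?D = "density cube (\<lambda>x. ennreal (rate k x))"
  have nn: "AE x in cube. 0 \<le> rate k x" using rate_pos by (auto intro: less_imp_le)
  have "(\<integral>x. rate k x * g (flip k x) \<partial>cube) = (\<integral>x. g (flip k x) \<partial>?D)"
    using nn by (subst integral_density) auto
  also have "\<dots> = (\<integral>x. g x \<partial>distr ?D ?D (flip k))"
    by (subst integral_distr) auto
  also have "\<dots> = (\<integral>x. rate k x * g x \<partial>cube)"
    unfolding density_flip_invariant using nn by (subst integral_density) auto
  finally show "(\<integral>x. rate k x * g (flip k x) \<partial>cube) = (\<integral>x. rate k x * g x \<partial>cube)" .
  have "integrable cube (\<lambda>x. rate k x * g (flip k x)) \<longleftrightarrow> integrable ?D (\<lambda>x. g (flip k x))"
    using nn by (subst integrable_density) auto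
  also have "\<dots> \<longleftrightarrow> integrable (distr ?D ?D (flip k)) g"
    by (subst integrable_distr_eq) auto
  also have "\<dots> \<longleftrightarrow> integrable cube (\<lambda>x. rate k x * g x)"
    unfolding density_flip_invariant using nn by (subst integrable_density) auto
  finally show "integrable cube (\<lambda>x. rate k x * g (flip k x)) \<longleftrightarrow> integrable cube (\<lambda>x. rate k x * g x)" .
qed

lemma integrable_rate_mult:
  assumes "integrable cube g"
  shows "integrable cube (\<lambda>x. rate k x * (g x :: real))"
proof (rule Bochner_Integration.integrable_bound[OF assms])
  show "AE x in cube. norm (rate k x * g x) \<le> norm (g x)"
    using rate_pos rate_le_1 by (auto simp: abs_mult mult_left_le_one_le less_imp_le)
qed (use assms in measurable)

lemma integrable_rate_flip:
  assumes "integrable cube g"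
  shows "integrable cube (\<lambda>x. rate k x * (g (flip k x) :: real))"
  using integrable_rate_mult[OF assms] integral_flip(2)[OF borel_measurable_integrable[OF assms]] by simp

lemma integrable_flip:
  fixes g :: "(nat \<Rightarrow> bool) \<Rightarrow> real"
  assumes g: "integrable cube g"
  shows "integrable cube (\<lambda>x. g (flip k x))"
proof -
  note [measurable] = borel_measurable_integrable[OF g]
  show ?thesis
  proof (rule Bochner_Integration.integrable_bound)
    show "integrable cube (\<lambda>x. (1 / p k + 1 / (1 - p k)) * (rate k x * g (flip k x)))"
      using integrable_rate_flip[OF g, of k] by simp
    show "AE x in cube. norm (g (flip k x)) \<le> norm ((1 / p k + 1 / (1 - p k)) * (rate k x * g (flip k x)))"
    proof (rule AE_I2)
      fix x
      have "1 \<le> (1 / p k + 1 / (1 - p k)) * rate k x"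
        using p_gt_0[of k] p_lt_1[of k] by (auto simp: rate_def distrib_right)
      then have "\<bar>g (flip k x)\<bar> \<le> \<bar>(1 / p k + 1 / (1 - p k)) * rate k x\<bar> * \<bar>g (flip k x)\<bar>"
        by (intro mult_le_cancel_right1[THEN iffD2]) auto
      then show "norm (g (flip k x)) \<le> norm ((1 / p k + 1 / (1 - p k)) * (rate k x * g (flip k x)))"
        by (simp add: abs_mult ac_simps)
    qed
  qed measurable
qed

lemma AE_flip:
  assumes "AE x in cube. P x"
  shows "AE x in cube. P (flip k x)"
proof -
  obtain N where N: "{x \<in> space cube. \<not> P x} \<subseteq> N" "N \<in> sets cube" "emeasure cube N = 0"
    by (rule AE_E[OF assms])
  have [measurable]: "N \<in> sets cube" by fact
  have "(\<integral>\<^sup>+x. ennreal (rate k x) * indicator N (flip k x) \<partial>cube) = (\<integral>\<^sup>+x. ennreal (rate k x) * indicator N x \<partial>cube)"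
    by (rule nn_integral_flip) auto
  also have "\<dots> = 0"
    using AE_not_in[of N cube] N by (subst nn_integral_0_iff_AE) (auto simp: null_sets_def indicator_def)
  finally have "AE x in cube. ennreal (rate k x) * indicator N (flip k x) = 0"
    by (subst (asm) nn_integral_0_iff_AE) auto
  then show ?thesis
  proof (rule AE_mp, intro AE_I2 impI)
    fix x assume "ennreal (rate k x) * indicator N (flip k x) = 0"
    then have "flip k x \<notin> N" using rate_pos[of k x] by (auto simp: indicator_def ennreal_eq_0_iff split: if_splits)
    then show "P (flip k x)" using N(1) by auto
  qed
qed

text \<open>
  The generator of resampling coordinate \<open>k\<close>, that is, the conditional expectation given all other
  coordinates minus the identity.
\<close>
definition gen_at :: "nat \<Rightarrow> ((nat \<Rightarrow> bool) \<Rightarrow> real) \<Rightarrow> (nat \<Rightarrow> bool) \<Rightarrow> real" where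
  "gen_at k g x = rate k x * (g (flip k x) - g x)"

lemma integral_gen_at_symmetric:
  assumes [measurable]: "u \<in> borel_measurable cube" "v \<in> borel_measurable cube"
    and 1: "integrable cube (\<lambda>x. u x * v x)" and 2: "integrable cube (\<lambda>x. u (flip k x) * v x)"
  shows "(\<integral>x. gen_at k u x * v x \<partial>cube) = (\<integral>x. u x * gen_at k v x \<partial>cube)"
proof -
  have 3: "integrable cube (\<lambda>x. u x * v (flip k x))"
    using integrable_flip[OF 2, of k] by simp
  have "(\<integral>x. gen_at k u x * v x \<partial>cube) = (\<integral>x. rate k x * (u (flip k x) * v x) - rate k x * (u x * v x) \<partial>cube)"
    by (intro Bochner_Integration.integral_cong) (auto simp: gen_at_def algebra_simps)
  also have "\<dots> = (\<integral>x. rate k x * (u (flip k x) * v x) \<partial>cube) - (\<integral>x. rate k x * (u x * v x) \<partial>cube)"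
    by (intro Bochner_Integration.integral_diff integrable_rate_mult 1 2)
  also have "(\<integral>x. rate k x * (u (flip k x) * v x) \<partial>cube) = (\<integral>x. rate k x * (u x * v (flip k x)) \<partial>cube)"
    using integral_flip(1)[of "\<lambda>x. u x * v (flip k x)" k] by simp
  also have "(\<integral>x. rate k x * (u x * v (flip k x)) \<partial>cube) - (\<integral>x. rate k x * (u x * v x) \<partial>cube)
      = (\<integral>x. rate k x * (u x * v (flip k x)) - rate k x * (u x * v x) \<partial>cube)"
    by (intro Bochner_Integration.integral_diff[symmetric] integrable_rate_mult 1 3)
  also have "\<dots> = (\<integral>x. u x * gen_at k v x \<partial>cube)"
    by (intro Bochner_Integration.integral_cong) (auto simp: gen_at_def algebra_simps)
  finally show ?thesis .
qed

definition Y :: "nat \<Rightarrow> (nat \<Rightarrow> bool) \<Rightarrow> real" where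
  "Y k x = (if x k then 1 - p k else - p k) / sqrt (p k * (1 - p k))"

definition walsh :: "nat set \<Rightarrow> (nat \<Rightarrow> bool) \<Rightarrow> real" where
  "walsh S x = (\<Prod>i\<in>S. Y i x)"

lemma Y_measurable [measurable]: "Y k \<in> borel_measurable cube"
  unfolding Y_def by measurable

lemma walsh_measurable [measurable]: "walsh S \<in> borel_measurable cube"
  unfolding walsh_def by measurable

lemma walsh_empty [simp]: "walsh {} x = 1"
  by (simp add: walsh_def)

lemma Y_flip_other: "i \<noteq> k \<Longrightarrow> Y i (flip k x) = Y i x"
  by (simp add: Y_def flip_def)

lemma walsh_flip_notin: "k \<notin> S \<Longrightarrow> walsh S (flip k x) = walsh S x"
  unfolding walsh_def by (rule prod.cong[OF refl], rule Y_flip_other) auto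

lemma walsh_insert: "finite S \<Longrightarrow> k \<notin> S \<Longrightarrow> walsh (insert k S) x = Y k x * walsh S x"
  by (simp add: walsh_def)

lemma sqrt_pq: "0 < sqrt (p k * (1 - p k))" "sqrt (p k * (1 - p k)) * sqrt (p k * (1 - p k)) = p k * (1 - p k)"
  using p_gt_0[of k] p_lt_1[of k] by (auto simp: real_sqrt_mult_self)

lemma gen_at_Y: "gen_at k (Y k) x = - Y k x"
proof -
  define s where "s = sqrt (p k * (1 - p k))"
  have "gen_at k (Y k) x = rate k x * ((if x k then - p k else 1 - p k) - (if x k then 1 - p k else - p k)) / s"
    by (simp add: gen_at_def Y_def flip_def s_def diff_divide_distrib)
  also have "rate k x * ((if x k then - p k else 1 - p k) - (if x k then 1 - p k else - p k)) = - (if x k then 1 - p k else - p k)"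
    by (simp add: rate_def)
  finally show ?thesis by (simp only: Y_def[of k x] s_def minus_divide_left)
qed

lemma gen_at_Y_sq: "gen_at k (\<lambda>x. (Y k x)\<^sup>2) x = 1 - (Y k x)\<^sup>2"
proof -
  have *: "(Y k x)\<^sup>2 = (if x k then (1 - p k) / p k else p k / (1 - p k))" for x
    using p_gt_0[of k] p_lt_1[of k] by (auto simp: Y_def power_divide power2_eq_square)
  show ?thesis
    using p_gt_0[of k] p_lt_1[of k] unfolding gen_at_def * by (auto simp: rate_def flip_def field_simps)
qed

text \<open>
  A fresh \<open>Y k\<close> has mean zero, so resampling coordinate \<open>k\<close> kills the Walsh functions that contain it.
\<close>
lemma gen_at_walsh:
  assumes "finite S"
  shows "gen_at k (walsh S) x = (if k \<in> S then - walsh S x else 0)"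
proof (cases "k \<in> S")
  case True
  then have S: "S = insert k (S - {k})" by auto
  have "walsh S y = Y k y * walsh (S - {k}) y" for y
    using walsh_insert[of "S - {k}" k y] assms S by auto
  then have "gen_at k (walsh S) x = gen_at k (Y k) x * walsh (S - {k}) x"
    by (simp add: gen_at_def walsh_flip_notin algebra_simps)
  also have "\<dots> = - walsh S x"
    using \<open>\<And>y. walsh S y = _\<close> by (simp add: gen_at_Y)
  finally show ?thesis using True by simp
qed (simp add: gen_at_def walsh_flip_notin)

text \<open>
  Cylinder functions, which depend on the first \<open>n\<close> coordinates only. They are bounded, which makes
  every finite computation integrable.
\<close>
definition cyl :: "nat \<Rightarrow> ((nat \<Rightarrow> bool) \<Rightarrow> real) \<Rightarrow> bool" where
  "cyl n g \<longleftrightarrow> (\<forall>x y. (\<forall>i<n. x i = y i) \<longrightarrow> g x = g y)"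

lemma cyl_const: "cyl n (\<lambda>x. a)"
  and cyl_add: "cyl n g \<Longrightarrow> cyl n h \<Longrightarrow> cyl n (\<lambda>x. g x + h x)"
  and cyl_diff: "cyl n g \<Longrightarrow> cyl n h \<Longrightarrow> cyl n (\<lambda>x. g x - h x)"
  and cyl_mult: "cyl n g \<Longrightarrow> cyl n h \<Longrightarrow> cyl n (\<lambda>x. g x * h x)"
  and cyl_power: "cyl n g \<Longrightarrow> cyl n (\<lambda>x. g x ^ j)"
  unfolding cyl_def by metis+

lemma cyl_sum: "(\<And>i. i \<in> I \<Longrightarrow> cyl n (g i)) \<Longrightarrow> cyl n (\<lambda>x. \<Sum>i\<in>I. g i x)"
  unfolding cyl_def by (auto intro!: sum.cong)

lemma cyl_walsh: "S \<subseteq> {..<n} \<Longrightarrow> cyl n (walsh S)"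
  unfolding cyl_def walsh_def by (auto simp: Y_def intro!: prod.cong)

lemma cyl_flip:
  assumes "cyl n g" shows "cyl n (\<lambda>x. g (flip k x))"
  unfolding cyl_def
proof (intro allI impI)
  fix x y :: "nat \<Rightarrow> bool" assume "\<forall>i<n. x i = y i"
  then have "\<forall>i<n. flip k x i = flip k y i" by (auto simp: flip_def)
  then show "g (flip k x) = g (flip k y)" using assms unfolding cyl_def by blast
qed

lemma cyl_rate: "k < n \<Longrightarrow> cyl n (rate k)"
  unfolding cyl_def rate_def by auto

lemma cyl_gen_at: "k < n \<Longrightarrow> cyl n g \<Longrightarrow> cyl n (gen_at k g)"
  unfolding gen_at_def[abs_def] by (intro cyl_mult cyl_diff cyl_flip cyl_rate)

lemmas cyl_intros = cyl_gen_at cyl_rate cyl_walsh cyl_sum cyl_power cyl_mult cyl_diff cyl_add cyl_const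

text \<open>On a two-point space every function is a combination of \<open>1\<close> and \<open>Y n\<close>.\<close>
lemma cyl_expansion_exists:
  "cyl n g \<Longrightarrow> \<exists>a. \<forall>x. g x = (\<Sum>W\<in>Pow {..<n}. a W * walsh W x)"
proof (induction n arbitrary: g)
  case 0
  then have "\<forall>x. g x = g (\<lambda>_. False)" unfolding cyl_def by blast
  then show ?case by (intro exI[of _ "\<lambda>_. g (\<lambda>_. False)"]) simp
next
  case (Suc n)
  define u where "u x = p n * g (x(n := True)) + (1 - p n) * g (x(n := False))" for x
  define v where "v x = sqrt (p n * (1 - p n)) * (g (x(n := True)) - g (x(n := False)))" for x
  have upd: "g (x(n := b)) = g (y(n := b))" if "\<forall>i<n. x i = y i" for x y b
  proof -
    have "\<forall>i<Suc n. (x(n := b)) i = (y(n := b)) i" using that by (auto simp: less_Suc_eq)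
    then show ?thesis using Suc.prems unfolding cyl_def by blast
  qed
  have uv: "u x = u y" "v x = v y" if "\<forall>i<n. x i = y i" for x y
    unfolding u_def v_def upd[OF that] by (rule refl)+
  have "cyl n u" unfolding cyl_def using uv(1) by blast
  moreover have "cyl n v" unfolding cyl_def using uv(2) by blast
  ultimately obtain a b where a: "\<And>x. u x = (\<Sum>W\<in>Pow {..<n}. a W * walsh W x)"
    and b: "\<And>x. v x = (\<Sum>W\<in>Pow {..<n}. b W * walsh W x)" using Suc.IH[of u] Suc.IH[of v] by blast
  have g: "g x = u x + Y n x * v x" for x
  proof -
    have "Y n x * v x = (if x n then 1 - p n else - p n) * (g (x(n := True)) - g (x(n := False)))"
      using less_imp_neq[OF sqrt_pq(1)[of n]] unfolding Y_def v_def by (metis (no_types) mult.assoc nonzero_eq_divide_eq)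
    moreover have "x(n := x n) = x" by simp
    ultimately show ?thesis by (cases "x n") (simp_all add: u_def algebra_simps)
  qed
  \<comment> \<open>Sets containing \<open>n\<close> receive the coefficients of \<open>v\<close>, the other ones those of \<open>u\<close>.\<close>
  define ab where "ab W = (if n \<in> W then b (W - {n}) else a W)" for W
  have "g x = (\<Sum>W\<in>Pow {..<Suc n}. ab W * walsh W x)" for x
  proof -
    have "Pow {..<Suc n} = Pow {..<n} \<union> insert n ` Pow {..<n}"
      by (simp add: lessThan_Suc Pow_insert)
    then have "(\<Sum>W\<in>Pow {..<Suc n}. ab W * walsh W x)
        = (\<Sum>W\<in>Pow {..<n}. ab W * walsh W x) + (\<Sum>W\<in>insert n ` Pow {..<n}. ab W * walsh W x)"
      by (simp only:) (rule sum.union_disjoint, auto)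
    also have "(\<Sum>W\<in>Pow {..<n}. ab W * walsh W x) = u x"
      unfolding a by (intro sum.cong) (auto simp: ab_def)
    also have "(\<Sum>W\<in>insert n ` Pow {..<n}. ab W * walsh W x) = (\<Sum>W\<in>Pow {..<n}. ab (insert n W) * walsh (insert n W) x)"
      by (rule sum.reindex_cong[of "insert n"]) (auto simp: inj_on_def)
    also have "\<dots> = Y n x * v x"
      unfolding b sum_distrib_left
    proof (rule sum.cong[OF refl])
      fix W assume W: "W \<in> Pow {..<n}"
      then have "finite W" "n \<notin> W" using finite_subset by auto
      then show "ab (insert n W) * walsh (insert n W) x = Y n x * (b W * walsh W x)"
        by (simp add: ab_def walsh_insert)
    qed
    finally show ?thesis by (simp add: g)
  qed
  then show ?case by blast
qed

lemma cyl_measurable [measurable_dest]: "cyl n g \<Longrightarrow> g \<in> borel_measurable cube"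
proof -
  assume "cyl n g"
  then obtain a where "\<forall>x. g x = (\<Sum>W\<in>Pow {..<n}. a W * walsh W x)" using cyl_expansion_exists by blast
  then have "g = (\<lambda>x. \<Sum>W\<in>Pow {..<n}. a W * walsh W x)" by auto
  then show ?thesis by simp
qed

lemma cyl_bounded: "cyl n g \<Longrightarrow> \<exists>C. \<forall>x. \<bar>g x\<bar> \<le> C"
proof -
  assume "cyl n g"
  then obtain a where a: "\<forall>x. g x = (\<Sum>W\<in>Pow {..<n}. a W * walsh W x)" using cyl_expansion_exists by blast
  define b where "b k = \<bar>1 / sqrt (p k * (1 - p k))\<bar>" for k
  have Y: "\<bar>Y k x\<bar> \<le> b k" for k x
    unfolding Y_def b_def abs_divide using p_gt_0[of k] p_lt_1[of k] by (intro divide_right_mono) auto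
  have "\<bar>g x\<bar> \<le> (\<Sum>W\<in>Pow {..<n}. \<bar>a W\<bar> * (\<Prod>i\<in>W. b i))" for x
    unfolding a[rule_format] walsh_def
    by (rule order_trans[OF sum_abs]) (auto simp: abs_mult abs_prod Y intro!: sum_mono mult_left_mono prod_mono)
  then show ?thesis by blast
qed

lemma cyl_integrable: "cyl n g \<Longrightarrow> integrable cube g"
  using cyl_bounded[of n g] cyl_measurable[of n g] by (metis AE_I2 integrable_const_bound real_norm_def)

lemma integral_gen_at_symmetric_cyl:
  assumes "cyl n u" "cyl n v"
  shows "(\<integral>x. gen_at k u x * v x \<partial>cube) = (\<integral>x. u x * gen_at k v x \<partial>cube)"
  using assms cyl_mult[OF cyl_flip[OF assms(1)] assms(2)] cyl_mult[OF assms]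
  by (intro integral_gen_at_symmetric cyl_measurable[of n] cyl_integrable[of n])

lemma finite_subset_lessThan: "S \<subseteq> {..<n::nat} \<Longrightarrow> finite S"
  using finite_subset by auto

text \<open>The symmetric operator \<open>gen_at k\<close> has eigenvalue \<open>- 1\<close> on one factor and \<open>0\<close> on the other.\<close>
lemma walsh_orthogonal:
  assumes S: "finite S" and T: "finite T" and k: "k \<in> S" "k \<notin> T"
  shows "(\<integral>x. walsh S x * walsh T x \<partial>cube) = 0"
proof -
  obtain n where n: "S \<subseteq> {..<n}" "T \<subseteq> {..<n}"
    using finite_nat_iff_bounded[of "S \<union> T"] S T by auto
  have "- (\<integral>x. walsh S x * walsh T x \<partial>cube) = (\<integral>x. gen_at k (walsh S) x * walsh T x \<partial>cube)"
    using gen_at_walsh[OF S] k by simp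
  also have "\<dots> = (\<integral>x. walsh S x * gen_at k (walsh T) x \<partial>cube)"
    using n by (intro integral_gen_at_symmetric_cyl[of n] cyl_intros)
  also have "\<dots> = 0" using gen_at_walsh[OF T] k by simp
  finally show ?thesis by simp
qed

lemma walsh_normalized: "finite S \<Longrightarrow> (\<integral>x. (walsh S x)\<^sup>2 \<partial>cube) = 1"
proof (induction rule: finite_induct)
  case (insert k S)
  obtain n where n: "insert k S \<subseteq> {..<n}"
    using finite_nat_iff_bounded[of "insert k S"] insert.hyps by auto
  have cy: "cyl n (\<lambda>x. (Y k x)\<^sup>2)" using cyl_power[OF cyl_walsh[of "{k}" n], of 2] n by (simp add: walsh_def)
  have cw: "cyl n (\<lambda>x. (walsh S x)\<^sup>2)" using n by (intro cyl_intros) auto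
  have "(\<integral>x. (walsh S x)\<^sup>2 \<partial>cube) - (\<integral>x. (walsh (insert k S) x)\<^sup>2 \<partial>cube)
      = (\<integral>x. (walsh S x)\<^sup>2 - (walsh (insert k S) x)\<^sup>2 \<partial>cube)"
    using n by (intro Bochner_Integration.integral_diff[symmetric] cyl_integrable[of n] cyl_intros) auto
  also have "\<dots> = (\<integral>x. gen_at k (\<lambda>x. (Y k x)\<^sup>2) x * (walsh S x)\<^sup>2 \<partial>cube)"
    using insert.hyps by (simp add: gen_at_Y_sq walsh_insert power_mult_distrib algebra_simps)
  also have "\<dots> = (\<integral>x. (Y k x)\<^sup>2 * gen_at k (\<lambda>x. (walsh S x)\<^sup>2) x \<partial>cube)"
    by (rule integral_gen_at_symmetric_cyl[OF cy cw])
  also have "\<dots> = 0" using insert.hyps by (simp add: gen_at_def walsh_flip_notin)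
  finally show ?case using insert.IH by simp
qed (use prob_space in simp)

lemma walsh_orthonormal:
  assumes "finite S" "finite T"
  shows "(\<integral>x. walsh S x * walsh T x \<partial>cube) = (if S = T then 1 else 0)"
proof (cases "S = T")
  case True
  then show ?thesis using walsh_normalized[OF assms(1)] by (simp add: power2_eq_square)
next
  case False
  then obtain k where "k \<in> S \<and> k \<notin> T \<or> k \<in> T \<and> k \<notin> S" by blast
  then show ?thesis
    using False walsh_orthogonal[OF assms, of k] walsh_orthogonal[OF assms(2,1), of k] by (auto simp: mult.commute)
qed

lemma integral_walsh_sum_mult:
  "(\<integral>x. (\<Sum>W\<in>Pow {..<n}. a W * walsh W x) * (\<Sum>W\<in>Pow {..<n}. b W * walsh W x) \<partial>cube) = (\<Sum>W\<in>Pow {..<n}. a W * b W)"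
proof -
  have fin: "finite W" if "W \<in> Pow {..<n}" for W using that finite_subset_lessThan by auto
  have "(\<integral>x. (\<Sum>W\<in>Pow {..<n}. a W * walsh W x) * (\<Sum>W\<in>Pow {..<n}. b W * walsh W x) \<partial>cube)
      = (\<integral>x. (\<Sum>W\<in>Pow {..<n}. \<Sum>V\<in>Pow {..<n}. a W * b V * (walsh W x * walsh V x)) \<partial>cube)"
    by (simp add: sum_product ac_simps)
  also have "\<dots> = (\<Sum>W\<in>Pow {..<n}. \<Sum>V\<in>Pow {..<n}. a W * b V * (\<integral>x. walsh W x * walsh V x \<partial>cube))"
  proof -
    have "integrable cube (\<lambda>x. \<Sum>V\<in>Pow {..<n}. a W * b V * (walsh W x * walsh V x))"
      if "W \<in> Pow {..<n}" for W
      using that by (intro cyl_integrable[of n] cyl_intros) auto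
    moreover have "integrable cube (\<lambda>x. a W * b V * (walsh W x * walsh V x))"
      if "W \<in> Pow {..<n}" "V \<in> Pow {..<n}" for W V
      using that by (intro cyl_integrable[of n] cyl_intros) auto
    ultimately show ?thesis by (simp add: Bochner_Integration.integral_sum)
  qed
  also have "\<dots> = (\<Sum>W\<in>Pow {..<n}. \<Sum>V\<in>Pow {..<n}. if W = V then a W * b V else 0)"
    using fin by (intro sum.cong refl) (simp add: walsh_orthonormal)
  also have "\<dots> = (\<Sum>W\<in>Pow {..<n}. a W * b W)" by (simp add: sum.delta)
  finally show ?thesis .
qed

lemma cyl_expansion:
  assumes "cyl n g"
  shows "g x = (\<Sum>W\<in>Pow {..<n}. (\<integral>y. g y * walsh W y \<partial>cube) * walsh W x)"
proof -
  obtain a where a: "\<And>x. g x = (\<Sum>W\<in>Pow {..<n}. a W * walsh W x)" using cyl_expansion_exists[OF assms] by blast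
  have "(\<integral>y. g y * walsh V y \<partial>cube) = a V" if V: "V \<in> Pow {..<n}" for V
  proof -
    have "(\<Sum>W\<in>Pow {..<n}. (if W = V then 1 else 0) * walsh W y) = (\<Sum>W\<in>Pow {..<n}. if W = V then walsh V y else 0)" for y
      by (rule sum.cong) auto
    then have *: "walsh V y = (\<Sum>W\<in>Pow {..<n}. (if W = V then 1 else 0) * walsh W y)" for y
      using V by (simp add: sum.delta)
    have "(\<integral>y. g y * walsh V y \<partial>cube) = (\<Sum>W\<in>Pow {..<n}. a W * (if W = V then 1 else 0))"
      unfolding a * by (rule integral_walsh_sum_mult)
    also have "\<dots> = (\<Sum>W\<in>Pow {..<n}. if W = V then a W else 0)" by (intro sum.cong) auto
    also have "\<dots> = a V" using V by (simp add: sum.delta)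
    finally show ?thesis .
  qed
  then show ?thesis unfolding a by (intro sum.cong) (auto simp flip: a)
qed

lemma gen_at_sum: "gen_at k (\<lambda>x. \<Sum>W\<in>I. a W * g W x) x = (\<Sum>W\<in>I. a W * gen_at k (g W) x)"
  unfolding gen_at_def by (simp add: sum_subtractf[symmetric] sum_distrib_left algebra_simps)

definition gen :: "nat \<Rightarrow> ((nat \<Rightarrow> bool) \<Rightarrow> real) \<Rightarrow> (nat \<Rightarrow> bool) \<Rightarrow> real" where
  "gen n g x = (\<Sum>k<n. gen_at k g x)"

text \<open>The carre du champ of the generator \<open>gen n\<close>.\<close>
definition Gam :: "nat \<Rightarrow> ((nat \<Rightarrow> bool) \<Rightarrow> real) \<Rightarrow> (nat \<Rightarrow> bool) \<Rightarrow> real" where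
  "Gam n g x = (\<Sum>k<n. rate k x * (g (flip k x) - g x)\<^sup>2) / 2"

lemma Gam_eq: "Gam n g x = gen n (\<lambda>y. (g y)\<^sup>2) x / 2 - g x * gen n g x"
proof -
  have "rate k x * (g (flip k x) - g x)\<^sup>2 = gen_at k (\<lambda>y. (g y)\<^sup>2) x - 2 * g x * gen_at k g x" for k
    by (simp add: gen_at_def power2_eq_square algebra_simps)
  then show ?thesis
    by (simp add: Gam_def gen_def sum_subtractf sum_distrib_left[symmetric] diff_divide_distrib mult.assoc)
qed

lemma gen_walsh_sum:
  assumes "\<And>W. W \<in> I \<Longrightarrow> finite W"
  shows "gen n (\<lambda>x. \<Sum>W\<in>I. a W * walsh W x) x = - (\<Sum>W\<in>I. card (W \<inter> {..<n}) * (a W * walsh W x))"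
proof -
  have "gen n (\<lambda>x. \<Sum>W\<in>I. a W * walsh W x) x = (\<Sum>k<n. \<Sum>W\<in>I. a W * (if k \<in> W then - walsh W x else 0))"
    unfolding gen_def gen_at_sum using assms by (intro sum.cong refl) (auto simp: gen_at_walsh)
  also have "\<dots> = (\<Sum>W\<in>I. \<Sum>k<n. a W * (if k \<in> W then - walsh W x else 0))" by (rule sum.swap)
  also have "\<dots> = (\<Sum>W\<in>I. - (card (W \<inter> {..<n}) * (a W * walsh W x)))"
  proof (intro sum.cong refl)
    fix W assume "W \<in> I"
    have "(\<Sum>k<n. a W * (if k \<in> W then - walsh W x else 0)) = (\<Sum>k<n. if k \<in> W then - (a W * walsh W x) else 0)"
      by (intro sum.cong) auto
    also have "\<dots> = (\<Sum>k\<in>W \<inter> {..<n}. - (a W * walsh W x))"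
      by (simp add: sum.If_cases Int_commute)
    finally show "(\<Sum>k<n. a W * (if k \<in> W then - walsh W x else 0)) = - (card (W \<inter> {..<n}) * (a W * walsh W x))" by simp
  qed
  finally show ?thesis by (simp add: sum_negf)
qed

lemma cyl_gen: "m \<le> n \<Longrightarrow> cyl n g \<Longrightarrow> cyl n (gen m g)"
  unfolding gen_def[abs_def] by (intro cyl_intros) auto

lemma cyl_divide: "cyl n g \<Longrightarrow> cyl n (\<lambda>x. g x / a)"
  unfolding cyl_def by metis

lemma cyl_Gam: "cyl n g \<Longrightarrow> cyl n (Gam n g)"
  unfolding Gam_eq[abs_def] by (intro cyl_intros cyl_divide cyl_gen order_refl)

lemma integral_gen_symmetric_cyl:
  assumes "cyl n u" "cyl n v"
  shows "(\<integral>x. gen n u x * v x \<partial>cube) = (\<integral>x. u x * gen n v x \<partial>cube)"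
proof -
  have "(\<integral>x. gen n u x * v x \<partial>cube) = (\<Sum>k<n. \<integral>x. gen_at k u x * v x \<partial>cube)"
    using assms by (simp add: gen_def sum_distrib_right) (intro Bochner_Integration.integral_sum cyl_integrable[of n] cyl_intros; auto)
  also have "\<dots> = (\<Sum>k<n. \<integral>x. u x * gen_at k v x \<partial>cube)"
    by (simp add: integral_gen_at_symmetric_cyl[OF assms])
  also have "\<dots> = (\<integral>x. u x * gen n v x \<partial>cube)"
    using assms by (simp add: gen_def sum_distrib_left) (intro Bochner_Integration.integral_sum[symmetric] cyl_integrable[of n] cyl_intros; auto)
  finally show ?thesis .
qed

end

section \<open>Moment estimates for finite homogeneous sums\<close>

context biased_cube
begin

lemma integral_walsh_mult_eq_0:
  assumes "finite W" "k \<in> W" "cyl n u" "W \<subseteq> {..<n}" "\<And>x. u (flip k x) = u x"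
  shows "(\<integral>x. walsh W x * u x \<partial>cube) = 0"
proof -
  have "- (\<integral>x. walsh W x * u x \<partial>cube) = (\<integral>x. gen_at k (walsh W) x * u x \<partial>cube)"
    using assms by (simp add: gen_at_walsh)
  also have "\<dots> = (\<integral>x. walsh W x * gen_at k u x \<partial>cube)"
    using assms by (intro integral_gen_at_symmetric_cyl cyl_walsh)
  also have "\<dots> = 0" using assms by (simp add: gen_at_def)
  finally show ?thesis by simp
qed

lemma gen_diff: "gen n (\<lambda>x. u x - v x) x = gen n u x - gen n v x"
  by (simp add: gen_def gen_at_def sum_subtractf[symmetric] algebra_simps)

text \<open>
  With \<open>a = u x\<close> and \<open>b = u (flip k x)\<close>, detailed balance exchanges \<open>b\<^sup>4 - 4 b\<^sup>3 a\<close> and \<open>a\<^sup>4 - 4 a\<^sup>3 b\<close> under the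
  integral, and what is left of \<open>(b - a)\<^sup>4\<close> is \<open>6 a\<^sup>2 (b\<^sup>2 - a\<^sup>2) - 8 a\<^sup>3 (b - a)\<close>.
\<close>
lemma integral_fourth_power_flip:
  assumes u: "cyl n u" and k: "k < n"
  shows "(\<integral>x. rate k x * (u (flip k x) - u x) ^ 4 \<partial>cube)
    = 6 * (\<integral>x. (u x)\<^sup>2 * gen_at k (\<lambda>y. (u y)\<^sup>2) x \<partial>cube) - 8 * (\<integral>x. u x ^ 3 * gen_at k u x \<partial>cube)"
proof -
  define q where "q x = u x ^ 4 - 4 * (u x ^ 3 * u (flip k x))" for x
  note uf = cyl_flip[OF u, of k]
  have q: "cyl n q" unfolding q_def[abs_def] by (intro cyl_intros u uf)
  have i: "integrable cube (\<lambda>x. rate k x * q x)" "integrable cube (\<lambda>x. rate k x * q (flip k x))"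
    using cyl_integrable[OF q] by (intro integrable_rate_mult integrable_rate_flip; simp)+
  have i2: "integrable cube (\<lambda>x. (u x)\<^sup>2 * gen_at k (\<lambda>y. (u y)\<^sup>2) x)" "integrable cube (\<lambda>x. u x ^ 3 * gen_at k u x)"
    by (intro cyl_integrable[of n] cyl_intros u k)+
  have "(\<integral>x. rate k x * (u (flip k x) - u x) ^ 4 \<partial>cube)
      = (\<integral>x. (rate k x * q (flip k x) - rate k x * q x) + (6 * ((u x)\<^sup>2 * gen_at k (\<lambda>y. (u y)\<^sup>2) x) - 8 * (u x ^ 3 * gen_at k u x)) \<partial>cube)"
    by (intro Bochner_Integration.integral_cong)
       (auto simp: q_def gen_at_def power2_eq_square power3_eq_cube power4_eq_xxxx algebra_simps)
  also have "\<dots> = ((\<integral>x. rate k x * q (flip k x) \<partial>cube) - (\<integral>x. rate k x * q x \<partial>cube))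
      + (6 * (\<integral>x. (u x)\<^sup>2 * gen_at k (\<lambda>y. (u y)\<^sup>2) x \<partial>cube) - 8 * (\<integral>x. u x ^ 3 * gen_at k u x \<partial>cube))"
    using i i2 by simp
  finally show ?thesis using integral_flip(1)[OF cyl_measurable[OF q], of k] by simp
qed

end

text \<open>
  A homogeneous sum of degree \<open>d\<close> in its set-indexed form: \<open>c S\<close> is the coefficient of the Walsh
  function of \<open>S\<close>, and \<open>infl\<close> bounds all influences. The comments write \<open>F\<close>, \<open>L\<close> and \<open>\<Gamma>\<close> for \<open>psum n\<close>,
  \<open>gen n\<close> and \<open>Gam n (psum n)\<close>.
\<close>
locale walsh_chaos = biased_cube +
  fixes c :: "nat set \<Rightarrow> real" and d :: nat and infl :: real
  assumes deg: "c S \<noteq> 0 \<Longrightarrow> card S = d" and d_ge_1: "1 \<le> d"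
    and influences_le: "(\<Sum>S | S \<subseteq> {..<n} \<and> k \<in> S. (c S)\<^sup>2) \<le> infl"
begin

definition psum :: "nat \<Rightarrow> (nat \<Rightarrow> bool) \<Rightarrow> real" where
  "psum n x = (\<Sum>S\<in>Pow {..<n}. c S * walsh S x)"

definition norm_sq :: "nat \<Rightarrow> real" where
  "norm_sq n = (\<Sum>S\<in>Pow {..<n}. (c S)\<^sup>2)"

text \<open>
  The deviation of the carre du champ from its value under the immigration-death dynamics, where twice
  the carre du champ is the total jump rate \<open>d \<lambda> + d (\<lambda> + F)\<close>.
\<close>
definition defect :: "nat \<Rightarrow> (nat \<Rightarrow> bool) \<Rightarrow> real" where
  "defect n x = Gam n (psum n) x - real d / 2 * psum n x - real d * norm_sq n"

text \<open>
  The functional \<open>m\<^sub>4 - 3 m\<^sub>2\<^sup>2 - 2 m\<^sub>3 + m\<^sub>2\<close>, enlarged by the influence term of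
  \<open>top_degree_lower_bound\<close> so that it is nonnegative.
\<close>
definition excess :: "nat \<Rightarrow> real" where
  "excess n = (\<integral>x. psum n x ^ 4 \<partial>cube) - 2 * (\<integral>x. psum n x ^ 3 \<partial>cube) + norm_sq n - 3 * (norm_sq n)\<^sup>2 + (4 ^ d + 2) * real d * infl * norm_sq n"

lemma c_empty: "c {} = 0"
  using deg[of "{}"] d_ge_1 by fastforce

lemma norm_sq_nonneg: "0 \<le> norm_sq n"
  by (simp add: norm_sq_def sum_nonneg)

lemma cyl_psum: "cyl n (psum n)"
  unfolding psum_def[abs_def] by (intro cyl_intros) auto

lemma cyl_defect: "cyl n (defect n)"
  unfolding defect_def[abs_def] by (intro cyl_intros cyl_Gam cyl_psum)

lemma psum_measurable [measurable]: "psum n \<in> borel_measurable cube"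
  by (rule cyl_measurable[OF cyl_psum])

lemma psum_second_moment: "(\<integral>x. (psum n x)\<^sup>2 \<partial>cube) = norm_sq n"
  unfolding power2_eq_square psum_def integral_walsh_sum_mult norm_sq_def ..

lemma integral_psum_mult_walsh:
  assumes "W \<subseteq> {..<n}"
  shows "(\<integral>x. psum n x * walsh W x \<partial>cube) = c W"
proof -
  have *: "walsh W x = (\<Sum>V\<in>Pow {..<n}. (if V = W then 1 else 0) * walsh V x)" for x
  proof -
    have "(\<Sum>V\<in>Pow {..<n}. (if V = W then 1 else 0) * walsh V x) = (\<Sum>V\<in>Pow {..<n}. if V = W then walsh W x else 0)"
      by (rule sum.cong) auto
    then show ?thesis using assms by simp
  qed
  have "(\<integral>x. psum n x * walsh W x \<partial>cube) = (\<Sum>V\<in>Pow {..<n}. c V * (if V = W then 1 else 0))"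
    unfolding psum_def * by (rule integral_walsh_sum_mult)
  also have "\<dots> = (\<Sum>V\<in>Pow {..<n}. if V = W then c W else 0)" by (intro sum.cong) auto
  also have "\<dots> = c W" using assms by simp
  finally show ?thesis .
qed

lemma psum_mean: "(\<integral>x. psum n x \<partial>cube) = 0"
  using integral_psum_mult_walsh[of "{}" n] c_empty by simp

lemma gen_psum: "gen n (psum n) x = - (real d * psum n x)"
proof -
  have "gen n (psum n) x = - (\<Sum>S\<in>Pow {..<n}. real (card (S \<inter> {..<n})) * (c S * walsh S x))"
    unfolding psum_def[abs_def] using finite_subset_lessThan by (intro gen_walsh_sum) auto
  also have "(\<Sum>S\<in>Pow {..<n}. real (card (S \<inter> {..<n})) * (c S * walsh S x)) = (\<Sum>S\<in>Pow {..<n}. real d * (c S * walsh S x))"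
  proof (rule sum.cong[OF refl])
    fix S assume "S \<in> Pow {..<n}"
    then have "S \<inter> {..<n} = S" by auto
    then show "real (card (S \<inter> {..<n})) * (c S * walsh S x) = real d * (c S * walsh S x)"
      using deg[of S] by (cases "c S = 0") auto
  qed
  finally show ?thesis by (simp only: psum_def[of n x] sum_distrib_left)
qed

text \<open>
  Two sets of size \<open>d\<close> cover a set of size at least \<open>2 d\<close> only if they partition it; otherwise \<open>W\<close> has
  a point outside both, in which the product has mean zero.
\<close>
lemma integral_triple_walsh:
  assumes n: "S \<subseteq> {..<n}" "T \<subseteq> {..<n}" "W \<subseteq> {..<n}"
    and cST: "c S * c T \<noteq> 0" and W: "card W \<ge> 2 * d"
  shows "(\<integral>x. walsh S x * walsh T x * walsh W x \<partial>cube) = (if S \<subseteq> W \<and> T = W - S then 1 else 0)"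
proof (cases "W \<subseteq> S \<union> T")
  case True
  have fin: "finite S" "finite T" "finite W" using n finite_subset_lessThan by auto
  have "card S = d" "card T = d" using cST deg[of S] deg[of T] by simp_all
  moreover have "card W \<le> card (S \<union> T)" using True fin by (intro card_mono) auto
  moreover have "card (S \<union> T) + card (S \<inter> T) = card S + card T" using card_Un_Int[OF fin(1,2)] by simp
  ultimately have "card (S \<inter> T) = 0" "card W = card (S \<union> T)" using W by linarith+
  then have "S \<inter> T = {}" "W = S \<union> T" using fin True card_subset_eq[of "S \<union> T" W] by auto
  then have "walsh S x * walsh T x * walsh W x = (walsh W x)\<^sup>2" for x
    using fin by (simp add: walsh_def prod.union_disjoint power2_eq_square)
  then show ?thesis using walsh_normalized[OF fin(3)] \<open>S \<inter> T = {}\<close> \<open>W = S \<union> T\<close> by auto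
next
  case False
  then obtain k where k: "k \<in> W" "k \<notin> S" "k \<notin> T" by auto
  have "(\<integral>x. walsh W x * (walsh S x * walsh T x) \<partial>cube) = 0"
    using n k finite_subset_lessThan
    by (intro integral_walsh_mult_eq_0[where n = n and k = k] cyl_intros) (auto simp: walsh_flip_notin)
  moreover have "\<not> (S \<subseteq> W \<and> T = W - S)" using k by auto
  ultimately show ?thesis by (simp add: ac_simps)
qed

lemma integral_psum_sq_mult_walsh:
  assumes W: "W \<subseteq> {..<n}" "card W \<ge> 2 * d"
  shows "(\<integral>x. (psum n x)\<^sup>2 * walsh W x \<partial>cube) = (\<Sum>S\<in>Pow W. c S * c (W - S))"
proof -
  have int: "integrable cube (\<lambda>x. c S * c T * (walsh S x * walsh T x * walsh W x))"
    if "S \<in> Pow {..<n}" "T \<in> Pow {..<n}" for S T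
    using that W by (intro cyl_integrable[of n] cyl_intros) auto
  have "(\<integral>x. (psum n x)\<^sup>2 * walsh W x \<partial>cube)
      = (\<integral>x. (\<Sum>S\<in>Pow {..<n}. \<Sum>T\<in>Pow {..<n}. c S * c T * (walsh S x * walsh T x * walsh W x)) \<partial>cube)"
  proof -
    have "(psum n x)\<^sup>2 = (\<Sum>S\<in>Pow {..<n}. \<Sum>T\<in>Pow {..<n}. (c S * walsh S x) * (c T * walsh T x))" for x
      unfolding psum_def power2_eq_square by (rule sum_product)
    then have "(psum n x)\<^sup>2 * walsh W x = (\<Sum>S\<in>Pow {..<n}. \<Sum>T\<in>Pow {..<n}. c S * c T * (walsh S x * walsh T x * walsh W x))" for x
      by (simp only: sum_distrib_right) (simp only: ac_simps)
    then show ?thesis by simp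
  qed
  also have "\<dots> = (\<Sum>S\<in>Pow {..<n}. \<Sum>T\<in>Pow {..<n}. c S * c T * (\<integral>x. walsh S x * walsh T x * walsh W x \<partial>cube))"
  proof -
    have int2: "integrable cube (\<lambda>x. \<Sum>T\<in>Pow {..<n}. c S * c T * (walsh S x * walsh T x * walsh W x))"
      if "S \<in> Pow {..<n}" for S
      using that by (intro Bochner_Integration.integrable_sum int)
    show ?thesis
      by (simp only: Bochner_Integration.integral_sum int int2 integral_mult_right_zero cong: sum.cong)
  qed
  also have "\<dots> = (\<Sum>S\<in>Pow {..<n}. \<Sum>T\<in>Pow {..<n}. if T = W - S then (if S \<subseteq> W then c S * c (W - S) else 0) else 0)"
  proof (intro sum.cong refl)
    fix S T assume "S \<in> Pow {..<n}" "T \<in> Pow {..<n}"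
    then show "c S * c T * (\<integral>x. walsh S x * walsh T x * walsh W x \<partial>cube) =
        (if T = W - S then (if S \<subseteq> W then c S * c (W - S) else 0) else 0)"
      using integral_triple_walsh[of S n T W] W by (cases "c S * c T = 0") auto
  qed
  also have "\<dots> = (\<Sum>S\<in>Pow {..<n}. if S \<subseteq> W then c S * c (W - S) else 0)"
    using W by (intro sum.cong refl, subst sum.delta) auto
  also have "\<dots> = (\<Sum>S\<in>Pow W. c S * c (W - S))"
    using W by (intro sum.mono_neutral_cong_right) auto
  finally show ?thesis .
qed

text \<open>
  With \<open>G = F\<^sup>2 - F\<close> one has \<open>defect = L G / 2 + d G - d E[F\<^sup>2]\<close>, whose Walsh coefficient at \<open>W\<close> is
  \<open>(d - card W / 2)\<close> times that of \<open>G\<close>, except that at the empty set it vanishes. The multiplier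
  is bounded by \<open>d\<close> on degrees up to \<open>2 d\<close> and zero on degree \<open>2 d\<close>, and \<open>G\<close> has no higher degrees. So
  the squared norm of the defect is at most \<open>d\<^sup>2\<close> times that of \<open>G\<close> without its mean and its top degree,
  and \<open>top_degree_lower_bound\<close> applies to the latter.
\<close>
lemma defect_second_moment: "(\<integral>x. (defect n x)\<^sup>2 \<partial>cube) \<le> (real d)\<^sup>2 * excess n"
proof -
  define G where "G x = (psum n x)\<^sup>2 - psum n x" for x
  have cG: "cyl n G" unfolding G_def[abs_def] by (intro cyl_intros cyl_psum)
  define g where "g W = (\<integral>y. G y * walsh W y \<partial>cube)" for W
  define h where "h W = (\<Sum>S\<in>Pow W. c S * c (W - S))" for W
  define b where "b W = (real d - card W / 2) * g W - (if W = {} then real d * norm_sq n else 0)" for W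
  have G: "G x = (\<Sum>W\<in>Pow {..<n}. g W * walsh W x)" for x
    unfolding g_def by (rule cyl_expansion[OF cG])
  have g_eq: "g W = (\<integral>x. (psum n x)\<^sup>2 * walsh W x \<partial>cube) - c W" if "W \<subseteq> {..<n}" for W
  proof -
    have "g W = (\<integral>x. (psum n x)\<^sup>2 * walsh W x - psum n x * walsh W x \<partial>cube)"
      by (simp add: g_def G_def left_diff_distrib)
    also have "\<dots> = (\<integral>x. (psum n x)\<^sup>2 * walsh W x \<partial>cube) - (\<integral>x. psum n x * walsh W x \<partial>cube)"
      using that by (intro Bochner_Integration.integral_diff cyl_integrable[of n] cyl_intros cyl_psum)
    finally show ?thesis using integral_psum_mult_walsh[OF that] by simp
  qed
  have LG: "gen n G x = - (\<Sum>W\<in>Pow {..<n}. card W * (g W * walsh W x))" for x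
  proof -
    have "gen n G x = - (\<Sum>W\<in>Pow {..<n}. card (W \<inter> {..<n}) * (g W * walsh W x))"
      unfolding G[abs_def] using finite_subset_lessThan by (intro gen_walsh_sum) auto
    also have "(\<Sum>W\<in>Pow {..<n}. card (W \<inter> {..<n}) * (g W * walsh W x)) = (\<Sum>W\<in>Pow {..<n}. card W * (g W * walsh W x))"
      by (intro sum.cong refl) (auto simp: Int_absorb2)
    finally show ?thesis .
  qed
  have defect_eq: "defect n x = (\<Sum>W\<in>Pow {..<n}. b W * walsh W x)" for x
  proof -
    have "gen n G x = gen n (\<lambda>y. (psum n y)\<^sup>2) x - gen n (psum n) x"
      unfolding G_def[abs_def] by (rule gen_diff)
    then have "defect n x = gen n G x / 2 + real d * G x - real d * norm_sq n"
      unfolding defect_def Gam_eq gen_psum G_def by (simp add: gen_psum power2_eq_square algebra_simps)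
    also have "\<dots> = (\<Sum>W\<in>Pow {..<n}. (real d - card W / 2) * g W * walsh W x) - real d * norm_sq n"
      unfolding LG unfolding G sum_distrib_left sum_divide_distrib sum_negf[symmetric] sum.distrib[symmetric]
      by (intro arg_cong2[of _ _ _ _ "(-)"] sum.cong refl) (simp add: algebra_simps)
    also have "real d * norm_sq n = (\<Sum>W\<in>Pow {..<n}. (if W = {} then real d * norm_sq n else 0) * walsh W x)"
    proof -
      have "(\<Sum>W\<in>Pow {..<n}. (if W = {} then real d * norm_sq n else 0) * walsh W x)
          = (\<Sum>W\<in>Pow {..<n}. if W = {} then real d * norm_sq n else 0)"
        by (intro sum.cong) auto
      then show ?thesis by simp
    qed
    finally show ?thesis
      by (simp add: b_def sum_subtractf[symmetric] left_diff_distrib)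
  qed
  have h0: "h W = 0" if "card W \<noteq> 2 * d" "W \<subseteq> {..<n}" for W
    unfolding h_def
  proof (rule sum.neutral, rule ballI)
    fix S assume S: "S \<in> Pow W"
    show "c S * c (W - S) = 0"
    proof (rule ccontr)
      assume "c S * c (W - S) \<noteq> 0"
      then have "card S = d" "card (W - S) = d" using deg[of S] deg[of "W - S"] by simp_all
      moreover have "card W = card S + card (W - S)"
        using S that finite_subset_lessThan[of W n] by (metis PowD card_Diff_subset card_mono finite_subset le_add_diff_inverse)
      ultimately show False using that by simp
    qed
  qed
  \<comment> \<open>Here \<open>h\<close> is the top degree part of \<open>G\<close>, and \<open>norm_sq n\<close> its mean.\<close>
  have bg: "(b W)\<^sup>2 \<le> (real d)\<^sup>2 * ((g W)\<^sup>2 - (if W = {} then (norm_sq n)\<^sup>2 else 0) - (h W)\<^sup>2)" if "W \<in> Pow {..<n}" for W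
  proof -
    have W: "W \<subseteq> {..<n}" using that by simp
    consider "W = {}" | "W \<noteq> {}" "card W < 2 * d" | "card W = 2 * d" | "card W > 2 * d" by linarith
    then show ?thesis
    proof cases
      case 1
      have "g W = norm_sq n" using g_eq[OF W] 1 c_empty psum_second_moment[of n] by simp
      moreover have "h W = 0" using h0[OF _ W] 1 d_ge_1 by simp
      ultimately show ?thesis using 1 by (simp add: b_def)
    next
      case 2
      have "\<bar>real d - card W / 2\<bar> \<le> real d" using 2 by auto
      then have "(real d - card W / 2)\<^sup>2 \<le> (real d)\<^sup>2" using abs_le_square_iff by fastforce
      moreover have "h W = 0" using h0[OF _ W] 2 by simp
      ultimately show ?thesis using 2 by (simp add: b_def power_mult_distrib mult_right_mono)
    next
      case 3
      then have "W \<noteq> {}" using d_ge_1 by auto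
      have "c W = 0" using deg[of W] 3 d_ge_1 by fastforce
      then have "g W = h W" using g_eq[OF W] integral_psum_sq_mult_walsh[OF W] 3 by (simp add: h_def)
      then show ?thesis using 3 \<open>W \<noteq> {}\<close> by (simp add: b_def)
    next
      case 4
      then have "W \<noteq> {}" by auto
      have "c W = 0" using deg[of W] 4 by fastforce
      then have "g W = 0" using g_eq[OF W] integral_psum_sq_mult_walsh[OF W] 4 h0[OF _ W] by (simp add: h_def)
      moreover have "h W = 0" using h0[OF _ W] 4 by simp
      ultimately show ?thesis using \<open>W \<noteq> {}\<close> by (simp add: b_def)
    qed
  qed
  have "(\<integral>x. (defect n x)\<^sup>2 \<partial>cube) = (\<Sum>W\<in>Pow {..<n}. (b W)\<^sup>2)"
    unfolding defect_eq power2_eq_square by (rule integral_walsh_sum_mult)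
  also have "\<dots> \<le> (\<Sum>W\<in>Pow {..<n}. (real d)\<^sup>2 * ((g W)\<^sup>2 - (if W = {} then (norm_sq n)\<^sup>2 else 0) - (h W)\<^sup>2))"
    by (intro sum_mono bg)
  also have "\<dots> = (real d)\<^sup>2 * ((\<Sum>W\<in>Pow {..<n}. (g W)\<^sup>2) - (norm_sq n)\<^sup>2 - (\<Sum>W\<in>Pow {..<n}. (h W)\<^sup>2))"
    by (simp add: sum_distrib_left[symmetric] sum_subtractf)
  also have "(\<Sum>W\<in>Pow {..<n}. (g W)\<^sup>2) = (\<integral>x. (G x)\<^sup>2 \<partial>cube)"
    unfolding G power2_eq_square by (rule integral_walsh_sum_mult[symmetric])
  also have "\<dots> = (\<integral>x. psum n x ^ 4 - 2 * psum n x ^ 3 + (psum n x)\<^sup>2 \<partial>cube)"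
    by (intro Bochner_Integration.integral_cong)
       (auto simp: G_def power2_eq_square power3_eq_cube power4_eq_xxxx algebra_simps)
  also have "\<dots> = (\<integral>x. psum n x ^ 4 \<partial>cube) - 2 * (\<integral>x. psum n x ^ 3 \<partial>cube) + norm_sq n"
  proof -
    have "integrable cube (\<lambda>x. psum n x ^ j)" for j
      by (intro cyl_integrable[of n] cyl_intros cyl_psum)
    then show ?thesis by (simp add: psum_second_moment)
  qed
  finally have 1: "(\<integral>x. (defect n x)\<^sup>2 \<partial>cube) \<le> (real d)\<^sup>2 *
    ((\<integral>x. psum n x ^ 4 \<partial>cube) - 2 * (\<integral>x. psum n x ^ 3 \<partial>cube) + norm_sq n - (norm_sq n)\<^sup>2 - (\<Sum>W\<in>Pow {..<n}. (h W)\<^sup>2))" .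
  have "2 * (norm_sq n)\<^sup>2 - (4 ^ d + 2) * real d * infl * norm_sq n \<le> (\<Sum>W\<in>Pow {..<n}. (h W)\<^sup>2)"
    unfolding norm_sq_def h_def
    by (rule top_degree_lower_bound[OF _ deg d_ge_1 influences_le]) simp_all
  then have "(real d)\<^sup>2 * ((\<integral>x. psum n x ^ 4 \<partial>cube) - 2 * (\<integral>x. psum n x ^ 3 \<partial>cube) + norm_sq n - (norm_sq n)\<^sup>2 - (\<Sum>W\<in>Pow {..<n}. (h W)\<^sup>2))
     \<le> (real d)\<^sup>2 * excess n"
    unfolding excess_def by (intro mult_left_mono) auto
  with 1 show ?thesis by linarith
qed

lemma excess_nonneg: "0 \<le> excess n"
proof -
  have "0 \<le> (\<integral>x. (defect n x)\<^sup>2 \<partial>cube)" by (intro Bochner_Integration.integral_nonneg) simp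
  then have "0 \<le> (real d)\<^sup>2 * excess n" using defect_second_moment[of n] by linarith
  then show ?thesis using d_ge_1 by (simp add: zero_le_mult_iff)
qed

lemma integrable_cyl_poly:
  shows "integrable cube (\<lambda>x. psum n x ^ j)" "integrable cube (\<lambda>x. psum n x ^ j * defect n x)"
    "integrable cube (\<lambda>x. (defect n x)\<^sup>2)" "integrable cube (defect n)"
  by (intro cyl_integrable[of n] cyl_intros cyl_psum cyl_defect)+

lemma sqrt_defect: "sqrt (\<integral>x. (defect n x)\<^sup>2 \<partial>cube) \<le> real d * sqrt (excess n)"
  using real_sqrt_le_mono[OF defect_second_moment[of n]] by (simp add: real_sqrt_mult)

text \<open>
  Symmetry of the generator gives \<open>E[F \<Gamma>] = d E[F\<^sup>3] / 2\<close>, whereas \<open>\<Gamma>\<close> replaced by its approximation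
  gives \<open>d E[F\<^sup>2] / 2\<close>.
\<close>
lemma third_moment_bound: "\<bar>(\<integral>x. psum n x ^ 3 \<partial>cube) - norm_sq n\<bar> \<le> 2 * (sqrt (norm_sq n) * sqrt (excess n))"
proof -
  have "(\<integral>x. psum n x * Gam n (psum n) x \<partial>cube) = (\<integral>x. (psum n x * gen n (\<lambda>y. (psum n y)\<^sup>2) x) / 2 + real d * psum n x ^ 3 \<partial>cube)"
    by (intro Bochner_Integration.integral_cong)
       (auto simp: Gam_eq gen_psum power2_eq_square power3_eq_cube algebra_simps)
  also have "\<dots> = (\<integral>x. psum n x * gen n (\<lambda>y. (psum n y)\<^sup>2) x \<partial>cube) / 2 + real d * (\<integral>x. psum n x ^ 3 \<partial>cube)"
    using integrable_cyl_poly(1)[of n 3] cyl_integrable[of n "\<lambda>x. psum n x * gen n (\<lambda>y. (psum n y)\<^sup>2) x"]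
    by (simp add: cyl_mult cyl_psum cyl_gen cyl_power)
  also have "(\<integral>x. psum n x * gen n (\<lambda>y. (psum n y)\<^sup>2) x \<partial>cube) = (\<integral>x. gen n (psum n) x * (psum n x)\<^sup>2 \<partial>cube)"
    by (rule integral_gen_symmetric_cyl[symmetric]) (intro cyl_intros cyl_psum)+
  also have "\<dots> = - (real d * (\<integral>x. psum n x ^ 3 \<partial>cube))"
    by (simp add: gen_psum power2_eq_square power3_eq_cube mult.assoc)
  finally have FG: "(\<integral>x. psum n x * Gam n (psum n) x \<partial>cube) = real d / 2 * (\<integral>x. psum n x ^ 3 \<partial>cube)" by (simp add: field_simps)
  have "(\<integral>x. psum n x * defect n x \<partial>cube) = (\<integral>x. psum n x * Gam n (psum n) x - real d / 2 * (psum n x)\<^sup>2 - real d * norm_sq n * psum n x \<partial>cube)"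
    by (intro Bochner_Integration.integral_cong) (auto simp: defect_def power2_eq_square algebra_simps)
  also have "\<dots> = real d / 2 * ((\<integral>x. psum n x ^ 3 \<partial>cube) - norm_sq n)"
    using integrable_cyl_poly(1)[of n 2] integrable_cyl_poly(1)[of n 1] cyl_integrable[of n "\<lambda>x. psum n x * Gam n (psum n) x"]
    by (simp add: FG cyl_mult cyl_psum cyl_Gam psum_second_moment psum_mean right_diff_distrib)
  finally have "real d / 2 * \<bar>(\<integral>x. psum n x ^ 3 \<partial>cube) - norm_sq n\<bar> = \<bar>\<integral>x. psum n x * defect n x \<partial>cube\<bar>"
    by (simp only: abs_mult)
  also have "\<dots> \<le> sqrt (\<integral>x. (psum n x)\<^sup>2 \<partial>cube) * sqrt (\<integral>x. (defect n x)\<^sup>2 \<partial>cube)"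
    using integrable_cyl_poly by (intro Cauchy_Schwarz_integral_sqrt cyl_measurable[OF cyl_defect] psum_measurable)
  also have "\<dots> \<le> sqrt (norm_sq n) * (real d * sqrt (excess n))"
    unfolding psum_second_moment by (intro mult_left_mono sqrt_defect) (simp add: norm_sq_nonneg)
  finally have "real d / 2 * \<bar>(\<integral>x. psum n x ^ 3 \<partial>cube) - norm_sq n\<bar> \<le> real d / 2 * (2 * (sqrt (norm_sq n) * sqrt (excess n)))" by (simp add: ac_simps)
  then show ?thesis using d_ge_1 by (simp add: mult_le_cancel_left_pos)
qed

text \<open>
  The left-hand side equals \<open>12 E[F\<^sup>2 \<Gamma>] - 4 d E[F\<^sup>4]\<close>. After replacing \<open>\<Gamma>\<close> by its approximation, the
  fourth moment occurs with a negative sign, and nonnegativity of \<open>excess\<close> bounds it from below.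
\<close>
lemma fourth_differences_bound:
  "(\<Sum>k<n. \<integral>x. rate k x * (psum n (flip k x) - psum n x) ^ 4 \<partial>cube) \<le> 2 * real d * norm_sq n
    + 12 * real d * (sqrt (\<integral>x. psum n x ^ 4 \<partial>cube) * sqrt (excess n)) + 4 * real d * (sqrt (norm_sq n) * sqrt (excess n))
    + 4 * real d * ((4 ^ d + 2) * real d * infl * norm_sq n)"
proof -
  define m3 m4 where "m3 = (\<integral>x. psum n x ^ 3 \<partial>cube)" and "m4 = (\<integral>x. psum n x ^ 4 \<partial>cube)"
  note cf = cyl_psum[of n]
  have cL: "cyl n (\<lambda>x. (psum n x)\<^sup>2 * gen n (\<lambda>y. (psum n y)\<^sup>2) x)" "cyl n (\<lambda>x. (psum n x)\<^sup>2 * Gam n (psum n) x)"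
    by (intro cyl_intros cyl_gen cf cyl_Gam order_refl)+
  have "(\<Sum>k<n. \<integral>x. rate k x * (psum n (flip k x) - psum n x) ^ 4 \<partial>cube)
      = (\<Sum>k<n. 6 * (\<integral>x. (psum n x)\<^sup>2 * gen_at k (\<lambda>y. (psum n y)\<^sup>2) x \<partial>cube) - 8 * (\<integral>x. psum n x ^ 3 * gen_at k (psum n) x \<partial>cube))"
    by (intro sum.cong refl integral_fourth_power_flip[OF cf]) simp
  also have "\<dots> = 6 * (\<Sum>k<n. \<integral>x. (psum n x)\<^sup>2 * gen_at k (\<lambda>y. (psum n y)\<^sup>2) x \<partial>cube) - 8 * (\<Sum>k<n. \<integral>x. psum n x ^ 3 * gen_at k (psum n) x \<partial>cube)"
    by (simp add: sum_subtractf sum_distrib_left)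
  also have "(\<Sum>k<n. \<integral>x. (psum n x)\<^sup>2 * gen_at k (\<lambda>y. (psum n y)\<^sup>2) x \<partial>cube) = (\<integral>x. (psum n x)\<^sup>2 * gen n (\<lambda>y. (psum n y)\<^sup>2) x \<partial>cube)"
    unfolding gen_def sum_distrib_left
    by (intro Bochner_Integration.integral_sum[symmetric] cyl_integrable[of n] cyl_intros cf) simp
  also have "(\<Sum>k<n. \<integral>x. psum n x ^ 3 * gen_at k (psum n) x \<partial>cube) = (\<integral>x. psum n x ^ 3 * gen n (psum n) x \<partial>cube)"
    unfolding gen_def sum_distrib_left
    by (intro Bochner_Integration.integral_sum[symmetric] cyl_integrable[of n] cyl_intros cf) simp
  also have "\<dots> = - (real d * m4)"
    by (simp add: gen_psum m4_def power3_eq_cube power4_eq_xxxx ac_simps)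
  also have "(\<integral>x. (psum n x)\<^sup>2 * gen n (\<lambda>y. (psum n y)\<^sup>2) x \<partial>cube) = (\<integral>x. 2 * ((psum n x)\<^sup>2 * Gam n (psum n) x) - 2 * real d * psum n x ^ 4 \<partial>cube)"
    by (intro Bochner_Integration.integral_cong)
       (auto simp: Gam_eq gen_psum power2_eq_square power4_eq_xxxx algebra_simps)
  also have "\<dots> = 2 * (\<integral>x. (psum n x)\<^sup>2 * Gam n (psum n) x \<partial>cube) - 2 * real d * m4"
    using integrable_cyl_poly(1)[of n 4] cyl_integrable[OF cL(2)] by (simp add: m4_def)
  also have "(\<integral>x. (psum n x)\<^sup>2 * Gam n (psum n) x \<partial>cube)
      = (\<integral>x. (psum n x)\<^sup>2 * defect n x + real d / 2 * psum n x ^ 3 + real d * norm_sq n * (psum n x)\<^sup>2 \<partial>cube)"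
    by (intro Bochner_Integration.integral_cong) (auto simp: defect_def power2_eq_square power3_eq_cube algebra_simps)
  also have "\<dots> = (\<integral>x. (psum n x)\<^sup>2 * defect n x \<partial>cube) + real d / 2 * m3 + real d * (norm_sq n)\<^sup>2"
    using integrable_cyl_poly[of n] by (simp add: m3_def psum_second_moment power2_eq_square[of "norm_sq n"])
  finally have 1: "(\<Sum>k<n. \<integral>x. rate k x * (psum n (flip k x) - psum n x) ^ 4 \<partial>cube)
     = 12 * (\<integral>x. (psum n x)\<^sup>2 * defect n x \<partial>cube) + real d * (6 * m3 + 12 * (norm_sq n)\<^sup>2 - 4 * m4)"
    by (simp add: algebra_simps)
  have "\<bar>\<integral>x. (psum n x)\<^sup>2 * defect n x \<partial>cube\<bar> \<le> sqrt (\<integral>x. ((psum n x)\<^sup>2)\<^sup>2 \<partial>cube) * sqrt (\<integral>x. (defect n x)\<^sup>2 \<partial>cube)"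
    using integrable_cyl_poly[of n] by (intro Cauchy_Schwarz_integral_sqrt cyl_measurable[OF cyl_defect]) auto
  also have "\<dots> = sqrt m4 * sqrt (\<integral>x. (defect n x)\<^sup>2 \<partial>cube)"
    by (simp add: m4_def)
  also have "\<dots> \<le> sqrt m4 * (real d * sqrt (excess n))"
    by (intro mult_left_mono sqrt_defect) (simp add: m4_def)
  finally have 2: "(\<integral>x. (psum n x)\<^sup>2 * defect n x \<partial>cube) \<le> real d * (sqrt m4 * sqrt (excess n))" by (simp add: ac_simps)
  have 3: "6 * m3 + 12 * (norm_sq n)\<^sup>2 - 4 * m4 = 2 * (norm_sq n) + 2 * (norm_sq n - m3) + 4 * ((4 ^ d + 2) * real d * infl * norm_sq n) - 4 * excess n"
    by (simp add: excess_def m3_def m4_def)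
  have "6 * m3 + 12 * (norm_sq n)\<^sup>2 - 4 * m4 \<le> 2 * norm_sq n + 4 * (sqrt (norm_sq n) * sqrt (excess n)) + 4 * ((4 ^ d + 2) * real d * infl * norm_sq n)"
  proof -
    have gen: "2 * a + 2 * (a - b) + 4 * z - 4 * r \<le> 2 * a + 4 * q + 4 * z"
      if "\<bar>b - a\<bar> \<le> 2 * q" "0 \<le> r" for a b z r q :: real
    proof -
      have "a - b \<le> 2 * q" using that(1) by (simp add: abs_le_iff)
      then show ?thesis using that(2) by (simp add: algebra_simps)
    qed
    show ?thesis
      unfolding 3 by (rule gen[OF third_moment_bound[of n, folded m3_def] excess_nonneg])
  qed
  then have "real d * (6 * m3 + 12 * (norm_sq n)\<^sup>2 - 4 * m4) \<le> real d * (2 * norm_sq n + 4 * (sqrt (norm_sq n) * sqrt (excess n)) + 4 * ((4 ^ d + 2) * real d * infl * norm_sq n))"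
    by (intro mult_left_mono) auto
  also have "\<dots> = 2 * real d * norm_sq n + 4 * real d * (sqrt (norm_sq n) * sqrt (excess n)) + 4 * real d * ((4 ^ d + 2) * real d * infl * norm_sq n)"
    by (simp add: distrib_left)
  finally show ?thesis unfolding 1 m4_def[symmetric] using 2 by linarith
qed

end

section \<open>Passage to infinite homogeneous sums\<close>

lemma Pow_split: "n \<le> k \<Longrightarrow> Pow {..<k} = Pow {..<n} \<union> {S. S \<subseteq> {..<k} \<and> \<not> S \<subseteq> {..<n::nat}}"
  by auto

lemma Pow_sum_split:
  fixes g :: "nat set \<Rightarrow> real"
  assumes "n \<le> k"
  shows "(\<Sum>S\<in>Pow {..<k}. g S) = (\<Sum>S\<in>Pow {..<n}. g S) + (\<Sum>S | S \<subseteq> {..<k} \<and> \<not> S \<subseteq> {..<n}. g S)"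
  unfolding Pow_split[OF assms]
  by (rule sum.union_disjoint) (auto intro: finite_subset[of _ "Pow {..<k}"])

context biased_cube
begin

lemma cyl_mono:
  assumes "cyl n u" "n \<le> k" shows "cyl k u"
  unfolding cyl_def
proof (intro allI impI)
  fix x y :: "nat \<Rightarrow> bool" assume "\<forall>i<k. x i = y i"
  then have "\<forall>i<n. x i = y i" using assms(2) by auto
  then show "u x = u y" using assms(1) unfolding cyl_def by blast
qed

lemma cyl_L2: "cyl n u \<Longrightarrow> square_integrable cube u"
  unfolding square_integrable_def using cyl_measurable[of n u] cyl_integrable[OF cyl_power[of n u 2]] by simp

lemma gen_at_measurable [measurable]:
  assumes [measurable]: "u \<in> borel_measurable cube"
  shows "gen_at k u \<in> borel_measurable cube"
  unfolding gen_at_def[abs_def] by measurable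

text \<open>Resampling is a contraction, so \<open>gen_at k\<close> has norm at most \<open>2\<close>.\<close>
lemma gen_at_square_le:
  assumes u: "square_integrable cube u"
  shows "integrable cube (\<lambda>x. (gen_at k u x)\<^sup>2)" and "(\<integral>x. (gen_at k u x)\<^sup>2 \<partial>cube) \<le> 4 * (\<integral>x. (u x)\<^sup>2 \<partial>cube)"
proof -
  note [measurable] = L2_measurable[OF u]
  note int = L2_integrable_sq[OF u]
  have i: "integrable cube (\<lambda>x. rate k x * (u x)\<^sup>2)" "integrable cube (\<lambda>x. rate k x * (u (flip k x))\<^sup>2)"
    using integrable_rate_mult[OF int] integrable_rate_flip[OF int] by auto
  have le: "(gen_at k u x)\<^sup>2 \<le> 2 * (rate k x * (u (flip k x))\<^sup>2) + 2 * (rate k x * (u x)\<^sup>2)" for x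
  proof -
    have "(gen_at k u x)\<^sup>2 = (rate k x * rate k x) * (u (flip k x) - u x)\<^sup>2"
      by (simp add: gen_at_def power2_eq_square)
    also have "\<dots> \<le> (rate k x * 1) * (u (flip k x) - u x)\<^sup>2"
      using rate_pos[of k x] rate_le_1[of k x] by (intro mult_right_mono mult_left_mono) auto
    also have "\<dots> \<le> rate k x * (2 * (u (flip k x))\<^sup>2 + 2 * (u x)\<^sup>2)"
    proof (rule mult_mono)
      show "(u (flip k x) - u x)\<^sup>2 \<le> 2 * (u (flip k x))\<^sup>2 + 2 * (u x)\<^sup>2"
        using zero_le_power2[of "u (flip k x) + u x"] by (simp add: power2_eq_square algebra_simps)
    qed (use rate_pos[of k x] in auto)
    finally show ?thesis by (simp add: distrib_left)
  qed
  show I: "integrable cube (\<lambda>x. (gen_at k u x)\<^sup>2)"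
  proof (rule Bochner_Integration.integrable_bound)
    show "integrable cube (\<lambda>x. 2 * (rate k x * (u (flip k x))\<^sup>2) + 2 * (rate k x * (u x)\<^sup>2))" using i by simp
    show "AE x in cube. norm ((gen_at k u x)\<^sup>2) \<le> norm (2 * (rate k x * (u (flip k x))\<^sup>2) + 2 * (rate k x * (u x)\<^sup>2))"
      using le by (intro AE_I2) (simp, smt (verit) zero_le_power2)
  qed measurable
  have "(\<integral>x. (gen_at k u x)\<^sup>2 \<partial>cube) \<le> (\<integral>x. 2 * (rate k x * (u (flip k x))\<^sup>2) + 2 * (rate k x * (u x)\<^sup>2) \<partial>cube)"
    using i by (intro integral_mono I le) simp
  also have "\<dots> = 4 * (\<integral>x. rate k x * (u x)\<^sup>2 \<partial>cube)"
    using i integral_flip(1)[of "\<lambda>x. (u x)\<^sup>2" k] by simp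
  also have "\<dots> \<le> 4 * (\<integral>x. (u x)\<^sup>2 \<partial>cube)"
    using i int rate_pos rate_le_1 by (intro mult_left_mono integral_mono) (auto intro!: mult_left_le_one_le less_imp_le[OF rate_pos] rate_le_1)
  finally show "(\<integral>x. (gen_at k u x)\<^sup>2 \<partial>cube) \<le> 4 * (\<integral>x. (u x)\<^sup>2 \<partial>cube)" .
qed

lemma L2_gen_at: "square_integrable cube u \<Longrightarrow> square_integrable cube (gen_at k u)"
  using gen_at_square_le(1) by (auto simp: square_integrable_def)

lemma L2_gen: "square_integrable cube u \<Longrightarrow> square_integrable cube (gen n u)"
  unfolding gen_def[abs_def] by (intro L2_sum L2_gen_at)

lemma L2_tendsto_gen_at:
  assumes u: "L2_tendsto cube u u0"
  shows "L2_tendsto cube (\<lambda>n. gen_at k (u n)) (gen_at k u0)"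
proof -
  have *: "square_integrable cube (u n)" "square_integrable cube u0" "square_integrable cube (\<lambda>x. u n x - u0 x)" for n
    using u by (auto simp: L2_tendsto_def intro: L2_diff)
  have "(\<lambda>n. \<integral>x. (gen_at k (u n) x - gen_at k u0 x)\<^sup>2 \<partial>cube) \<longlonglongrightarrow> 0"
  proof (rule tendsto_sandwich[OF _ _ tendsto_const])
    have "gen_at k (u n) x - gen_at k u0 x = gen_at k (\<lambda>x. u n x - u0 x) x" for n x by (simp add: gen_at_def algebra_simps)
    then show "\<forall>\<^sub>F n in sequentially. (\<integral>x. (gen_at k (u n) x - gen_at k u0 x)\<^sup>2 \<partial>cube) \<le> 4 * (\<integral>x. (u n x - u0 x)\<^sup>2 \<partial>cube)"
      using gen_at_square_le(2)[OF *(3), of k] by (intro always_eventually) auto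
    show "(\<lambda>n. 4 * (\<integral>x. (u n x - u0 x)\<^sup>2 \<partial>cube)) \<longlonglongrightarrow> 0"
      using u by (auto simp: L2_tendsto_def intro!: tendsto_mult_right_zero)
  qed auto
  then show ?thesis using * by (auto simp: L2_tendsto_def intro: L2_gen_at)
qed

lemma L2_tendsto_gen: "L2_tendsto cube u u0 \<Longrightarrow> L2_tendsto cube (\<lambda>n. gen N (u n)) (gen N u0)"
  unfolding gen_def[abs_def] by (intro L2_tendsto_sum L2_tendsto_gen_at)

lemma Gam_measurable [measurable]:
  assumes [measurable]: "u \<in> borel_measurable cube"
  shows "Gam n u \<in> borel_measurable cube"
  unfolding Gam_def[abs_def] by measurable

lemma integrable_rate_diff_sq:
  assumes u: "square_integrable cube u"
  shows "integrable cube (\<lambda>x. rate k x * (u (flip k x) - u x)\<^sup>2)"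
    and "(\<integral>x. rate k x * (u (flip k x) - u x)\<^sup>2 \<partial>cube) = - 2 * (\<integral>x. u x * gen_at k u x \<partial>cube)"
proof -
  note [measurable] = L2_measurable[OF u]
  note int = L2_integrable_sq[OF u]
  have i: "integrable cube (\<lambda>x. rate k x * (u x)\<^sup>2)" "integrable cube (\<lambda>x. rate k x * (u (flip k x))\<^sup>2)"
    using integrable_rate_mult[OF int] integrable_rate_flip[OF int] by auto
  have i2: "integrable cube (\<lambda>x. u x * gen_at k u x)" by (intro L2_integrable_mult L2_gen_at u)
  have eq: "(\<lambda>x. rate k x * (u (flip k x) - u x)\<^sup>2) = (\<lambda>x. (rate k x * (u (flip k x))\<^sup>2 - rate k x * (u x)\<^sup>2) - 2 * (u x * gen_at k u x))"
    by (auto simp: fun_eq_iff gen_at_def power2_eq_square algebra_simps)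
  show "integrable cube (\<lambda>x. rate k x * (u (flip k x) - u x)\<^sup>2)" unfolding eq using i i2 by simp
  show "(\<integral>x. rate k x * (u (flip k x) - u x)\<^sup>2 \<partial>cube) = - 2 * (\<integral>x. u x * gen_at k u x \<partial>cube)"
    unfolding eq using i i2 integral_flip(1)[of "\<lambda>x. (u x)\<^sup>2" k] by simp
qed

lemma Gam_integral:
  assumes u: "square_integrable cube u"
  shows "integrable cube (Gam n u)" and "(\<integral>x. Gam n u x \<partial>cube) = - (\<integral>x. u x * gen n u x \<partial>cube)"
proof -
  show "integrable cube (Gam n u)"
    unfolding Gam_def[abs_def] using integrable_rate_diff_sq(1)[OF u] by simp
  have "(\<integral>x. Gam n u x \<partial>cube) = (\<Sum>k<n. \<integral>x. rate k x * (u (flip k x) - u x)\<^sup>2 \<partial>cube) / 2"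
    unfolding Gam_def using integrable_rate_diff_sq(1)[OF u] by (simp add: Bochner_Integration.integral_sum)
  also have "\<dots> = - (\<Sum>k<n. \<integral>x. u x * gen_at k u x \<partial>cube)"
    unfolding integrable_rate_diff_sq(2)[OF u] by (simp add: sum_distrib_left[symmetric] sum_negf)
  also have "(\<Sum>k<n. \<integral>x. u x * gen_at k u x \<partial>cube) = (\<integral>x. u x * gen n u x \<partial>cube)"
    unfolding gen_def sum_distrib_left using u
    by (intro Bochner_Integration.integral_sum[symmetric] L2_integrable_mult L2_gen_at)
  finally show "(\<integral>x. Gam n u x \<partial>cube) = - (\<integral>x. u x * gen n u x \<partial>cube)" .
qed

end

text \<open>
  The limit \<open>phi\<close> of the homogeneous sums. Its fourth moment is an assumption: the fourth moments of
  the coordinates \<open>Y k\<close> need not be bounded, so hypercontractivity is of no help.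
\<close>
locale chaos_limit = walsh_chaos +
  fixes phi :: "(nat \<Rightarrow> bool) \<Rightarrow> real"
  assumes phi_measurable [measurable]: "phi \<in> borel_measurable cube"
    and phi4: "integrable cube (\<lambda>x. phi x ^ 4)"
    and psum_tendsto: "(\<lambda>n. \<integral>x. (psum n x - phi x)\<^sup>2 \<partial>cube) \<longlonglongrightarrow> 0"
begin

lemma integrable_phi_power: "j \<le> 4 \<Longrightarrow> integrable cube (\<lambda>x. phi x ^ j)"
  by (rule integrable_power_of_fourth[OF phi_measurable phi4])

lemma L2_phi: "square_integrable cube phi"
  using integrable_phi_power[of 2] by (simp add: square_integrable_def)

lemma L2_psum: "square_integrable cube (psum n)"
  by (rule cyl_L2[OF cyl_psum])

lemma psum_L2_tendsto: "L2_tendsto cube psum phi"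
  using psum_tendsto L2_phi L2_psum by (simp add: L2_tendsto_def)

definition M2 :: real where "M2 = (\<integral>x. phi x ^ 2 \<partial>cube)"
definition M3 :: real where "M3 = (\<integral>x. phi x ^ 3 \<partial>cube)"
definition M4 :: real where "M4 = (\<integral>x. phi x ^ 4 \<partial>cube)"
definition truncation_error :: "nat \<Rightarrow> real" where "truncation_error n = (\<integral>x. (psum n x - phi x)\<^sup>2 \<partial>cube)"

lemma truncation_error_tendsto: "truncation_error \<longlonglongrightarrow> 0"
  using psum_tendsto by (simp add: truncation_error_def[abs_def])

lemma norm_sq_tendsto: "norm_sq \<longlonglongrightarrow> M2"
  using L2_tendsto_norm[OF psum_L2_tendsto] by (simp add: psum_second_moment M2_def)

lemma norm_sq_mono: "n \<le> k \<Longrightarrow> norm_sq n \<le> norm_sq k"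
  unfolding norm_sq_def by (intro sum_mono2) auto

lemma norm_sq_le: "norm_sq n \<le> M2"
  using norm_sq_mono by (intro incseq_le norm_sq_tendsto) (auto simp: incseq_def)

lemma M4_nonneg: "0 \<le> M4"
  by (simp add: M4_def)

lemma phi_mean: "(\<integral>x. phi x \<partial>cube) = 0"
proof -
  have "(\<lambda>n. \<integral>x. psum n x * 1 \<partial>cube) \<longlonglongrightarrow> (\<integral>x. phi x * 1 \<partial>cube)"
    by (intro L2_tendsto_inner psum_L2_tendsto L2_tendsto_const) (simp add: square_integrable_def)
  then show ?thesis by (simp add: psum_mean LIMSEQ_const_iff)
qed

lemma psum_flip: "n \<le> k \<Longrightarrow> psum n (flip k x) = psum n x"
  unfolding psum_def
proof (intro sum.cong refl)
  fix S assume "n \<le> k" "S \<in> Pow {..<n}"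
  then have "k \<notin> S" by auto
  then show "c S * walsh S (flip k x) = c S * walsh S x" by (simp add: walsh_flip_notin)
qed

text \<open>
  The partial sum \<open>psum n\<close> is the conditional expectation of \<open>phi\<close> given the first \<open>n\<close> coordinates, since all
  other Walsh functions are orthogonal to cylinder functions.
\<close>

lemma integral_psum_cube_mult: "(\<integral>x. psum n x ^ 3 * phi x \<partial>cube) = (\<integral>x. psum n x ^ 4 \<partial>cube)"
proof -
  have cF: "cyl n (\<lambda>x. psum n x ^ 3)" by (intro cyl_intros cyl_psum)
  have ck: "cyl k (\<lambda>x. psum n x ^ 3)" if "n \<le> k" for k
    by (rule cyl_mono[OF cF that])
  have *: "(\<integral>x. psum n x ^ 3 * psum k x \<partial>cube) = (\<integral>x. psum n x ^ 4 \<partial>cube)" if k: "n \<le> k" for k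
  proof -
    have z: "(\<integral>x. psum n x ^ 3 * (c S * walsh S x) \<partial>cube) = 0" if S: "S \<subseteq> {..<k} \<and> \<not> S \<subseteq> {..<n}" for S
    proof -
      obtain i where "i \<in> S" "i \<notin> {..<n}" using S by blast
      then have i: "i \<in> S" "n \<le> i" by auto
      have "(\<integral>x. walsh S x * psum n x ^ 3 \<partial>cube) = 0"
        using S i finite_subset_lessThan
        by (intro integral_walsh_mult_eq_0[where n = k and k = i] ck[OF k]) (auto simp: psum_flip)
      then show ?thesis by (simp add: ac_simps)
    qed
    have int: "integrable cube (\<lambda>x. psum n x ^ 3 * (c S * walsh S x))" if "S \<subseteq> {..<k}" for S
      using that by (intro cyl_integrable[of k] cyl_mult ck[OF k] cyl_const cyl_walsh)
    have "psum n x ^ 3 * psum k x = psum n x ^ 4 + (\<Sum>S | S \<subseteq> {..<k} \<and> \<not> S \<subseteq> {..<n}. psum n x ^ 3 * (c S * walsh S x))" for x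
    proof -
      have "psum k x = psum n x + (\<Sum>S | S \<subseteq> {..<k} \<and> \<not> S \<subseteq> {..<n}. c S * walsh S x)"
        unfolding psum_def by (rule Pow_sum_split[OF k])
      then show ?thesis by (simp add: distrib_left sum_distrib_left power3_eq_cube power4_eq_xxxx)
    qed
    then have "(\<integral>x. psum n x ^ 3 * psum k x \<partial>cube) = (\<integral>x. psum n x ^ 4 + (\<Sum>S | S \<subseteq> {..<k} \<and> \<not> S \<subseteq> {..<n}. psum n x ^ 3 * (c S * walsh S x)) \<partial>cube)"
      by simp
    also have "\<dots> = (\<integral>x. psum n x ^ 4 \<partial>cube) + (\<Sum>S | S \<subseteq> {..<k} \<and> \<not> S \<subseteq> {..<n}. \<integral>x. psum n x ^ 3 * (c S * walsh S x) \<partial>cube)"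
      using int integrable_cyl_poly(1)[of n 4]
      by (subst Bochner_Integration.integral_add) (auto intro!: Bochner_Integration.integral_sum)
    also have "\<dots> = (\<integral>x. psum n x ^ 4 \<partial>cube)" using z by simp
    finally show ?thesis .
  qed
  have "(\<lambda>k. \<integral>x. psum n x ^ 3 * psum k x \<partial>cube) \<longlonglongrightarrow> (\<integral>x. psum n x ^ 3 * phi x \<partial>cube)"
    by (intro L2_tendsto_inner psum_L2_tendsto L2_tendsto_const cyl_L2[OF cF])
  moreover have "(\<lambda>k. \<integral>x. psum n x ^ 3 * psum k x \<partial>cube) \<longlonglongrightarrow> (\<integral>x. psum n x ^ 4 \<partial>cube)"
    by (rule tendsto_eventually) (rule eventually_sequentiallyI[of n], rule *)
  ultimately show ?thesis by (rule LIMSEQ_unique)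
qed

text \<open>Jensen's inequality for the conditional expectation \<open>psum n\<close>, in the form of Young's inequality.\<close>
lemma psum_fourth_moment_le: "(\<integral>x. psum n x ^ 4 \<partial>cube) \<le> M4"
proof -
  have Young: "a ^ 3 * b \<le> 3/4 * a ^ 4 + 1/4 * b ^ 4" for a b :: real
  proof -
    have "0 \<le> (a - b)\<^sup>2 * (2 * a\<^sup>2 + (a + b)\<^sup>2)" by simp
    also have "\<dots> = 4 * (3/4 * a ^ 4 + 1/4 * b ^ 4 - a ^ 3 * b)"
      by (simp add: power2_eq_square power3_eq_cube power4_eq_xxxx algebra_simps)
    finally show ?thesis by simp
  qed
  have "(\<integral>x. psum n x ^ 4 \<partial>cube) = (\<integral>x. psum n x ^ 3 * phi x \<partial>cube)"
    by (rule integral_psum_cube_mult[symmetric])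
  also have "\<dots> \<le> (\<integral>x. 3/4 * psum n x ^ 4 + 1/4 * phi x ^ 4 \<partial>cube)"
    using integrable_cyl_poly(1)[of n 4] phi4
    by (intro integral_mono Young L2_integrable_mult cyl_L2[of n] L2_phi cyl_intros cyl_psum) simp
  also have "\<dots> = 3/4 * (\<integral>x. psum n x ^ 4 \<partial>cube) + 1/4 * M4"
    using integrable_cyl_poly(1)[of n 4] phi4 by (simp add: M4_def)
  finally show ?thesis by simp
qed

text \<open>
  The difference of the cubes is \<open>(F - phi) (F\<^sup>2 + F phi + phi\<^sup>2)\<close>, whose second factor is bounded in
  quadratic mean by the fourth moments.
\<close>
lemma psum_third_moment_tendsto: "(\<lambda>n. \<integral>x. psum n x ^ 3 \<partial>cube) \<longlonglongrightarrow> M3"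
proof (rule LIM_zero_cancel, rule Lim_null_comparison)
  show "\<forall>\<^sub>F n in sequentially. norm ((\<integral>x. psum n x ^ 3 \<partial>cube) - M3) \<le> sqrt (truncation_error n) * sqrt (9 * M4)"
  proof (rule always_eventually, rule allI)
    fix n
    define v where "v x = (psum n x)\<^sup>2 + psum n x * phi x + (phi x)\<^sup>2" for x
    have [measurable]: "v \<in> borel_measurable cube" unfolding v_def[abs_def] by measurable
    have v: "(v x)\<^sup>2 \<le> 9/2 * psum n x ^ 4 + 9/2 * phi x ^ 4" for x
    proof -
      define a b where "a = psum n x" and "b = phi x"
      have "\<bar>a * b\<bar> \<le> (a\<^sup>2 + b\<^sup>2) / 2"
        using sum_squares_bound[of "\<bar>a\<bar>" "\<bar>b\<bar>"] by (simp add: abs_mult)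
      then have "\<bar>v x\<bar> \<le> 3/2 * (a\<^sup>2 + b\<^sup>2)"
        unfolding v_def a_def[symmetric] b_def[symmetric] by (simp add: abs_le_iff algebra_simps)
      then have "(v x)\<^sup>2 \<le> (3/2 * (a\<^sup>2 + b\<^sup>2))\<^sup>2" by (rule abs_le_square_iff[THEN iffD1, OF order_trans]) simp
      also have "\<dots> \<le> 9/2 * a ^ 4 + 9/2 * b ^ 4"
        using zero_le_power2[of "a\<^sup>2 - b\<^sup>2"] by (simp add: power2_eq_square power4_eq_xxxx algebra_simps)
      finally show ?thesis by (simp add: a_def b_def)
    qed
    have i: "integrable cube (\<lambda>x. 9/2 * psum n x ^ 4 + 9/2 * phi x ^ 4)"
      using integrable_cyl_poly(1)[of n 4] phi4 by simp
    have iv: "integrable cube (\<lambda>x. (v x)\<^sup>2)"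
      using v by (intro Bochner_Integration.integrable_bound[OF i] AE_I2) (auto intro: order_trans)
    then have L2v: "square_integrable cube v" by (simp add: square_integrable_def)
    have "(\<integral>x. (v x)\<^sup>2 \<partial>cube) \<le> (\<integral>x. 9/2 * psum n x ^ 4 + 9/2 * phi x ^ 4 \<partial>cube)"
      by (intro integral_mono iv i v)
    also have "\<dots> = 9/2 * (\<integral>x. psum n x ^ 4 \<partial>cube) + 9/2 * M4"
      using integrable_cyl_poly(1)[of n 4] phi4 by (simp add: M4_def)
    also have "\<dots> \<le> 9 * M4" using psum_fourth_moment_le[of n] by simp
    finally have v2: "(\<integral>x. (v x)\<^sup>2 \<partial>cube) \<le> 9 * M4" .
    have "(\<integral>x. psum n x ^ 3 \<partial>cube) - M3 = (\<integral>x. psum n x ^ 3 - phi x ^ 3 \<partial>cube)"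
      unfolding M3_def using integrable_cyl_poly(1)[of n 3] integrable_phi_power[of 3] by simp
    also have "\<dots> = (\<integral>x. (psum n x - phi x) * v x \<partial>cube)"
      by (intro Bochner_Integration.integral_cong) (auto simp: v_def power2_eq_square power3_eq_cube algebra_simps)
    finally have "norm ((\<integral>x. psum n x ^ 3 \<partial>cube) - M3) \<le> sqrt (truncation_error n) * sqrt (\<integral>x. (v x)\<^sup>2 \<partial>cube)"
      unfolding truncation_error_def using L2_Cauchy_Schwarz[OF L2_diff[OF L2_psum[of n] L2_phi] L2v] by simp
    also have "\<dots> \<le> sqrt (truncation_error n) * sqrt (9 * M4)"
      using v2 by (intro mult_left_mono) (auto simp: truncation_error_def)
    finally show "norm ((\<integral>x. psum n x ^ 3 \<partial>cube) - M3) \<le> sqrt (truncation_error n) * sqrt (9 * M4)" .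
  qed
  have "(\<lambda>n. sqrt (truncation_error n) * sqrt (9 * M4)) \<longlonglongrightarrow> sqrt 0 * sqrt (9 * M4)"
    by (intro tendsto_intros truncation_error_tendsto)
  then show "(\<lambda>n. sqrt (truncation_error n) * sqrt (9 * M4)) \<longlonglongrightarrow> 0" by simp
qed

text \<open>
  Second and third moments of the partial sums converge, while for the fourth moments an upper bound
  is all that is needed.
\<close>
definition excess_upper :: "nat \<Rightarrow> real" where
  "excess_upper n = M4 - 2 * (\<integral>x. psum n x ^ 3 \<partial>cube) + norm_sq n - 3 * (norm_sq n)\<^sup>2 + (4 ^ d + 2) * real d * infl * norm_sq n"

definition excess_lim :: real where
  "excess_lim = M4 - 2 * M3 + M2 - 3 * M2\<^sup>2 + (4 ^ d + 2) * real d * infl * M2"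

lemma excess_le: "excess n \<le> excess_upper n"
  using psum_fourth_moment_le[of n] by (simp add: excess_def excess_upper_def)

lemma excess_upper_tendsto: "excess_upper \<longlonglongrightarrow> excess_lim"
  unfolding excess_upper_def[abs_def] excess_lim_def
  by (intro tendsto_intros psum_third_moment_tendsto norm_sq_tendsto)

lemma excess_lim_nonneg: "0 \<le> excess_lim"
  using excess_nonneg excess_le order_trans by (intro LIMSEQ_le_const[OF excess_upper_tendsto]) blast

lemma sqrt_excess_le: "sqrt (excess n) \<le> sqrt (excess_upper n)"
  by (simp add: excess_le)

lemma third_moment_limit_bound: "\<bar>M3 - M2\<bar> \<le> 2 * (sqrt M2 * sqrt excess_lim)"
proof (rule LIMSEQ_le)
  show "(\<lambda>n. \<bar>(\<integral>x. psum n x ^ 3 \<partial>cube) - norm_sq n\<bar>) \<longlonglongrightarrow> \<bar>M3 - M2\<bar>"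
    by (intro tendsto_intros psum_third_moment_tendsto norm_sq_tendsto)
  show "(\<lambda>n. 2 * (sqrt (norm_sq n) * sqrt (excess_upper n))) \<longlonglongrightarrow> 2 * (sqrt M2 * sqrt excess_lim)"
    by (intro tendsto_intros excess_upper_tendsto norm_sq_tendsto)
  show "\<exists>N. \<forall>n\<ge>N. \<bar>(\<integral>x. psum n x ^ 3 \<partial>cube) - norm_sq n\<bar> \<le> 2 * (sqrt (norm_sq n) * sqrt (excess_upper n))"
  proof (intro exI allI impI)
    fix n
    have "sqrt (norm_sq n) * sqrt (excess n) \<le> sqrt (norm_sq n) * sqrt (excess_upper n)"
      by (intro mult_left_mono sqrt_excess_le) (simp add: norm_sq_nonneg)
    then show "\<bar>(\<integral>x. psum n x ^ 3 \<partial>cube) - norm_sq n\<bar> \<le> 2 * (sqrt (norm_sq n) * sqrt (excess_upper n))"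
      using third_moment_bound[of n] by linarith
  qed
qed

end

context walsh_chaos
begin

text \<open>
  On the Walsh function of \<open>S\<close>, \<open>gen N\<close> has the eigenvalue \<open>- card (S \<inter> {..<N})\<close>, which is \<open>- d\<close> unless
  \<open>S\<close> leaves the first \<open>N\<close> coordinates.
\<close>
lemma gen_psum_defect:
  assumes "N \<le> n"
  shows "(\<integral>x. (gen N (psum n) x + real d * psum n x)\<^sup>2 \<partial>cube) \<le> (real d)\<^sup>2 * (norm_sq n - norm_sq N)"
proof -
  define b where "b S = (real d - real (card (S \<inter> {..<N}))) * c S" for S
  have eq: "gen N (psum n) x + real d * psum n x = (\<Sum>S\<in>Pow {..<n}. b S * walsh S x)" for x
  proof -
    have "gen N (psum n) x = - (\<Sum>S\<in>Pow {..<n}. card (S \<inter> {..<N}) * (c S * walsh S x))"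
      unfolding psum_def[abs_def] using finite_subset_lessThan by (intro gen_walsh_sum) auto
    then show ?thesis
      by (simp add: b_def psum_def sum_distrib_left sum_subtractf[symmetric] algebra_simps)
  qed
  have "(\<integral>x. (gen N (psum n) x + real d * psum n x)\<^sup>2 \<partial>cube) = (\<Sum>S\<in>Pow {..<n}. (b S)\<^sup>2)"
    unfolding eq power2_eq_square by (rule integral_walsh_sum_mult)
  also have "\<dots> = (\<Sum>S\<in>Pow {..<N}. (b S)\<^sup>2) + (\<Sum>S | S \<subseteq> {..<n} \<and> \<not> S \<subseteq> {..<N}. (b S)\<^sup>2)"
    by (rule Pow_sum_split[OF assms])
  also have "(\<Sum>S\<in>Pow {..<N}. (b S)\<^sup>2) = 0"
  proof (rule sum.neutral, rule ballI)
    fix S assume "S \<in> Pow {..<N}"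
    then have "S \<inter> {..<N} = S" by auto
    then show "(b S)\<^sup>2 = 0" using deg[of S] by (cases "c S = 0") (auto simp: b_def)
  qed
  also have "0 + (\<Sum>S | S \<subseteq> {..<n} \<and> \<not> S \<subseteq> {..<N}. (b S)\<^sup>2) \<le> (\<Sum>S | S \<subseteq> {..<n} \<and> \<not> S \<subseteq> {..<N}. (real d)\<^sup>2 * (c S)\<^sup>2)"
    unfolding add_0
  proof (rule sum_mono)
    fix S assume "S \<in> {S. S \<subseteq> {..<n} \<and> \<not> S \<subseteq> {..<N}}"
    then have fin: "finite S" using finite_subset_lessThan by auto
    show "(b S)\<^sup>2 \<le> (real d)\<^sup>2 * (c S)\<^sup>2"
    proof (cases "c S = 0")
      case False
      then have "card (S \<inter> {..<N}) \<le> d" using deg[of S] card_mono[OF fin, of "S \<inter> {..<N}"] by simp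
      then have "(real d - real (card (S \<inter> {..<N})))\<^sup>2 \<le> (real d)\<^sup>2" by (intro power_mono) auto
      then show ?thesis by (simp add: b_def power_mult_distrib mult_right_mono)
    qed (simp add: b_def)
  qed
  also have "\<dots> = (real d)\<^sup>2 * (norm_sq n - norm_sq N)"
    using Pow_sum_split[OF assms, of "\<lambda>S. (c S)\<^sup>2"] by (simp add: norm_sq_def sum_distrib_left)
  finally show ?thesis .
qed

text \<open>All eigenvalues of \<open>- gen N\<close> on homogeneous sums of degree \<open>d\<close> are at most \<open>d\<close>.\<close>
lemma Gam_psum_combination_le:
  assumes "N \<le> n"
  shows "- (\<integral>x. (psum n x + a * psum N x) * gen N (\<lambda>y. psum n y + a * psum N y) x \<partial>cube) \<le> real d * (\<integral>x. (psum n x + a * psum N x)\<^sup>2 \<partial>cube)"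
proof -
  define b where "b S = c S + (if S \<subseteq> {..<N} then a * c S else 0)" for S
  have b: "psum n x + a * psum N x = (\<Sum>S\<in>Pow {..<n}. b S * walsh S x)" for x
  proof -
    have "(\<Sum>S\<in>Pow {..<n}. b S * walsh S x) = psum n x + (\<Sum>S\<in>Pow {..<n}. if S \<subseteq> {..<N} then a * (c S * walsh S x) else 0)"
      unfolding psum_def sum.distrib[symmetric] by (intro sum.cong) (auto simp: b_def algebra_simps)
    also have "(\<Sum>S\<in>Pow {..<n}. if S \<subseteq> {..<N} then a * (c S * walsh S x) else 0) = (\<Sum>S\<in>Pow {..<N}. a * (c S * walsh S x))"
      using assms by (intro sum.mono_neutral_cong_right) auto
    finally show ?thesis by (simp add: psum_def sum_distrib_left)
  qed
  have "gen N (\<lambda>y. psum n y + a * psum N y) x = (\<Sum>S\<in>Pow {..<n}. - (card (S \<inter> {..<N}) * b S) * walsh S x)" for x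
  proof -
    have "gen N (\<lambda>y. psum n y + a * psum N y) x = - (\<Sum>S\<in>Pow {..<n}. card (S \<inter> {..<N}) * (b S * walsh S x))"
      unfolding b using finite_subset_lessThan by (intro gen_walsh_sum) auto
    then show ?thesis by (simp add: sum_negf[symmetric] mult.assoc)
  qed
  then have "- (\<integral>x. (psum n x + a * psum N x) * gen N (\<lambda>y. psum n y + a * psum N y) x \<partial>cube)
      = - (\<Sum>S\<in>Pow {..<n}. b S * - (card (S \<inter> {..<N}) * b S))"
    unfolding b by (simp only: integral_walsh_sum_mult)
  also have "\<dots> = (\<Sum>S\<in>Pow {..<n}. card (S \<inter> {..<N}) * (b S)\<^sup>2)"
    by (simp add: sum_negf[symmetric] power2_eq_square ac_simps)
  also have "\<dots> \<le> (\<Sum>S\<in>Pow {..<n}. real d * (b S)\<^sup>2)"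
  proof (rule sum_mono)
    fix S assume "S \<in> Pow {..<n}"
    then have fin: "finite S" using finite_subset_lessThan by auto
    show "card (S \<inter> {..<N}) * (b S)\<^sup>2 \<le> real d * (b S)\<^sup>2"
    proof (cases "c S = 0")
      case False
      then have "card (S \<inter> {..<N}) \<le> d" using deg[of S] card_mono[OF fin, of "S \<inter> {..<N}"] by simp
      then show ?thesis by (intro mult_right_mono) auto
    qed (simp add: b_def)
  qed
  also have "\<dots> = real d * (\<integral>x. (psum n x + a * psum N x)\<^sup>2 \<partial>cube)"
    unfolding b power2_eq_square[of "sum _ _"] integral_walsh_sum_mult
    by (simp add: sum_distrib_left power2_eq_square)
  finally show ?thesis .
qed

end

context chaos_limit
begin

lemma gen_phi_defect: "(\<integral>x. (gen N phi x + real d * phi x)\<^sup>2 \<partial>cube) \<le> (real d)\<^sup>2 * (M2 - norm_sq N)"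
proof (rule LIMSEQ_le)
  show "(\<lambda>n. \<integral>x. (gen N (psum n) x + real d * psum n x)\<^sup>2 \<partial>cube) \<longlonglongrightarrow> (\<integral>x. (gen N phi x + real d * phi x)\<^sup>2 \<partial>cube)"
    by (intro L2_tendsto_norm L2_tendsto_add L2_tendsto_gen L2_tendsto_cmult psum_L2_tendsto)
  show "(\<lambda>n. (real d)\<^sup>2 * (norm_sq n - norm_sq N)) \<longlonglongrightarrow> (real d)\<^sup>2 * (M2 - norm_sq N)"
    by (intro tendsto_intros norm_sq_tendsto)
  show "\<exists>n0. \<forall>n\<ge>n0. (\<integral>x. (gen N (psum n) x + real d * psum n x)\<^sup>2 \<partial>cube) \<le> (real d)\<^sup>2 * (norm_sq n - norm_sq N)"
    using gen_psum_defect by blast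
qed

lemma Gam_combination_le:
  "(\<integral>x. Gam N (\<lambda>y. phi y + a * psum N y) x \<partial>cube) \<le> real d * (\<integral>x. (phi x + a * psum N x)\<^sup>2 \<partial>cube)"
proof -
  have t: "L2_tendsto cube (\<lambda>n x. psum n x + a * psum N x) (\<lambda>x. phi x + a * psum N x)"
    by (intro L2_tendsto_add psum_L2_tendsto L2_tendsto_const L2_cmult L2_psum)
  have "(\<integral>x. Gam N (\<lambda>y. phi y + a * psum N y) x \<partial>cube) = - (\<integral>x. (phi x + a * psum N x) * gen N (\<lambda>y. phi y + a * psum N y) x \<partial>cube)"
    by (intro Gam_integral L2_add L2_cmult L2_psum L2_phi)
  also have "\<dots> \<le> real d * (\<integral>x. (phi x + a * psum N x)\<^sup>2 \<partial>cube)"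
  proof (rule LIMSEQ_le)
    show "(\<lambda>n. - (\<integral>x. (psum n x + a * psum N x) * gen N (\<lambda>y. psum n y + a * psum N y) x \<partial>cube))
        \<longlonglongrightarrow> - (\<integral>x. (phi x + a * psum N x) * gen N (\<lambda>y. phi y + a * psum N y) x \<partial>cube)"
      by (intro tendsto_minus L2_tendsto_inner t L2_tendsto_gen[OF t])
    show "(\<lambda>n. real d * (\<integral>x. (psum n x + a * psum N x)\<^sup>2 \<partial>cube)) \<longlonglongrightarrow> real d * (\<integral>x. (phi x + a * psum N x)\<^sup>2 \<partial>cube)"
      by (intro tendsto_intros L2_tendsto_norm t)
    show "\<exists>n0. \<forall>n\<ge>n0. - (\<integral>x. (psum n x + a * psum N x) * gen N (\<lambda>y. psum n y + a * psum N y) x \<partial>cube)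
        \<le> real d * (\<integral>x. (psum n x + a * psum N x)\<^sup>2 \<partial>cube)"
      using Gam_psum_combination_le by blast
  qed
  finally show ?thesis .
qed

definition Gam_error :: "nat \<Rightarrow> real" where
  "Gam_error N = (\<integral>x. \<bar>Gam N phi x - Gam N (psum N) x\<bar> \<partial>cube)"

text \<open>
  The difference of the squared increments of \<open>phi\<close> and of the partial sum is the product of the
  increments of \<open>phi - psum N\<close> and \<open>phi + psum N\<close>, to which the weighted inequality of arithmetic and
  geometric means applies.
\<close>
lemma Gam_error_le:
  assumes t: "0 < t"
  shows "Gam_error N \<le> real d / 2 * (1 / t * truncation_error N + t * (4 * M2))"
proof -
  define u where "u x = phi x + (-1) * psum N x" for x
  define v where "v x = phi x + 1 * psum N x" for x
  have L2uv: "square_integrable cube u" "square_integrable cube v" unfolding u_def v_def by (intro L2_add L2_cmult L2_psum L2_phi)+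
  have Gam_uv: "integrable cube (Gam N u)" "integrable cube (Gam N v)" "integrable cube (Gam N phi)" "integrable cube (Gam N (psum N))"
    by (intro Gam_integral L2uv L2_phi L2_psum)+
  have pt: "\<bar>Gam N phi x - Gam N (psum N) x\<bar> \<le> (1 / t * Gam N u x + t * Gam N v x) / 2" for x
  proof -
    define y z where "y k = phi (flip k x) - phi x" and "z k = psum N (flip k x) - psum N x" for k
    have el: "\<bar>a * b\<bar> \<le> (1 / t * a\<^sup>2 + t * b\<^sup>2) / 2" for a b :: real
    proof -
      have "0 \<le> (1 / t) * (\<bar>a\<bar> - t * \<bar>b\<bar>)\<^sup>2" using t by simp
      also have "(\<bar>a\<bar> - t * \<bar>b\<bar>)\<^sup>2 = a\<^sup>2 + t * t * b\<^sup>2 - 2 * t * \<bar>a * b\<bar>"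
        by (simp add: power2_diff power_mult_distrib abs_mult) (simp add: power2_eq_square)
      also have "1 / t * \<dots> = 1 / t * a\<^sup>2 + t * b\<^sup>2 - 2 * \<bar>a * b\<bar>"
        using t by (simp add: field_simps)
      finally show ?thesis by simp
    qed
    have "Gam N phi x - Gam N (psum N) x = (\<Sum>k<N. rate k x * ((y k - z k) * (y k + z k))) / 2"
      by (simp add: Gam_def y_def z_def diff_divide_distrib[symmetric] sum_subtractf[symmetric] power2_eq_square algebra_simps)
    then have "\<bar>Gam N phi x - Gam N (psum N) x\<bar> = \<bar>\<Sum>k<N. rate k x * ((y k - z k) * (y k + z k))\<bar> / 2"
      by (simp only: abs_divide abs_numeral)
    also have "\<dots> \<le> (\<Sum>k<N. rate k x * ((1 / t * (y k - z k)\<^sup>2 + t * (y k + z k)\<^sup>2) / 2)) / 2"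
    proof (intro divide_right_mono order_trans[OF sum_abs] sum_mono)
      fix k
      show "\<bar>rate k x * ((y k - z k) * (y k + z k))\<bar> \<le> rate k x * ((1 / t * (y k - z k)\<^sup>2 + t * (y k + z k)\<^sup>2) / 2)"
        unfolding abs_mult[of "rate k x"] abs_of_pos[OF rate_pos]
        by (intro mult_left_mono el less_imp_le[OF rate_pos])
    qed simp
    also have "\<dots> = (1 / t * Gam N u x + t * Gam N v x) / 2"
    proof -
      have uv: "u (flip k x) - u x = y k - z k" "v (flip k x) - v x = y k + z k" for k
        by (simp_all add: u_def v_def y_def z_def)
      have "1 / t * Gam N u x + t * Gam N v x
          = (\<Sum>k<N. 1 / t * (rate k x * (y k - z k)\<^sup>2)) / 2 + (\<Sum>k<N. t * (rate k x * (y k + z k)\<^sup>2)) / 2"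
        by (simp add: Gam_def uv sum_distrib_left sum_divide_distrib)
      also have "\<dots> = (\<Sum>k<N. rate k x * ((1 / t * (y k - z k)\<^sup>2 + t * (y k + z k)\<^sup>2) / 2))"
        unfolding sum_divide_distrib sum.distrib[symmetric] by (intro sum.cong refl) (simp add: field_simps)
      finally show ?thesis by simp
    qed
    finally show ?thesis .
  qed
  have "Gam_error N \<le> (\<integral>x. (1 / t * Gam N u x + t * Gam N v x) / 2 \<partial>cube)"
    unfolding Gam_error_def using Gam_uv by (intro integral_mono pt) auto
  also have "\<dots> = (1 / t * (\<integral>x. Gam N u x \<partial>cube) + t * (\<integral>x. Gam N v x \<partial>cube)) / 2"
    using Gam_uv by simp
  also have "\<dots> \<le> (1 / t * (real d * truncation_error N) + t * (real d * (4 * M2))) / 2"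
  proof -
    have "(\<integral>x. Gam N u x \<partial>cube) \<le> real d * (\<integral>x. (u x)\<^sup>2 \<partial>cube)"
      unfolding u_def by (rule Gam_combination_le)
    also have "(\<integral>x. (u x)\<^sup>2 \<partial>cube) = truncation_error N"
      unfolding truncation_error_def by (intro Bochner_Integration.integral_cong) (auto simp: u_def power2_commute)
    finally have 1: "(\<integral>x. Gam N u x \<partial>cube) \<le> real d * truncation_error N" .
    have "(\<integral>x. Gam N v x \<partial>cube) \<le> real d * (\<integral>x. (v x)\<^sup>2 \<partial>cube)"
      unfolding v_def by (rule Gam_combination_le)
    also have "(\<integral>x. (v x)\<^sup>2 \<partial>cube) \<le> (\<integral>x. 2 * (phi x)\<^sup>2 + 2 * (psum N x)\<^sup>2 \<partial>cube)"
    proof (rule integral_mono)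
      show "integrable cube (\<lambda>x. (v x)\<^sup>2)" by (rule L2_integrable_sq[OF L2uv(2)])
      show "integrable cube (\<lambda>x. 2 * (phi x)\<^sup>2 + 2 * (psum N x)\<^sup>2)"
        using L2_integrable_sq[OF L2_phi] L2_integrable_sq[OF L2_psum[of N]] by simp
      show "(v x)\<^sup>2 \<le> 2 * (phi x)\<^sup>2 + 2 * (psum N x)\<^sup>2" for x
        using zero_le_power2[of "phi x - psum N x"] by (simp add: v_def power2_eq_square algebra_simps)
    qed
    also have "\<dots> = 2 * M2 + 2 * norm_sq N"
      using L2_integrable_sq[OF L2_phi] L2_integrable_sq[OF L2_psum[of N]] by (simp add: M2_def psum_second_moment)
    also have "\<dots> \<le> 4 * M2" using norm_sq_le[of N] by simp
    finally have 2: "(\<integral>x. Gam N v x \<partial>cube) \<le> real d * (4 * M2)" by (simp add: mult_left_mono)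
    show ?thesis using t 1 2 by (intro divide_right_mono add_mono mult_left_mono) auto
  qed
  also have "\<dots> = real d / 2 * (1 / t * truncation_error N + t * (4 * M2))" by (simp add: field_simps)
  finally show ?thesis .
qed

lemma Gam_error_tendsto: "Gam_error \<longlonglongrightarrow> 0"
proof (rule tendsto_sandwich[OF _ _ tendsto_const])
  \<comment> \<open>The summand \<open>1 / Suc N\<close> keeps the weight positive when the truncation error is zero.\<close>
  define t where "t N = sqrt (truncation_error N) + 1 / real (Suc N)" for N
  have e0: "0 \<le> truncation_error N" for N by (simp add: truncation_error_def)
  have tpos: "0 < t N" for N unfolding t_def using e0[of N] by (intro add_nonneg_pos) auto
  show "\<forall>\<^sub>F N in sequentially. Gam_error N \<le> real d / 2 * (sqrt (truncation_error N) + t N * (4 * M2))"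
  proof (rule always_eventually, rule allI)
    fix N
    have "truncation_error N = sqrt (truncation_error N) * sqrt (truncation_error N)" using e0[of N] by simp
    also have "\<dots> \<le> t N * sqrt (truncation_error N)" unfolding t_def using e0[of N] by (intro mult_right_mono) auto
    finally have "1 / t N * truncation_error N \<le> sqrt (truncation_error N)" using tpos[of N] by (simp add: field_simps)
    then have "real d / 2 * (1 / t N * truncation_error N + t N * (4 * M2)) \<le> real d / 2 * (sqrt (truncation_error N) + t N * (4 * M2))"
      by (intro mult_left_mono add_right_mono) auto
    then show "Gam_error N \<le> real d / 2 * (sqrt (truncation_error N) + t N * (4 * M2))"
      using Gam_error_le[OF tpos[of N], of N] by linarith
  qed
  have "t \<longlonglongrightarrow> sqrt 0 + 0"
    unfolding t_def[abs_def]
    by (intro tendsto_intros truncation_error_tendsto) (rule LIMSEQ_Suc[OF lim_1_over_n])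
  then have "(\<lambda>N. real d / 2 * (sqrt (truncation_error N) + t N * (4 * M2))) \<longlonglongrightarrow> real d / 2 * (sqrt 0 + (sqrt 0 + 0) * (4 * M2))"
    by (intro tendsto_intros truncation_error_tendsto)
  then show "(\<lambda>N. real d / 2 * (sqrt (truncation_error N) + t N * (4 * M2))) \<longlonglongrightarrow> 0" by simp
qed (simp add: Gam_error_def)

definition jumps4_upper :: "nat \<Rightarrow> real" where
  "jumps4_upper n = 2 * real d * norm_sq n + 12 * real d * (sqrt M4 * sqrt (excess_upper n))
    + 4 * real d * (sqrt (norm_sq n) * sqrt (excess_upper n)) + 4 * real d * ((4 ^ d + 2) * real d * infl * norm_sq n)"

definition jumps4_lim :: real where
  "jumps4_lim = 2 * real d * M2 + 12 * real d * (sqrt M4 * sqrt excess_lim)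
    + 4 * real d * (sqrt M2 * sqrt excess_lim) + 4 * real d * ((4 ^ d + 2) * real d * infl * M2)"

lemma jumps4_upper_tendsto: "jumps4_upper \<longlonglongrightarrow> jumps4_lim"
  unfolding jumps4_upper_def[abs_def] jumps4_lim_def
  by (intro tendsto_intros excess_upper_tendsto norm_sq_tendsto)

lemma jumps4_psum_le: "(\<Sum>k<n. \<integral>x. rate k x * (psum n (flip k x) - psum n x) ^ 4 \<partial>cube) \<le> jumps4_upper n"
proof -
  have 0: "0 \<le> (\<integral>x. psum n x ^ 4 \<partial>cube)" by (intro Bochner_Integration.integral_nonneg) simp
  have 1: "sqrt (\<integral>x. psum n x ^ 4 \<partial>cube) * sqrt (excess n) \<le> sqrt M4 * sqrt (excess_upper n)"
    using psum_fourth_moment_le[of n] excess_nonneg[of n] M4_nonneg by (intro mult_mono sqrt_excess_le) auto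
  have 2: "sqrt (norm_sq n) * sqrt (excess n) \<le> sqrt (norm_sq n) * sqrt (excess_upper n)"
    by (intro mult_left_mono sqrt_excess_le) (simp add: norm_sq_nonneg)
  have "12 * real d * (sqrt (\<integral>x. psum n x ^ 4 \<partial>cube) * sqrt (excess n)) \<le> 12 * real d * (sqrt M4 * sqrt (excess_upper n))"
    by (rule mult_left_mono[OF 1]) simp
  moreover have "4 * real d * (sqrt (norm_sq n) * sqrt (excess n)) \<le> 4 * real d * (sqrt (norm_sq n) * sqrt (excess_upper n))"
    by (rule mult_left_mono[OF 2]) simp
  ultimately show ?thesis unfolding jumps4_upper_def using fourth_differences_bound[of n] by linarith
qed

lemma integrable_phi_diff4: "integrable cube (\<lambda>x. rate k x * (phi (flip k x) - phi x) ^ 4)"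
proof (rule integrable_rate_mult, rule Bochner_Integration.integrable_bound)
  show "integrable cube (\<lambda>x. 8 * phi (flip k x) ^ 4 + 8 * phi x ^ 4)"
    using integrable_flip[OF phi4, of k] phi4 by simp
  show "AE x in cube. norm ((phi (flip k x) - phi x) ^ 4) \<le> norm (8 * phi (flip k x) ^ 4 + 8 * phi x ^ 4)"
  proof (rule AE_I2)
    fix x
    define a b where "a = phi (flip k x)" and "b = phi x"
    have "(a - b)\<^sup>2 \<le> 2 * (a\<^sup>2 + b\<^sup>2)" using zero_le_power2[of "a + b"] by (simp add: power2_eq_square algebra_simps)
    then have "((a - b)\<^sup>2)\<^sup>2 \<le> (2 * (a\<^sup>2 + b\<^sup>2))\<^sup>2" by (intro power_mono) auto
    also have "\<dots> \<le> 8 * a ^ 4 + 8 * b ^ 4"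
      using zero_le_power2[of "a\<^sup>2 - b\<^sup>2"] by (simp add: power2_eq_square power4_eq_xxxx algebra_simps)
    finally show "norm ((phi (flip k x) - phi x) ^ 4) \<le> norm (8 * phi (flip k x) ^ 4 + 8 * phi x ^ 4)"
      by (simp add: a_def b_def)
  qed
qed measurable

text \<open>Fatou'norm_sq lemma along an almost surely convergent subsequence of the partial sums.\<close>

lemma jumps4_phi_le: "(\<Sum>k<N. \<integral>x. rate k x * (phi (flip k x) - phi x) ^ 4 \<partial>cube) \<le> jumps4_lim"
proof -
  have int: "integrable cube (\<lambda>x. psum n x - phi x)" for n
    by (intro L2_integrable L2_diff L2_psum L2_phi)
  have "(\<lambda>n. \<integral>x. norm (psum n x - phi x) \<partial>cube) \<longlonglongrightarrow> 0"
  proof (rule tendsto_sandwich[OF _ _ tendsto_const])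
    show "\<forall>\<^sub>F n in sequentially. (\<integral>x. norm (psum n x - phi x) \<partial>cube) \<le> sqrt (truncation_error n)"
      unfolding truncation_error_def by (intro always_eventually allI) (simp add: integral_abs_le_L2 L2_diff L2_psum L2_phi)
    have "(\<lambda>n. sqrt (truncation_error n)) \<longlonglongrightarrow> sqrt 0" by (intro tendsto_intros truncation_error_tendsto)
    then show "(\<lambda>n. sqrt (truncation_error n)) \<longlonglongrightarrow> 0" by simp
  qed auto
  from tendsto_L1_AE_subseq[OF int this] obtain r where r: "strict_mono r"
    and ae: "AE x in cube. (\<lambda>n. psum (r n) x - phi x) \<longlonglongrightarrow> 0" by auto
  define D where "D g x = (\<Sum>k<N. rate k x * (g (flip k x) - g x) ^ 4)" for g :: "(nat \<Rightarrow> bool) \<Rightarrow> real" and x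
  have D_nonneg: "0 \<le> D g x" for g x
    unfolding D_def by (intro sum_nonneg mult_nonneg_nonneg less_imp_le[OF rate_pos]) auto
  have [measurable]: "D (psum n) \<in> borel_measurable cube" "D phi \<in> borel_measurable cube" for n
    unfolding D_def[abs_def] by measurable
  have Dphi: "integrable cube (D phi)" "(\<integral>x. D phi x \<partial>cube) = (\<Sum>k<N. \<integral>x. rate k x * (phi (flip k x) - phi x) ^ 4 \<partial>cube)"
    unfolding D_def[abs_def] using integrable_phi_diff4 by (auto simp: Bochner_Integration.integral_sum)
  have DF: "(\<integral>x. D (psum n) x \<partial>cube) \<le> jumps4_upper n" "integrable cube (D (psum n))" if "N \<le> n" for n
  proof -
    have cy: "cyl n (\<lambda>x. rate k x * (psum n (flip k x) - psum n x) ^ 4)" if "k < n" for k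
      using that by (intro cyl_intros cyl_psum cyl_flip)
    then have int: "integrable cube (\<lambda>x. rate k x * (psum n (flip k x) - psum n x) ^ 4)" if "k < n" for k
      using that by (intro cyl_integrable)
    show "integrable cube (D (psum n))"
      unfolding D_def[abs_def] using that by (intro Bochner_Integration.integrable_sum int) auto
    have "(\<integral>x. D (psum n) x \<partial>cube) = (\<Sum>k<N. \<integral>x. rate k x * (psum n (flip k x) - psum n x) ^ 4 \<partial>cube)"
      unfolding D_def using that by (intro Bochner_Integration.integral_sum int) auto
    also have "\<dots> \<le> (\<Sum>k<n. \<integral>x. rate k x * (psum n (flip k x) - psum n x) ^ 4 \<partial>cube)"
      using that by (intro sum_mono2) (auto intro!: Bochner_Integration.integral_nonneg mult_nonneg_nonneg less_imp_le[OF rate_pos])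
    also have "\<dots> \<le> jumps4_upper n" by (rule jumps4_psum_le)
    finally show "(\<integral>x. D (psum n) x \<partial>cube) \<le> jumps4_upper n" .
  qed
  have "AE x in cube. \<forall>k\<in>{..<N}. (\<lambda>n. psum (r n) (flip k x) - phi (flip k x)) \<longlonglongrightarrow> 0"
    using AE_flip[OF ae] by (subst AE_finite_all) auto
  with ae have lim: "AE x in cube. (\<lambda>n. D (psum (r n)) x) \<longlonglongrightarrow> D phi x"
  proof eventually_elim
    case (elim x)
    then show ?case unfolding D_def by (intro tendsto_intros) (auto dest: LIM_zero_cancel)
  qed
  have "ennreal (\<integral>x. D phi x \<partial>cube) = (\<integral>\<^sup>+x. ennreal (D phi x) \<partial>cube)"
    using Dphi D_nonneg by (subst nn_integral_eq_integral) auto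
  also have "\<dots> = (\<integral>\<^sup>+x. liminf (\<lambda>n. ennreal (D (psum (r n)) x)) \<partial>cube)"
  proof (rule nn_integral_cong_AE)
    show "AE x in cube. ennreal (D phi x) = liminf (\<lambda>n. ennreal (D (psum (r n)) x))"
      using lim
    proof eventually_elim
      case (elim x)
      then have "(\<lambda>n. ennreal (D (psum (r n)) x)) \<longlonglongrightarrow> ennreal (D phi x)" by (intro tendsto_ennrealI)
      then show ?case by (simp add: lim_imp_Liminf)
    qed
  qed
  also have "\<dots> \<le> liminf (\<lambda>n. \<integral>\<^sup>+x. ennreal (D (psum (r n)) x) \<partial>cube)"
    by (rule nn_integral_liminf) measurable
  also have "\<dots> \<le> liminf (\<lambda>n. ennreal (jumps4_upper (r n)))"
  proof (rule Liminf_mono)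
    show "\<forall>\<^sub>F n in sequentially. (\<integral>\<^sup>+x. ennreal (D (psum (r n)) x) \<partial>cube) \<le> ennreal (jumps4_upper (r n))"
      using eventually_ge_at_top[of N]
    proof eventually_elim
      case (elim n)
      then have n: "N \<le> r n" using seq_suble[OF r, of n] by linarith
      show ?case using DF[OF n] D_nonneg by (subst nn_integral_eq_integral) (auto intro: ennreal_leI)
    qed
  qed
  also have "\<dots> = ennreal jumps4_lim"
  proof (rule lim_imp_Liminf)
    have "(\<lambda>n. jumps4_upper (r n)) \<longlonglongrightarrow> jumps4_lim"
      using LIMSEQ_subseq_LIMSEQ[OF jumps4_upper_tendsto r] by (simp add: o_def)
    then show "(\<lambda>n. ennreal (jumps4_upper (r n))) \<longlonglongrightarrow> ennreal jumps4_lim" by (rule tendsto_ennrealI)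
  qed simp
  finally have le: "ennreal (\<integral>x. D phi x \<partial>cube) \<le> ennreal jumps4_lim" .
  have "0 \<le> jumps4_lim"
  proof (rule LIMSEQ_le_const[OF jumps4_upper_tendsto], intro exI allI impI)
    fix n
    have "0 \<le> (\<Sum>k<n. \<integral>x. rate k x * (psum n (flip k x) - psum n x) ^ 4 \<partial>cube)"
      by (auto intro!: sum_nonneg Bochner_Integration.integral_nonneg mult_nonneg_nonneg less_imp_le[OF rate_pos])
    then show "0 \<le> jumps4_upper n" using jumps4_psum_le[of n] by linarith
  qed
  then show ?thesis using le Dphi(2) by (simp add: ennreal_le_iff)
qed

end

section \<open>The balance of births and deaths\<close>

text \<open>
  A jump of size at least two satisfies \<open>1 + \<delta>\<^sup>2 \<le> \<delta>\<^sup>4 - \<delta>\<^sup>2\<close>, which absorbs all terms.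
\<close>
lemma threshold_large:
  fixes \<delta> h1 h0 a b :: real
  assumes \<delta>: "2 \<le> \<bar>\<delta>\<bar>" and h: "\<bar>h1 - h0\<bar> \<le> 1" and ab: "\<bar>a\<bar> \<le> 1" "\<bar>b\<bar> \<le> 1"
  shows "\<bar>(h1 - h0) - ((\<delta>\<^sup>2 + \<delta>) / 2 * a + (\<delta>\<^sup>2 - \<delta>) / 2 * b)\<bar> \<le> \<delta> ^ 4 - \<delta>\<^sup>2"
proof -
  have "2 * 2 \<le> \<bar>\<delta>\<bar> * \<bar>\<delta>\<bar>" using \<delta> by (intro mult_mono) auto
  then have 4: "4 \<le> \<delta>\<^sup>2" by (simp add: power2_eq_square)
  then have "4 * \<delta>\<^sup>2 \<le> \<delta>\<^sup>2 * \<delta>\<^sup>2" by (intro mult_right_mono) auto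
  then have "1 + \<delta>\<^sup>2 \<le> \<delta> ^ 4 - \<delta>\<^sup>2" using 4 by (simp add: power2_eq_square power4_eq_xxxx)
  moreover have "1 * \<bar>\<delta>\<bar> \<le> \<bar>\<delta>\<bar> * \<bar>\<delta>\<bar>" using \<delta> by (intro mult_right_mono) auto
  then have "\<bar>\<delta>\<bar> \<le> \<delta>\<^sup>2" by (simp add: power2_eq_square)
  then have nn: "0 \<le> (\<delta>\<^sup>2 + \<delta>) / 2" "0 \<le> (\<delta>\<^sup>2 - \<delta>) / 2" by (auto simp: abs_le_iff)
  have "\<bar>(\<delta>\<^sup>2 + \<delta>) / 2 * a\<bar> \<le> (\<delta>\<^sup>2 + \<delta>) / 2 * 1"
    unfolding abs_mult abs_of_nonneg[OF nn(1)] by (intro mult_left_mono ab nn)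
  moreover have "\<bar>(\<delta>\<^sup>2 - \<delta>) / 2 * b\<bar> \<le> (\<delta>\<^sup>2 - \<delta>) / 2 * 1"
    unfolding abs_mult abs_of_nonneg[OF nn(2)] by (intro mult_left_mono ab nn)
  moreover have "(\<delta>\<^sup>2 + \<delta>) / 2 * 1 + (\<delta>\<^sup>2 - \<delta>) / 2 * 1 = \<delta>\<^sup>2" by (simp add: add_divide_distrib diff_divide_distrib)
  ultimately show ?thesis using h by linarith
qed

text \<open>
  For an integer valued increment, the increment of the indicator of \<open>{..j}\<close> is a combination of
  up and down steps of size one, up to an error that vanishes unless the increment exceeds one.
\<close>

lemma threshold_increment:
  fixes z \<delta> :: real and j :: nat
  assumes "z \<in> \<nat>" "z + \<delta> \<in> \<nat>"
  defines "h \<equiv> \<lambda>y::real. if y \<le> real j then 1 else 0 :: real"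
    and "a \<equiv> if z = real j then - 1 else 0" and "b \<equiv> if z = real (Suc j) then 1 else 0"
  shows "\<bar>(h (z + \<delta>) - h z) - ((\<delta>\<^sup>2 + \<delta>) / 2 * a + (\<delta>\<^sup>2 - \<delta>) / 2 * b)\<bar> \<le> \<delta> ^ 4 - \<delta>\<^sup>2"
proof -
  obtain u v :: nat where uv: "z = real u" "z + \<delta> = real v" using assms(1,2) by (auto elim!: Nats_cases)
  then have \<delta>: "\<delta> = real v - real u" by simp
  consider "v = u" | "v = Suc u" | "u = Suc v" | "v \<ge> u + 2" | "u \<ge> v + 2" by linarith
  then show ?thesis
  proof cases
    case 1
    then show ?thesis using uv by (simp add: \<delta>)
  next
    case 2
    then have "\<delta> = 1" by (simp add: \<delta>)
    then show ?thesis unfolding h_def a_def b_def using uv 2 by auto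
  next
    case 3
    then have dm: "\<delta> = - 1" by (simp add: \<delta>)
    have z: "z = real (Suc v)" using uv 3 by simp
    show ?thesis unfolding h_def a_def b_def dm z by auto
  next
    case 4
    then have "2 \<le> \<bar>\<delta>\<bar>" by (simp add: \<delta>)
    then show ?thesis by (rule threshold_large) (auto simp: h_def a_def b_def)
  next
    case 5
    then have "2 \<le> \<bar>\<delta>\<bar>" by (simp add: \<delta>)
    then show ?thesis by (rule threshold_large) (auto simp: h_def a_def b_def)
  qed
qed

context chaos_limit
begin

lemma integral_rate_increment_eq_0:
  assumes g: "integrable cube g"
  shows "(\<integral>x. rate k x * (g (flip k x) - g x) \<partial>cube) = 0"
    and "integrable cube (\<lambda>x. rate k x * (g (flip k x) - g x))"
proof -
  have i: "integrable cube (\<lambda>x. rate k x * g x)" "integrable cube (\<lambda>x. rate k x * g (flip k x))"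
    by (rule integrable_rate_mult[OF g], rule integrable_rate_flip[OF g])
  show "(\<integral>x. rate k x * (g (flip k x) - g x) \<partial>cube) = 0"
    using i integral_flip(1)[OF borel_measurable_integrable[OF g], of k] by (simp add: right_diff_distrib)
  show "integrable cube (\<lambda>x. rate k x * (g (flip k x) - g x))"
    using i by (simp add: right_diff_distrib)
qed

definition balance_error :: "nat \<Rightarrow> real" where
  "balance_error N = (jumps4_lim - 2 * real d * norm_sq N) + 3 * Gam_error N + real d * sqrt (excess_upper N)
    + real d / 2 * sqrt (truncation_error N) + sqrt ((real d)\<^sup>2 * (M2 - norm_sq N)) / 2"

lemma balance_error_tendsto:
  "balance_error \<longlonglongrightarrow> (jumps4_lim - 2 * real d * M2) + real d * sqrt excess_lim"
proof -
  have "balance_error \<longlonglongrightarrow> (jumps4_lim - 2 * real d * M2) + 3 * 0 + real d * sqrt excess_lim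
    + real d / 2 * sqrt 0 + sqrt ((real d)\<^sup>2 * (M2 - M2)) / 2"
    unfolding balance_error_def[abs_def]
    by (intro tendsto_intros norm_sq_tendsto Gam_error_tendsto excess_upper_tendsto truncation_error_tendsto) simp
  then show ?thesis by simp
qed

text \<open>
  Only the first \<open>N\<close> coordinates are resampled here. Stationarity says that the mean rate of change of the
  indicator of \<open>{..j}\<close> is zero. By \<open>threshold_increment\<close> this rate is \<open>a u + b v\<close> up to
  the excess of the fourth powers of the jumps over their squares, where \<open>a\<close> and \<open>b\<close> are the changes of
  the indicator after a step up and down, and \<open>u = \<Gamma> + L phi / 2\<close>, \<open>v = \<Gamma> - L phi / 2\<close>. Replacing \<open>\<Gamma>\<close> and
  \<open>L phi\<close> by \<open>d E[F\<^sup>2] + d phi / 2\<close> and \<open>- d phi\<close> gives the claim; \<open>balance_error\<close> collects the costs.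
\<close>
lemma birth_death_balance_partial:
  assumes nat: "AE x in cube. phi x + \<theta> \<in> \<nat>"
  shows "\<bar>real d * ((norm_sq N + (real (Suc j) - \<theta>)) * prob {x. phi x + \<theta> = real (Suc j)} - norm_sq N * prob {x. phi x + \<theta> = real j})\<bar> \<le> balance_error N"
proof -
  define Z where "Z x = phi x + \<theta>" for x
  define h where "h = (\<lambda>y::real. if y \<le> real j then 1 else 0 :: real)"
  define a where "a x = (if Z x = real j then - 1 else 0 :: real)" for x
  define b where "b x = (if Z x = real (Suc j) then 1 else 0 :: real)" for x
  have [measurable]: "Z \<in> borel_measurable cube" "h \<in> borel_measurable borel"
    "a \<in> borel_measurable cube" "b \<in> borel_measurable cube"
    unfolding Z_def[abs_def] h_def a_def[abs_def] b_def[abs_def] by measurable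
  have ab: "\<bar>a x + b x\<bar> \<le> 1" "\<bar>a x - b x\<bar> \<le> 1" "\<bar>a x\<bar> \<le> 1" "\<bar>b x\<bar> \<le> 1" for x by (auto simp: a_def b_def)
  define S where "S x = (\<Sum>k<N. rate k x * (h (Z (flip k x)) - h (Z x)))" for x
  define T where "T x = a x * (Gam N phi x + gen N phi x / 2) + b x * (Gam N phi x - gen N phi x / 2)" for x
  define D where "D x = (\<Sum>k<N. rate k x * (phi (flip k x) - phi x) ^ 4)" for x
  define V where "V x = a x * (real d * norm_sq N) + b x * (real d * norm_sq N + real d * phi x)" for x
  define X where "X x = real d * norm_sq N + real d / 2 * phi x" for x
  define r where "r x = (a x + b x) * (Gam N phi x - X x) + (a x - b x) / 2 * (gen N phi x + real d * phi x)" for x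
  have hZ: "integrable cube (\<lambda>x. h (Z x))"
    by (rule integrable_const_bound[of _ 1]) (auto simp: h_def)
  have iS: "integrable cube S"
    unfolding S_def[abs_def] by (intro Bochner_Integration.integrable_sum integral_rate_increment_eq_0(2) hZ)
  have S0: "(\<integral>x. S x \<partial>cube) = 0"
    unfolding S_def using integral_rate_increment_eq_0[OF hZ] by (subst Bochner_Integration.integral_sum) auto
  have iG: "integrable cube (Gam N phi)" "integrable cube (Gam N (psum N))" by (intro Gam_integral L2_phi L2_psum)+
  have iL: "integrable cube (gen N phi)" and iphi: "integrable cube phi"
    by (intro L2_integrable L2_gen L2_phi)+
  have bdd: "integrable cube (\<lambda>x. g x * u x)" if "integrable cube u" "\<And>x. \<bar>g x\<bar> \<le> 1" "g \<in> borel_measurable cube"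
    for g u :: "(nat \<Rightarrow> bool) \<Rightarrow> real"
  proof (rule Bochner_Integration.integrable_bound[OF that(1)])
    show "AE x in cube. norm (g x * u x) \<le> norm (u x)"
      using that(2) by (intro AE_I2) (simp add: abs_mult mult_left_le_one_le)
  qed (use that in measurable)
  have iT: "integrable cube T" unfolding T_def[abs_def]
    using iG iL by (intro Bochner_Integration.integrable_add bdd) (auto simp: ab)
  have iV: "integrable cube V" unfolding V_def[abs_def]
  proof (rule Bochner_Integration.integrable_add)
    show "integrable cube (\<lambda>x. a x * (real d * norm_sq N))" by (rule bdd) (auto simp: ab)
    have "integrable cube (\<lambda>x. real d * norm_sq N + real d * phi x)" using iphi by simp
    then show "integrable cube (\<lambda>x. b x * (real d * norm_sq N + real d * phi x))" by (rule bdd) (auto simp: ab)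
  qed
  have iD: "integrable cube D" "(\<integral>x. D x \<partial>cube) \<le> jumps4_lim"
    unfolding D_def[abs_def] using integrable_phi_diff4 jumps4_phi_le[of N] by (auto simp: Bochner_Integration.integral_sum)
  have TV: "T x = V x + r x" for x
    unfolding T_def V_def r_def X_def by (simp add: field_simps)
  have ir: "integrable cube r"
  proof -
    have "r = (\<lambda>x. T x - V x)" by (simp add: TV fun_eq_iff)
    then show ?thesis using iT iV by simp
  qed
  have "AE x in cube. \<forall>k\<in>{..<N}. Z (flip k x) \<in> \<nat>"
    using AE_flip[OF nat] by (subst AE_finite_all) (auto simp: Z_def)
  with nat have "AE x in cube. \<bar>S x - T x\<bar> \<le> D x - 2 * Gam N phi x"
  proof eventually_elim
    case (elim x)
    define \<delta> where "\<delta> k = phi (flip k x) - phi x" for k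
    have sum1: "(\<Sum>k<N. rate k x * (\<delta> k)\<^sup>2) = 2 * Gam N phi x" by (simp add: Gam_def \<delta>_def)
    have sum2: "(\<Sum>k<N. rate k x * \<delta> k) = gen N phi x" by (simp add: gen_def gen_at_def \<delta>_def)
    have "(\<Sum>k<N. rate k x * (((\<delta> k)\<^sup>2 + \<delta> k) / 2 * a x + ((\<delta> k)\<^sup>2 - \<delta> k) / 2 * b x))
        = (a x + b x) / 2 * (\<Sum>k<N. rate k x * (\<delta> k)\<^sup>2) + (a x - b x) / 2 * (\<Sum>k<N. rate k x * \<delta> k)"
      unfolding sum_distrib_left sum.distrib[symmetric] by (intro sum.cong refl) (simp add: field_simps)
    also have "\<dots> = T x" unfolding sum1 sum2 T_def by (simp add: field_simps)
    finally have T: "T x = (\<Sum>k<N. rate k x * (((\<delta> k)\<^sup>2 + \<delta> k) / 2 * a x + ((\<delta> k)\<^sup>2 - \<delta> k) / 2 * b x))" by simp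
    have ST: "S x - T x = (\<Sum>k<N. rate k x * ((h (Z (flip k x)) - h (Z x)) - (((\<delta> k)\<^sup>2 + \<delta> k) / 2 * a x + ((\<delta> k)\<^sup>2 - \<delta> k) / 2 * b x)))"
      unfolding S_def T by (simp add: sum_subtractf[symmetric] right_diff_distrib)
    have "\<bar>S x - T x\<bar> \<le> (\<Sum>k<N. rate k x * (\<delta> k ^ 4 - (\<delta> k)\<^sup>2))"
      unfolding ST
    proof (rule order_trans[OF sum_abs], rule sum_mono)
      fix k assume k: "k \<in> {..<N}"
      have Zk: "Z (flip k x) = Z x + \<delta> k" by (simp add: Z_def \<delta>_def)
      have "Z (flip k x) \<in> \<nat>" using elim(2) k by (auto simp: Z_def)
      then have Zn: "Z x \<in> \<nat>" "Z x + \<delta> k \<in> \<nat>" using elim(1) unfolding Zk by (simp_all only: Z_def)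
      have "\<bar>(h (Z x + \<delta> k) - h (Z x)) - (((\<delta> k)\<^sup>2 + \<delta> k) / 2 * a x + ((\<delta> k)\<^sup>2 - \<delta> k) / 2 * b x)\<bar> \<le> \<delta> k ^ 4 - (\<delta> k)\<^sup>2"
        unfolding h_def a_def b_def
        by (rule threshold_increment[OF Zn])
      then show "\<bar>rate k x * ((h (Z (flip k x)) - h (Z x)) - (((\<delta> k)\<^sup>2 + \<delta> k) / 2 * a x + ((\<delta> k)\<^sup>2 - \<delta> k) / 2 * b x))\<bar>
          \<le> rate k x * (\<delta> k ^ 4 - (\<delta> k)\<^sup>2)"
        unfolding Zk abs_mult[of "rate k x"] abs_of_pos[OF rate_pos]
        by (intro mult_left_mono less_imp_le[OF rate_pos])
    qed
    also have "\<dots> = D x - 2 * Gam N phi x"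
      unfolding sum1[symmetric] by (simp add: D_def \<delta>_def sum_subtractf[symmetric] right_diff_distrib)
    finally show ?case .
  qed
  then have "(\<integral>x. \<bar>S x - T x\<bar> \<partial>cube) \<le> (\<integral>x. D x - 2 * Gam N phi x \<partial>cube)"
    using iS iT iD iG by (intro integral_mono_AE) auto
  also have "\<dots> \<le> jumps4_lim - 2 * (\<integral>x. Gam N phi x \<partial>cube)"
    using iD iG by simp
  finally have 1: "(\<integral>x. \<bar>S x - T x\<bar> \<partial>cube) \<le> jumps4_lim - 2 * (\<integral>x. Gam N phi x \<partial>cube)" .
  have "\<bar>\<integral>x. T x \<partial>cube\<bar> = \<bar>\<integral>x. S x - T x \<partial>cube\<bar>"
    using iS iT S0 by simp
  also have "\<dots> \<le> (\<integral>x. \<bar>S x - T x\<bar> \<partial>cube)" by (rule integral_abs_bound)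
  finally have T_le: "\<bar>\<integral>x. T x \<partial>cube\<bar> \<le> jumps4_lim - 2 * (\<integral>x. Gam N phi x \<partial>cube)" using 1 by simp
  have GF: "(\<integral>x. Gam N (psum N) x \<partial>cube) = real d * norm_sq N"
    unfolding Gam_integral(2)[OF L2_psum] gen_psum psum_second_moment[symmetric] by (simp add: power2_eq_square mult.left_commute)
  have "(\<integral>x. Gam N (psum N) x \<partial>cube) - (\<integral>x. Gam N phi x \<partial>cube) \<le> Gam_error N"
  proof -
    have "(\<integral>x. Gam N (psum N) x \<partial>cube) - (\<integral>x. Gam N phi x \<partial>cube) = (\<integral>x. Gam N (psum N) x - Gam N phi x \<partial>cube)"
      using iG by simp
    also have "\<dots> \<le> Gam_error N" unfolding Gam_error_def using iG by (intro integral_mono) auto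
    finally show ?thesis .
  qed
  then have T_le2: "\<bar>\<integral>x. T x \<partial>cube\<bar> \<le> jumps4_lim - 2 * real d * norm_sq N + 2 * Gam_error N"
    using T_le unfolding GF by linarith
  have r_le: "\<bar>r x\<bar> \<le> (\<bar>Gam N phi x - Gam N (psum N) x\<bar> + \<bar>defect N x\<bar> + real d / 2 * \<bar>psum N x - phi x\<bar>) + \<bar>gen N phi x + real d * phi x\<bar> / 2" for x
  proof -
    have "\<bar>r x\<bar> \<le> \<bar>a x + b x\<bar> * \<bar>Gam N phi x - X x\<bar> + \<bar>a x - b x\<bar> * (\<bar>gen N phi x + real d * phi x\<bar> / 2)"
      unfolding r_def by (rule order_trans[OF abs_triangle_ineq]) (simp add: abs_mult)
    also have "\<dots> \<le> 1 * \<bar>Gam N phi x - X x\<bar> + 1 * (\<bar>gen N phi x + real d * phi x\<bar> / 2)"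
      by (intro add_mono mult_right_mono ab) auto
    also have "Gam N phi x - X x = (Gam N phi x - Gam N (psum N) x) + defect N x + real d / 2 * (psum N x - phi x)"
      by (simp add: defect_def X_def algebra_simps)
    also have "\<bar>\<dots>\<bar> \<le> \<bar>Gam N phi x - Gam N (psum N) x\<bar> + \<bar>defect N x\<bar> + \<bar>real d / 2 * (psum N x - phi x)\<bar>"
      by linarith
    also have "\<bar>real d / 2 * (psum N x - phi x)\<bar> = real d / 2 * \<bar>psum N x - phi x\<bar>" by (simp add: abs_mult)
    finally show ?thesis by simp
  qed
  have LKd: "square_integrable cube (defect N)" "square_integrable cube (\<lambda>x. psum N x - phi x)" "square_integrable cube (\<lambda>x. gen N phi x + real d * phi x)"
    by (intro cyl_L2[OF cyl_defect] L2_diff L2_add L2_psum L2_phi L2_gen L2_cmult)+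
  have iK: "integrable cube (\<lambda>x. \<bar>defect N x\<bar>)" "integrable cube (\<lambda>x. \<bar>psum N x - phi x\<bar>)" "integrable cube (\<lambda>x. \<bar>gen N phi x + real d * phi x\<bar>)"
    by (intro integrable_abs L2_integrable LKd)+
  have iGd: "integrable cube (\<lambda>x. \<bar>Gam N phi x - Gam N (psum N) x\<bar>)" using iG by simp
  have "\<bar>\<integral>x. r x \<partial>cube\<bar> \<le> (\<integral>x. \<bar>r x\<bar> \<partial>cube)" by (rule integral_abs_bound)
  also have "\<dots> \<le> (\<integral>x. (\<bar>Gam N phi x - Gam N (psum N) x\<bar> + \<bar>defect N x\<bar> + real d / 2 * \<bar>psum N x - phi x\<bar>) + \<bar>gen N phi x + real d * phi x\<bar> / 2 \<partial>cube)"
    using ir iK iGd by (intro integral_mono r_le) auto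
  also have "\<dots> = Gam_error N + (\<integral>x. \<bar>defect N x\<bar> \<partial>cube) + real d / 2 * (\<integral>x. \<bar>psum N x - phi x\<bar> \<partial>cube) + (\<integral>x. \<bar>gen N phi x + real d * phi x\<bar> \<partial>cube) / 2"
    using iK iGd by (simp add: Gam_error_def)
  also have "\<dots> \<le> Gam_error N + real d * sqrt (excess_upper N) + real d / 2 * sqrt (truncation_error N) + sqrt ((real d)\<^sup>2 * (M2 - norm_sq N)) / 2"
  proof (intro add_mono divide_right_mono mult_left_mono order_refl)
    have "(\<integral>x. \<bar>defect N x\<bar> \<partial>cube) \<le> sqrt (\<integral>x. (defect N x)\<^sup>2 \<partial>cube)" by (rule integral_abs_le_L2[OF LKd(1)])
    also have "\<dots> \<le> real d * sqrt (excess N)" by (rule sqrt_defect)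
    also have "\<dots> \<le> real d * sqrt (excess_upper N)" by (intro mult_left_mono sqrt_excess_le) auto
    finally show "(\<integral>x. \<bar>defect N x\<bar> \<partial>cube) \<le> real d * sqrt (excess_upper N)" .
    show "(\<integral>x. \<bar>psum N x - phi x\<bar> \<partial>cube) \<le> sqrt (truncation_error N)" unfolding truncation_error_def by (rule integral_abs_le_L2[OF LKd(2)])
    show "(\<integral>x. \<bar>gen N phi x + real d * phi x\<bar> \<partial>cube) \<le> sqrt ((real d)\<^sup>2 * (M2 - norm_sq N))"
      by (rule order_trans[OF integral_abs_le_L2[OF LKd(3)]]) (rule real_sqrt_le_mono[OF gen_phi_defect])
  qed auto
  finally have r_int: "\<bar>\<integral>x. r x \<partial>cube\<bar> \<le> Gam_error N + real d * sqrt (excess_upper N) + real d / 2 * sqrt (truncation_error N) + sqrt ((real d)\<^sup>2 * (M2 - norm_sq N)) / 2" .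
  have "(\<integral>x. T x \<partial>cube) = (\<integral>x. V x \<partial>cube) + (\<integral>x. r x \<partial>cube)"
    unfolding TV using iV ir by simp
  then have V_le: "\<bar>\<integral>x. V x \<partial>cube\<bar> \<le> balance_error N"
    using T_le2 r_int unfolding balance_error_def by linarith
  have sets: "{x. phi x + \<theta> = y} \<in> events" for y
    using measurable_sets[of "\<lambda>x. phi x + \<theta>" cube borel "{y}"] by (simp add: vimage_def)
  have V: "V x = real d * (norm_sq N + (real (Suc j) - \<theta>)) * indicator {x. phi x + \<theta> = real (Suc j)} x - real d * norm_sq N * indicator {x. phi x + \<theta> = real j} x" for x
  proof -
    have "b x * (real d * norm_sq N + real d * phi x) = real d * (norm_sq N + (real (Suc j) - \<theta>)) * indicator {x. phi x + \<theta> = real (Suc j)} x"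
    proof (cases "phi x + \<theta> = real (Suc j)")
      case True
      then have "phi x = real (Suc j) - \<theta>" by linarith
      then show ?thesis using True by (simp only: b_def Z_def indicator_def mem_Collect_eq distrib_left) simp
    qed (simp add: b_def Z_def)
    moreover have "a x * (real d * norm_sq N) = - (real d * norm_sq N * indicator {x. phi x + \<theta> = real j} x)"
      by (simp add: a_def Z_def indicator_def)
    ultimately show ?thesis by (simp add: V_def)
  qed
  have "(\<integral>x. V x \<partial>cube) = real d * (norm_sq N + (real (Suc j) - \<theta>)) * prob {x. phi x + \<theta> = real (Suc j)} - real d * norm_sq N * prob {x. phi x + \<theta> = real j}"
  proof -
    have "integrable cube (indicat_real {x. phi x + \<theta> = y})" for y
      by (intro integrable_real_indicator sets) (simp add: emeasure_eq_measure)
    then show ?thesis unfolding V by simp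
  qed
  then show ?thesis using V_le by (simp add: algebra_simps)
qed

lemma birth_death_balance:
  assumes nat: "AE x in cube. phi x + \<theta> \<in> \<nat>"
  shows "\<bar>(M2 + (real (Suc j) - \<theta>)) * prob {x. phi x + \<theta> = real (Suc j)} - M2 * prob {x. phi x + \<theta> = real j}\<bar>
    \<le> sqrt excess_lim + 12 * (sqrt M4 * sqrt excess_lim) + 4 * (sqrt M2 * sqrt excess_lim) + 4 * ((4 ^ d + 2) * real d * infl * M2)"
proof -
  have "\<bar>real d * ((M2 + (real (Suc j) - \<theta>)) * prob {x. phi x + \<theta> = real (Suc j)} - M2 * prob {x. phi x + \<theta> = real j})\<bar>
      \<le> (jumps4_lim - 2 * real d * M2) + real d * sqrt excess_lim"
  proof (rule LIMSEQ_le[OF _ balance_error_tendsto])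
    show "(\<lambda>N. \<bar>real d * ((norm_sq N + (real (Suc j) - \<theta>)) * prob {x. phi x + \<theta> = real (Suc j)} - norm_sq N * prob {x. phi x + \<theta> = real j})\<bar>)
      \<longlonglongrightarrow> \<bar>real d * ((M2 + (real (Suc j) - \<theta>)) * prob {x. phi x + \<theta> = real (Suc j)} - M2 * prob {x. phi x + \<theta> = real j})\<bar>"
      by (intro tendsto_intros norm_sq_tendsto)
  qed (use birth_death_balance_partial[OF nat] in blast)
  also have "\<dots> = real d * (sqrt excess_lim + 12 * (sqrt M4 * sqrt excess_lim) + 4 * (sqrt M2 * sqrt excess_lim) + 4 * ((4 ^ d + 2) * real d * infl * M2))"
    by (simp add: jumps4_lim_def algebra_simps)
  finally show ?thesis using d_ge_1 by (simp add: abs_mult mult_le_cancel_left_pos)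
qed

end

section \<open>From a Rademacher sequence to the cube\<close>

text \<open>A set of size \<open>d\<close> is listed by \<open>d!\<close> index tuples, on all of which a symmetric kernel agrees.\<close>
definition set_coefficient :: "nat \<Rightarrow> (nat list \<Rightarrow> real) \<Rightarrow> nat set \<Rightarrow> real" where
  "set_coefficient d f S = (if finite S \<and> card S = d then fact d * f (sorted_list_of_set S) else 0)"

lemma chaos_kernel_sorted:
  assumes f: "chaos_kernel d f" and xs: "length xs = d" "distinct xs"
  shows "f xs = f (sorted_list_of_set (set xs))"
proof -
  have "mset (sorted_list_of_set (set xs)) = mset xs"
    using set_eq_iff_mset_eq_distinct[of "sorted_list_of_set (set xs)" xs] xs(2) by simp
  then show ?thesis using f xs(1) unfolding chaos_kernel_def by metis
qed

lemma sum_lists_eq_sum_subsets: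
  fixes y :: "nat \<Rightarrow> real"
  assumes f: "chaos_kernel d f"
  shows "(\<Sum>xs | length xs = d \<and> set xs \<subseteq> {..<n}. f xs * (\<Prod>j<d. y (xs ! j)))
    = (\<Sum>S\<in>Pow {..<n}. set_coefficient d f S * (\<Prod>i\<in>S. y i))"
proof -
  define B where "B = {S. S \<subseteq> {..<n} \<and> card S = d}"
  have finB: "finite B" unfolding B_def by (rule finite_subset[of _ "Pow {..<n}"]) auto
  have fin: "finite S" if "S \<in> B" for S using that finite_subset unfolding B_def by auto
  have finA: "finite {xs. length xs = d \<and> set xs \<subseteq> {..<n}}"
    using finite_lists_length_eq[of "{..<n}" d] by (simp add: conj_commute)
  have "(\<Sum>xs | length xs = d \<and> set xs \<subseteq> {..<n}. f xs * (\<Prod>j<d. y (xs ! j)))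
      = (\<Sum>xs\<in>(\<Union>S\<in>B. permutations_of_set S). f xs * (\<Prod>j<d. y (xs ! j)))"
  proof (rule sum.mono_neutral_right[OF finA])
    show "(\<Union>S\<in>B. permutations_of_set S) \<subseteq> {xs. length xs = d \<and> set xs \<subseteq> {..<n}}"
      by (auto simp: B_def permutations_of_set_def distinct_card)
    show "\<forall>xs\<in>{xs. length xs = d \<and> set xs \<subseteq> {..<n}} - (\<Union>S\<in>B. permutations_of_set S). f xs * (\<Prod>j<d. y (xs ! j)) = 0"
    proof
      fix xs assume xs: "xs \<in> {xs. length xs = d \<and> set xs \<subseteq> {..<n}} - (\<Union>S\<in>B. permutations_of_set S)"
      have "\<not> distinct xs"
      proof
        assume "distinct xs"
        then have "set xs \<in> B" using xs by (simp add: B_def distinct_card)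
        moreover have "xs \<in> permutations_of_set (set xs)" using \<open>distinct xs\<close> by (intro permutations_of_setI) auto
        ultimately show False using xs by blast
      qed
      then have "f xs = 0" using f xs unfolding chaos_kernel_def by auto
      then show "f xs * (\<Prod>j<d. y (xs ! j)) = 0" by simp
    qed
  qed
  also have "\<dots> = (\<Sum>S\<in>B. \<Sum>xs\<in>permutations_of_set S. f xs * (\<Prod>j<d. y (xs ! j)))"
  proof (rule sum.UNION_disjoint[OF finB])
    show "\<forall>S\<in>B. finite (permutations_of_set S)" by simp
    show "\<forall>S\<in>B. \<forall>T\<in>B. S \<noteq> T \<longrightarrow> permutations_of_set S \<inter> permutations_of_set T = {}"
      by (auto simp: permutations_of_set_def)
  qed
  also have "\<dots> = (\<Sum>S\<in>B. set_coefficient d f S * (\<Prod>i\<in>S. y i))"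
  proof (rule sum.cong[OF refl])
    fix S assume S: "S \<in> B"
    have "f xs * (\<Prod>j<d. y (xs ! j)) = f (sorted_list_of_set S) * (\<Prod>i\<in>S. y i)" if "xs \<in> permutations_of_set S" for xs
    proof -
      have xs: "distinct xs" "set xs = S" using that by (auto simp: permutations_of_set_def)
      then have len: "length xs = d" using S by (auto simp: B_def distinct_card)
      have "(\<Prod>j<d. y (xs ! j)) = (\<Prod>i\<in>S. y i)"
        using bij_betw_nth[OF xs(1), of "{..<d}" S] len xs(2)
        by (intro prod.reindex_bij_betw) auto
      then show ?thesis using chaos_kernel_sorted[OF f len xs(1)] xs(2) by simp
    qed
    then have "(\<Sum>xs\<in>permutations_of_set S. f xs * (\<Prod>j<d. y (xs ! j))) = (\<Sum>xs\<in>permutations_of_set S. f (sorted_list_of_set S) * (\<Prod>i\<in>S. y i))"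
      by (intro sum.cong refl)
    also have "\<dots> = fact d * (f (sorted_list_of_set S) * (\<Prod>i\<in>S. y i))"
      using S fin[OF S] by (simp add: B_def)
    finally show "(\<Sum>xs\<in>permutations_of_set S. f xs * (\<Prod>j<d. y (xs ! j))) = set_coefficient d f S * (\<Prod>i\<in>S. y i)"
      using S fin[OF S] by (simp add: set_coefficient_def B_def)
  qed
  also have "\<dots> = (\<Sum>S\<in>Pow {..<n}. set_coefficient d f S * (\<Prod>i\<in>S. y i))"
    by (rule sum.mono_neutral_left) (auto simp: B_def set_coefficient_def)
  finally show ?thesis .
qed

lemma influence_summable:
  assumes f: "chaos_kernel d f" and d: "d \<ge> 1"
  shows "(\<lambda>xs. (f (xs @ [k]))\<^sup>2) summable_on {xs. length xs = d - 1}"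
    and "influence d f k \<le> (\<Sum>\<^sub>\<infinity>xs\<in>{xs. length xs = d}. (f xs)\<^sup>2)"
proof -
  have f2: "(\<lambda>xs. (f xs)\<^sup>2) summable_on {xs. length xs = d}" using f by (simp add: chaos_kernel_def)
  let ?g = "\<lambda>xs. xs @ [k]"
  have inj: "inj_on ?g {xs. length xs = d - 1}" by (auto simp: inj_on_def)
  have sub: "?g ` {xs. length xs = d - 1} \<subseteq> {xs. length xs = d}" using d by auto
  have s: "(\<lambda>xs. (f xs)\<^sup>2) summable_on ?g ` {xs. length xs = d - 1}"
    by (rule summable_on_subset_banach[OF f2 sub])
  then show "(\<lambda>xs. (f (xs @ [k]))\<^sup>2) summable_on {xs. length xs = d - 1}"
    using summable_on_reindex[OF inj, of "\<lambda>xs. (f xs)\<^sup>2"] by (simp add: o_def)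
  have "influence d f k = infsum (\<lambda>xs. (f xs)\<^sup>2) (?g ` {xs. length xs = d - 1})"
    using infsum_reindex[OF inj, of "\<lambda>xs. (f xs)\<^sup>2"] by (simp add: influence_def o_def)
  also have "\<dots> \<le> (\<Sum>\<^sub>\<infinity>xs\<in>{xs. length xs = d}. (f xs)\<^sup>2)"
    using sub by (intro infsum_mono_neutral s f2) auto
  finally show "influence d f k \<le> (\<Sum>\<^sub>\<infinity>xs\<in>{xs. length xs = d}. (f xs)\<^sup>2)" .
qed

lemma influence_le_max:
  assumes "chaos_kernel d f" "d \<ge> 1"
  shows "influence d f k \<le> max_influence d f"
  unfolding max_influence_def
  by (rule cSUP_upper) (auto intro!: bdd_aboveI influence_summable(2)[OF assms])

text \<open>
  Each set containing \<open>k\<close> contributes at least one tuple, its sorted remainder followed by \<open>k\<close>, to the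
  influence of \<open>k\<close>.
\<close>
lemma set_coefficient_influence_le:
  assumes f: "chaos_kernel d f" and d: "d \<ge> 1"
  shows "(\<Sum>S | S \<subseteq> {..<n} \<and> k \<in> S. (set_coefficient d f S)\<^sup>2) \<le> (fact d)\<^sup>2 * max_influence d f"
proof -
  define B where "B = {S. S \<subseteq> {..<n} \<and> k \<in> S \<and> card S = d}"
  have finB: "finite B" unfolding B_def by (rule finite_subset[of _ "Pow {..<n}"]) auto
  have fin: "finite S" if "S \<in> B" for S using that finite_subset unfolding B_def by auto
  let ?g = "\<lambda>S. sorted_list_of_set (S - {k})"
  have eq: "(set_coefficient d f S)\<^sup>2 = (fact d)\<^sup>2 * (f (?g S @ [k]))\<^sup>2" if S: "S \<in> B" for S
  proof -
    have kS: "finite S" "k \<in> S" "card S = d" using S fin[OF S] by (auto simp: B_def)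
    then have *: "set (?g S @ [k]) = S" "distinct (?g S @ [k])" by auto
    have "f (?g S @ [k]) = f (sorted_list_of_set S)"
      using chaos_kernel_sorted[OF f _ *(2)] *(1) distinct_card[OF *(2)] kS(3) by metis
    then show ?thesis using kS by (simp add: set_coefficient_def power_mult_distrib)
  qed
  have inj: "inj_on ?g B"
  proof (rule inj_onI)
    fix S T assume S: "S \<in> B" and T: "T \<in> B" and e: "?g S = ?g T"
    have "set (?g S) = set (?g T)" by (simp only: e)
    then have "S - {k} = T - {k}" using fin[OF S] fin[OF T] by simp
    then show "S = T" using S T unfolding B_def by blast
  qed
  have "(\<Sum>S | S \<subseteq> {..<n} \<and> k \<in> S. (set_coefficient d f S)\<^sup>2) = (\<Sum>S\<in>B. (set_coefficient d f S)\<^sup>2)"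
    by (rule sum.mono_neutral_right, rule finite_subset[of _ "Pow {..<n}"])
       (auto simp: B_def set_coefficient_def)
  also have "\<dots> = (fact d)\<^sup>2 * (\<Sum>S\<in>B. (f (?g S @ [k]))\<^sup>2)"
    by (simp add: eq sum_distrib_left)
  also have "(\<Sum>S\<in>B. (f (?g S @ [k]))\<^sup>2) = (\<Sum>xs\<in>?g ` B. (f (xs @ [k]))\<^sup>2)"
    by (simp add: sum.reindex[OF inj])
  also have "\<dots> \<le> influence d f k"
    unfolding influence_def
  proof (rule finite_sum_le_infsum[OF influence_summable(1)[OF f d]])
    show "?g ` B \<subseteq> {xs. length xs = d - 1}"
    proof (rule image_subsetI)
      fix S assume S: "S \<in> B"
      then have "length (?g S) = d - 1" using fin[OF S] by (simp add: B_def card_Diff_singleton)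
      then show "?g S \<in> {xs. length xs = d - 1}" by simp
    qed
  qed (use finB in auto)
  also have "\<dots> \<le> max_influence d f" by (rule influence_le_max[OF f d])
  finally show ?thesis by (simp add: mult_left_mono)
qed

lemma filterlim_lists_below:
  "filterlim (\<lambda>n. {xs. length xs = d \<and> set xs \<subseteq> {..<n::nat}}) (finite_subsets_at_top {xs. length xs = d}) sequentially"
  unfolding filterlim_finite_subsets_at_top
proof (intro allI impI)
  fix A :: "nat list set" assume A: "finite A \<and> A \<subseteq> {xs. length xs = d}"
  then have "finite (\<Union>xs\<in>A. set xs)" by auto
  then obtain n0 where n0: "(\<Union>xs\<in>A. set xs) \<subseteq> {..<n0}" using finite_nat_iff_bounded by blast
  show "\<forall>\<^sub>F n in sequentially. finite {xs. length xs = d \<and> set xs \<subseteq> {..<n}} \<and>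
      A \<subseteq> {xs. length xs = d \<and> set xs \<subseteq> {..<n}} \<and> {xs. length xs = d \<and> set xs \<subseteq> {..<n}} \<subseteq> {xs. length xs = d}"
  proof (rule eventually_sequentiallyI[of n0])
    fix n assume "n0 \<le> n"
    then have "\<And>xs. xs \<in> A \<Longrightarrow> set xs \<subseteq> {..<n}" using n0 by fastforce
    then show "finite {xs. length xs = d \<and> set xs \<subseteq> {..<n}} \<and>
      A \<subseteq> {xs. length xs = d \<and> set xs \<subseteq> {..<n}} \<and> {xs. length xs = d \<and> set xs \<subseteq> {..<n}} \<subseteq> {xs. length xs = d}"
      using A finite_lists_length_eq[of "{..<n}" d] by (auto simp: conj_commute)
  qed
qed

sublocale rademacher_sequence \<subseteq> canonical: biased_cube p
  by unfold_locales (rule p_pos, rule p_less_1)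

context rademacher_sequence
begin

definition signs :: "'a \<Rightarrow> nat \<Rightarrow> bool" where
  "signs \<omega> k \<longleftrightarrow> X k \<omega> = 1"

lemma X_measurable [measurable]: "X k \<in> borel_measurable M"
  using indep by (auto simp: indep_vars_def)

lemma signs_coordinate_measurable: "(\<lambda>\<omega>. signs \<omega> k) \<in> M \<rightarrow>\<^sub>M measure_pmf (bernoulli_pmf (p k))"
proof -
  have "Measurable.pred M (\<lambda>\<omega>. X k \<omega> = 1)" by measurable
  then show ?thesis by (simp add: signs_def)
qed

lemma signs_coordinate_law:
  "distr M (measure_pmf (bernoulli_pmf (p k))) (\<lambda>\<omega>. signs \<omega> k) = measure_pmf (bernoulli_pmf (p k))"
proof (rule measure_eqI_countable[of _ UNIV])
  fix b :: bool
  have [measurable]: "(\<lambda>\<omega>. signs \<omega> k) \<in> M \<rightarrow>\<^sub>M count_space UNIV"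
    using signs_coordinate_measurable[of k] by simp
  have "emeasure (distr M (measure_pmf (bernoulli_pmf (p k))) (\<lambda>\<omega>. signs \<omega> k)) {b}
      = emeasure M {\<omega> \<in> space M. signs \<omega> k = b}"
    by (subst emeasure_distr) (auto intro!: arg_cong[where f = "emeasure M"])
  also have "\<dots> = prob {\<omega> \<in> space M. signs \<omega> k = b}" by (simp add: emeasure_eq_measure)
  also have "prob {\<omega> \<in> space M. signs \<omega> k = b} = (if b then p k else 1 - p k)"
  proof (cases b)
    case True
    then show ?thesis using prob_X_pos[of k] by (simp add: signs_def)
  next
    case False
    have "{\<omega> \<in> space M. X k \<omega> = 1} \<in> events" by measurable
    then have "prob (space M - {\<omega> \<in> space M. X k \<omega> = 1}) = 1 - p k"
      using prob_X_pos[of k] by (simp add: prob_compl)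
    moreover have "space M - {\<omega> \<in> space M. X k \<omega> = 1} = {\<omega> \<in> space M. signs \<omega> k = b}"
      using False by (auto simp: signs_def)
    ultimately show ?thesis using False by simp
  qed
  finally show "emeasure (distr M (measure_pmf (bernoulli_pmf (p k))) (\<lambda>\<omega>. signs \<omega> k)) {b} = emeasure (measure_pmf (bernoulli_pmf (p k))) {b}"
    using p_pos[of k] p_less_1[of k] by (simp add: emeasure_pmf_single)
qed auto

lemma signs_measurable [measurable]: "signs \<in> M \<rightarrow>\<^sub>M canonical.cube"
  unfolding canonical.cube_def
  by (rule measurable_PiM_single') (rule signs_coordinate_measurable, auto)

lemma signs_law: "distr M canonical.cube signs = canonical.cube"
proof -
  have "indep_vars (\<lambda>k. measure_pmf (bernoulli_pmf (p k))) (\<lambda>k \<omega>. signs \<omega> k) UNIV"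
    unfolding signs_def
    using indep_vars_compose2[OF indep, of "\<lambda>k x. x = 1" "\<lambda>k. measure_pmf (bernoulli_pmf (p k))"] by simp
  then have "distr M (PiM UNIV (\<lambda>k. measure_pmf (bernoulli_pmf (p k)))) (\<lambda>\<omega>. \<lambda>k\<in>UNIV. signs \<omega> k)
      = PiM UNIV (\<lambda>k. distr M (measure_pmf (bernoulli_pmf (p k))) (\<lambda>\<omega>. signs \<omega> k))"
    by (rule indep_vars_iff_distr_eq_PiM'[THEN iffD1, rotated 2]) (simp, rule signs_coordinate_measurable)
  moreover have "(\<lambda>\<omega>. \<lambda>k\<in>UNIV. signs \<omega> k) = signs" by (simp add: fun_eq_iff)
  ultimately show ?thesis by (simp only: signs_coordinate_law canonical.cube_def)
qed

lemma integral_signs: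
  fixes g :: "(nat \<Rightarrow> bool) \<Rightarrow> real"
  assumes [measurable]: "g \<in> borel_measurable canonical.cube"
  shows "(\<integral>x. g x \<partial>canonical.cube) = (\<integral>\<omega>. g (signs \<omega>) \<partial>M)"
    and "integrable canonical.cube g \<longleftrightarrow> integrable M (\<lambda>\<omega>. g (signs \<omega>))"
proof -
  show "(\<integral>x. g x \<partial>canonical.cube) = (\<integral>\<omega>. g (signs \<omega>) \<partial>M)"
    by (subst signs_law[symmetric], subst integral_distr) auto
  show "integrable canonical.cube g \<longleftrightarrow> integrable M (\<lambda>\<omega>. g (signs \<omega>))"
    by (subst signs_law[symmetric], subst integrable_distr_eq) auto
qed

lemma AE_normalized_rademacher: "AE \<omega> in M. \<forall>k. normalized_rademacher p X k \<omega> = canonical.Y k (signs \<omega>)"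
proof (subst AE_all_countable, rule allI)
  fix k
  have ev: "{\<omega> \<in> space M. X k \<omega> = 1} \<in> events" "{\<omega> \<in> space M. X k \<omega> = - 1} \<in> events" by measurable
  have "prob ({\<omega> \<in> space M. X k \<omega> = 1} \<union> {\<omega> \<in> space M. X k \<omega> = - 1}) = 1"
    using ev prob_X_pos[of k] prob_X_neg[of k] by (subst finite_measure_Union) auto
  then have "AE \<omega> in M. \<omega> \<in> {\<omega> \<in> space M. X k \<omega> = 1} \<union> {\<omega> \<in> space M. X k \<omega> = - 1}"
    by (rule AE_prob_1)
  then show "AE \<omega> in M. normalized_rademacher p X k \<omega> = canonical.Y k (signs \<omega>)"
  proof eventually_elim
    case (elim \<omega>)
    then consider "X k \<omega> = 1" | "X k \<omega> = - 1" by auto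
    then show ?case
    proof cases
      case 1
      then have "normalized_rademacher p X k \<omega> = (2 * (1 - p k)) / (2 * sqrt (p k * (1 - p k)))"
        by (simp add: normalized_rademacher_def)
      then show ?thesis using 1 by (simp only: mult_divide_mult_cancel_left_if) (simp add: canonical.Y_def signs_def)
    next
      case 2
      then have "normalized_rademacher p X k \<omega> = (2 * (- p k)) / (2 * sqrt (p k * (1 - p k)))"
        by (simp add: normalized_rademacher_def)
      then show ?thesis using 2 by (simp only: mult_divide_mult_cancel_left_if) (simp add: canonical.Y_def signs_def)
    qed
  qed
qed

lemma chaos_on_cube:
  assumes d: "d \<ge> 1" and F: "is_chaos M (normalized_rademacher p X) d f F"
    and F4: "integrable M (\<lambda>\<omega>. F \<omega> ^ 4)"
  shows "\<exists>phi. chaos_limit p (set_coefficient d f) d ((fact d)\<^sup>2 * max_influence d f) phi \<and> (AE \<omega> in M. F \<omega> = phi (signs \<omega>))"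
proof -
  have f: "chaos_kernel d f" and [measurable]: "F \<in> borel_measurable M" and F2: "integrable M (\<lambda>\<omega>. (F \<omega>)\<^sup>2)"
    and lim: "((\<lambda>A. \<integral>\<omega>. (F \<omega> - (\<Sum>xs\<in>A. f xs * (\<Prod>j<d. normalized_rademacher p X (xs ! j) \<omega>)))\<^sup>2 \<partial>M) \<longlongrightarrow> 0)
       (finite_subsets_at_top {xs. length xs = d})"
    using F by (auto simp: is_chaos_def)
  interpret W: walsh_chaos p "set_coefficient d f" d "(fact d)\<^sup>2 * max_influence d f"
    by unfold_locales (use d set_coefficient_influence_le[OF f d] in \<open>auto simp: set_coefficient_def split: if_splits\<close>)
  have eqF: "AE \<omega> in M. (\<Sum>xs | length xs = d \<and> set xs \<subseteq> {..<n}. f xs * (\<Prod>j<d. normalized_rademacher p X (xs ! j) \<omega>)) = W.psum n (signs \<omega>)" for n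
    using AE_normalized_rademacher
  proof eventually_elim
    case (elim \<omega>)
    then show ?case
      using sum_lists_eq_sum_subsets[OF f, where y = "\<lambda>k. canonical.Y k (signs \<omega>)" and n = n]
      by (simp add: W.psum_def canonical.walsh_def)
  qed
  have [measurable]: "normalized_rademacher p X k \<in> borel_measurable M" for k
    unfolding normalized_rademacher_def[abs_def] by measurable
  have FM [measurable]: "(\<lambda>\<omega>. W.psum n (signs \<omega>)) \<in> borel_measurable M" for n by measurable
  have conv: "(\<lambda>n. \<integral>\<omega>. (F \<omega> - W.psum n (signs \<omega>))\<^sup>2 \<partial>M) \<longlonglongrightarrow> 0"
  proof -
    have "(\<lambda>n. \<integral>\<omega>. (F \<omega> - (\<Sum>xs | length xs = d \<and> set xs \<subseteq> {..<n}. f xs * (\<Prod>j<d. normalized_rademacher p X (xs ! j) \<omega>)))\<^sup>2 \<partial>M) \<longlonglongrightarrow> 0"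
      by (rule filterlim_compose[OF lim filterlim_lists_below])
    also have "(\<lambda>n. \<integral>\<omega>. (F \<omega> - (\<Sum>xs | length xs = d \<and> set xs \<subseteq> {..<n}. f xs * (\<Prod>j<d. normalized_rademacher p X (xs ! j) \<omega>)))\<^sup>2 \<partial>M)
        = (\<lambda>n. \<integral>\<omega>. (F \<omega> - W.psum n (signs \<omega>))\<^sup>2 \<partial>M)"
    proof
      fix n
      show "(\<integral>\<omega>. (F \<omega> - (\<Sum>xs | length xs = d \<and> set xs \<subseteq> {..<n}. f xs * (\<Prod>j<d. normalized_rademacher p X (xs ! j) \<omega>)))\<^sup>2 \<partial>M)
        = (\<integral>\<omega>. (F \<omega> - W.psum n (signs \<omega>))\<^sup>2 \<partial>M)"
        using eqF[of n] by (intro integral_cong_AE) auto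
    qed
    finally show ?thesis .
  qed
  have L2F: "square_integrable M F" using F2 by (simp add: square_integrable_def)
  have L2W: "square_integrable M (\<lambda>\<omega>. W.psum n (signs \<omega>))" for n
    using integral_signs(2)[of "\<lambda>x. (W.psum n x)\<^sup>2"] W.integrable_cyl_poly(1)[of n 2] by (simp add: square_integrable_def)
  have int: "integrable M (\<lambda>\<omega>. F \<omega> - W.psum n (signs \<omega>))" for n
    by (intro L2_integrable L2_diff L2F L2W)
  have "(\<lambda>n. \<integral>\<omega>. norm (F \<omega> - W.psum n (signs \<omega>)) \<partial>M) \<longlonglongrightarrow> 0"
  proof (rule tendsto_sandwich[OF _ _ tendsto_const])
    show "\<forall>\<^sub>F n in sequentially. (\<integral>\<omega>. norm (F \<omega> - W.psum n (signs \<omega>)) \<partial>M) \<le> sqrt (\<integral>\<omega>. (F \<omega> - W.psum n (signs \<omega>))\<^sup>2 \<partial>M)"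
      by (intro always_eventually allI) (simp add: integral_abs_le_L2 L2_diff L2F L2W)
    have "(\<lambda>n. sqrt (\<integral>\<omega>. (F \<omega> - W.psum n (signs \<omega>))\<^sup>2 \<partial>M)) \<longlonglongrightarrow> sqrt 0" by (intro tendsto_intros conv)
    then show "(\<lambda>n. sqrt (\<integral>\<omega>. (F \<omega> - W.psum n (signs \<omega>))\<^sup>2 \<partial>M)) \<longlonglongrightarrow> 0" by simp
  qed auto
  from tendsto_L1_AE_subseq[OF int this] obtain r
    where ae: "AE \<omega> in M. (\<lambda>n. F \<omega> - W.psum (r n) (signs \<omega>)) \<longlonglongrightarrow> 0" by auto
  \<comment> \<open>The variable \<open>F\<close> is given on \<open>M\<close>, where coordinates cannot be flipped; the limit is a function on the cube.\<close>
  define phi where "phi x = lim (\<lambda>n. W.psum (r n) x)" for x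
  have phi_meas [measurable]: "phi \<in> borel_measurable canonical.cube"
    unfolding phi_def[abs_def] by (rule borel_measurable_lim_metric) auto
  have Fphi: "AE \<omega> in M. F \<omega> = phi (signs \<omega>)"
    using ae
  proof eventually_elim
    case (elim \<omega>)
    have "(\<lambda>n. F \<omega> - (F \<omega> - W.psum (r n) (signs \<omega>))) \<longlonglongrightarrow> F \<omega> - 0" by (intro tendsto_intros elim)
    then show ?case unfolding phi_def by (simp add: limI)
  qed
  have "chaos_limit p (set_coefficient d f) d ((fact d)\<^sup>2 * max_influence d f) phi"
  proof unfold_locales
    show "phi \<in> borel_measurable canonical.cube" by (rule phi_meas)
    have "integrable M (\<lambda>\<omega>. F \<omega> ^ 4) \<longleftrightarrow> integrable M (\<lambda>\<omega>. phi (signs \<omega>) ^ 4)"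
      using Fphi by (intro integrable_cong_AE) auto
    then show "integrable canonical.cube (\<lambda>x. phi x ^ 4)" using F4 by (simp add: integral_signs(2))
    have "(\<integral>x. (W.psum n x - phi x)\<^sup>2 \<partial>canonical.cube) = (\<integral>\<omega>. (F \<omega> - W.psum n (signs \<omega>))\<^sup>2 \<partial>M)" for n
    proof -
      have "(\<integral>x. (W.psum n x - phi x)\<^sup>2 \<partial>canonical.cube) = (\<integral>\<omega>. (W.psum n (signs \<omega>) - phi (signs \<omega>))\<^sup>2 \<partial>M)"
        by (rule integral_signs(1)) measurable
      also have "\<dots> = (\<integral>\<omega>. (F \<omega> - W.psum n (signs \<omega>))\<^sup>2 \<partial>M)"
        using Fphi by (intro integral_cong_AE) (auto simp: power2_commute)
      finally show ?thesis .
    qed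
    then show "(\<lambda>n. \<integral>x. (W.psum n x - phi x)\<^sup>2 \<partial>canonical.cube) \<longlonglongrightarrow> 0" using conv by simp
  qed
  with Fphi show ?thesis by blast
qed

lemma chaos_estimates:
  assumes d: "d \<ge> 1" and F: "is_chaos M (normalized_rademacher p X) d f F"
    and F4: "integrable M (\<lambda>\<omega>. F \<omega> ^ 4)"
  defines "\<mu> \<equiv> (4 ^ d + 2) * real d * ((fact d)\<^sup>2 * max_influence d f)"
  defines "\<rho> \<equiv> moment_R M F + \<mu> * moment M 2 F"
  shows "moment M 1 F = 0" and "0 \<le> \<rho>"
    and "\<bar>moment M 3 F - moment M 2 F\<bar> \<le> 2 * (sqrt (moment M 2 F) * sqrt \<rho>)"
    and "(AE \<omega> in M. F \<omega> + \<theta> \<in> \<nat>) \<Longrightarrow>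
      \<bar>(moment M 2 F + (real (Suc j) - \<theta>)) * prob {\<omega> \<in> space M. F \<omega> + \<theta> = real (Suc j)}
         - moment M 2 F * prob {\<omega> \<in> space M. F \<omega> + \<theta> = real j}\<bar>
      \<le> sqrt \<rho> + 12 * (sqrt (moment M 4 F) * sqrt \<rho>) + 4 * (sqrt (moment M 2 F) * sqrt \<rho>) + 4 * (\<mu> * moment M 2 F)"
proof -
  have [measurable]: "F \<in> borel_measurable M" using F by (simp add: is_chaos_def)
  obtain phi where "chaos_limit p (set_coefficient d f) d ((fact d)\<^sup>2 * max_influence d f) phi"
    and Fphi: "AE \<omega> in M. F \<omega> = phi (signs \<omega>)" using chaos_on_cube[OF d F F4] by blast
  then interpret C: chaos_limit p "set_coefficient d f" d "(fact d)\<^sup>2 * max_influence d f" phi by simp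
  have mom: "moment M k F = (\<integral>x. phi x ^ k \<partial>canonical.cube)" for k
  proof -
    have "moment M k F = (\<integral>\<omega>. phi (signs \<omega>) ^ k \<partial>M)"
      unfolding moment_def using Fphi by (intro integral_cong_AE) auto
    then show ?thesis by (simp add: integral_signs(1))
  qed
  have pr: "prob {\<omega> \<in> space M. F \<omega> + \<theta> = y} = canonical.prob {x. phi x + \<theta> = y}" for y
  proof -
    have ev: "{x. phi x + \<theta> = y} \<in> sets canonical.cube"
      using measurable_sets[of "\<lambda>x. phi x + \<theta>" canonical.cube borel "{y}"] by (simp add: vimage_def)
    have "canonical.prob {x. phi x + \<theta> = y} = measure (distr M canonical.cube signs) {x. phi x + \<theta> = y}"
      by (simp add: signs_law)
    also have "\<dots> = prob (signs -` {x. phi x + \<theta> = y} \<inter> space M)"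
      by (rule measure_distr) (use ev in auto)
    also have "\<dots> = prob {\<omega> \<in> space M. F \<omega> + \<theta> = y}"
      using Fphi measurable_sets[OF signs_measurable ev] by (intro finite_measure_eq_AE) auto
    finally show ?thesis by simp
  qed
  have rho: "\<rho> = C.excess_lim"
    by (simp add: \<rho>_def \<mu>_def moment_R_def mom C.excess_lim_def C.M2_def C.M3_def C.M4_def)
  show "moment M 1 F = 0" using C.phi_mean by (simp add: mom)
  show "0 \<le> \<rho>" unfolding rho by (rule C.excess_lim_nonneg)
  show "\<bar>moment M 3 F - moment M 2 F\<bar> \<le> 2 * (sqrt (moment M 2 F) * sqrt \<rho>)"
    using C.third_moment_limit_bound by (simp add: rho mom C.M2_def C.M3_def)
  assume nat: "AE \<omega> in M. F \<omega> + \<theta> \<in> \<nat>"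
  have "AE x in canonical.cube. phi x + \<theta> \<in> \<nat>"
  proof (subst signs_law[symmetric], subst AE_distr_iff)
    have "(\<nat> :: real set) \<in> sets borel"
      by (rule sets.countable) (auto simp: Nats_def)
    then show "{x \<in> space canonical.cube. phi x + \<theta> \<in> \<nat>} \<in> sets canonical.cube"
      using measurable_sets[of "\<lambda>x. phi x + \<theta>" canonical.cube borel "\<nat>"] by (simp add: vimage_def)
    show "AE \<omega> in M. phi (signs \<omega>) + \<theta> \<in> \<nat>" using nat Fphi by eventually_elim simp
  qed simp
  from C.birth_death_balance[OF this, of j]
  show "\<bar>(moment M 2 F + (real (Suc j) - \<theta>)) * prob {\<omega> \<in> space M. F \<omega> + \<theta> = real (Suc j)}
         - moment M 2 F * prob {\<omega> \<in> space M. F \<omega> + \<theta> = real j}\<bar>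
      \<le> sqrt \<rho> + 12 * (sqrt (moment M 4 F) * sqrt \<rho>) + 4 * (sqrt (moment M 2 F) * sqrt \<rho>) + 4 * (\<mu> * moment M 2 F)"
    unfolding pr mom rho \<mu>_def C.M2_def C.M4_def by (simp add: mult.assoc)
qed

end

section \<open>Convergence to the Poisson law\<close>

definition poisson_weight :: "real \<Rightarrow> nat \<Rightarrow> real" where
  "poisson_weight l j = l ^ j / fact j * exp (- l)"

lemma poisson_weight_sums: "poisson_weight l sums 1"
proof -
  have "(\<lambda>j. l ^ j /\<^sub>R fact j * exp (- l)) sums (exp l * exp (- l))"
    by (intro sums_mult2 exp_converges)
  then show ?thesis by (simp add: poisson_weight_def[abs_def] exp_minus_inverse divide_inverse ac_simps)
qed

text \<open>The identity \<open>E[P g(P)] = l E[g(P + 1)]\<close> for a Poisson variable \<open>P\<close>.\<close>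
lemma poisson_weight_shift:
  assumes "(\<lambda>j. g (Suc j) * poisson_weight l j) sums S"
  shows "(\<lambda>j. real j * g j * poisson_weight l j) sums (l * S)"
proof -
  have w: "real (Suc j) * poisson_weight l (Suc j) = l * poisson_weight l j" for j
  proof -
    have "real (Suc j) / fact (Suc j) = 1 / fact j"
      unfolding fact_Suc by (rule nonzero_divide_mult_cancel_left) simp
    then show ?thesis unfolding poisson_weight_def power_Suc by (metis (no_types, opaque_lifting) mult.assoc mult.commute times_divide_eq_right mult_1_right)
  qed
  have "(\<lambda>j. real (Suc j) * g (Suc j) * poisson_weight l (Suc j)) = (\<lambda>j. l * (g (Suc j) * poisson_weight l j))"
  proof
    fix j
    have "real (Suc j) * g (Suc j) * poisson_weight l (Suc j) = g (Suc j) * (real (Suc j) * poisson_weight l (Suc j))"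
      by (simp only: ac_simps)
    then show "real (Suc j) * g (Suc j) * poisson_weight l (Suc j) = l * (g (Suc j) * poisson_weight l j)"
      unfolding w by (simp only: ac_simps)
  qed
  moreover have "(\<lambda>j. l * (g (Suc j) * poisson_weight l j)) sums (l * S)" by (intro sums_mult assms)
  ultimately have "(\<lambda>j. real (Suc j) * g (Suc j) * poisson_weight l (Suc j)) sums (l * S)" by simp
  from sums_Suc[OF this] show ?thesis by simp
qed

lemma poisson_moments:
  shows "(\<lambda>j. real j ^ 1 * poisson_weight l j) sums l"
    and "(\<lambda>j. real j ^ 2 * poisson_weight l j) sums (l ^ 2 + l)"
    and "(\<lambda>j. real j ^ 3 * poisson_weight l j) sums (l ^ 3 + 3 * l ^ 2 + l)"
    and "(\<lambda>j. real j ^ 4 * poisson_weight l j) sums (l ^ 4 + 6 * l ^ 3 + 7 * l ^ 2 + l)"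
proof -
  note w = poisson_weight_sums[of l]
  have "(\<lambda>j. 1 * poisson_weight l j) sums 1" using w by simp
  from poisson_weight_shift[OF this[folded]] have 1: "(\<lambda>j. real j * poisson_weight l j) sums l" by simp
  then show "(\<lambda>j. real j ^ 1 * poisson_weight l j) sums l" by simp
  have "(\<lambda>j. real j * poisson_weight l j + poisson_weight l j) sums (l + 1)" by (intro sums_add 1 w)
  then have "(\<lambda>j. real (Suc j) * poisson_weight l j) sums (l + 1)" by (simp add: algebra_simps)
  from poisson_weight_shift[OF this] have 2: "(\<lambda>j. real j ^ 2 * poisson_weight l j) sums (l ^ 2 + l)"
    by (simp add: power2_eq_square algebra_simps)
  then show "(\<lambda>j. real j ^ 2 * poisson_weight l j) sums (l ^ 2 + l)" .
  have "(\<lambda>j. real j ^ 2 * poisson_weight l j + 2 * (real j * poisson_weight l j) + poisson_weight l j) sums (l ^ 2 + l + 2 * l + 1)"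
    by (intro sums_add sums_mult 1 2 w)
  then have "(\<lambda>j. real (Suc j) ^ 2 * poisson_weight l j) sums (l ^ 2 + l + 2 * l + 1)"
    by (simp add: power2_eq_square algebra_simps)
  from poisson_weight_shift[where g = "\<lambda>j. real j ^ 2", OF this]
  have 3: "(\<lambda>j. real j ^ 3 * poisson_weight l j) sums (l ^ 3 + 3 * l ^ 2 + l)"
    by (simp add: power2_eq_square power3_eq_cube algebra_simps)
  then show "(\<lambda>j. real j ^ 3 * poisson_weight l j) sums (l ^ 3 + 3 * l ^ 2 + l)" .
  have "(\<lambda>j. real j ^ 3 * poisson_weight l j + 3 * (real j ^ 2 * poisson_weight l j) + 3 * (real j * poisson_weight l j) + poisson_weight l j)
      sums (l ^ 3 + 3 * l ^ 2 + l + 3 * (l ^ 2 + l) + 3 * l + 1)"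
    by (intro sums_add sums_mult 1 2 3 w)
  then have "(\<lambda>j. real (Suc j) ^ 3 * poisson_weight l j) sums (l ^ 3 + 3 * l ^ 2 + l + 3 * (l ^ 2 + l) + 3 * l + 1)"
    by (simp add: power2_eq_square power3_eq_cube algebra_simps)
  from poisson_weight_shift[where g = "\<lambda>j. real j ^ 3", OF this]
  show "(\<lambda>j. real j ^ 4 * poisson_weight l j) sums (l ^ 4 + 6 * l ^ 3 + 7 * l ^ 2 + l)"
    by (simp add: power2_eq_square power3_eq_cube power4_eq_xxxx algebra_simps)
qed

lemma poisson_weight_pmf: "0 < l \<Longrightarrow> pmf (poisson_pmf l) j = poisson_weight l j"
  by (simp add: poisson_weight_def)

locale nat_valued_sequence = prob_space M for M :: "'a measure" +
  fixes Z :: "nat \<Rightarrow> 'a \<Rightarrow> real"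
  assumes Z_measurable [measurable]: "Z n \<in> borel_measurable M"
    and Z_nat: "AE \<omega> in M. Z n \<omega> \<in> \<nat>"
    and Z4: "integrable M (\<lambda>\<omega>. Z n \<omega> ^ 4)"
begin

definition weight :: "nat \<Rightarrow> nat \<Rightarrow> real" where
  "weight n j = prob {\<omega> \<in> space M. Z n \<omega> = real j}"

definition tail_moment :: "nat \<Rightarrow> nat \<Rightarrow> nat \<Rightarrow> real" where
  "tail_moment k n J = (\<integral>\<omega>. Z n \<omega> ^ k * indicator {\<omega> \<in> space M. Z n \<omega> > real J} \<omega> \<partial>M)"

lemma weight_nonneg: "0 \<le> weight n j" and weight_le_1: "weight n j \<le> 1"
  by (simp_all add: weight_def)

lemma integrable_Z_power: "k \<le> 4 \<Longrightarrow> integrable M (\<lambda>\<omega>. Z n \<omega> ^ k)"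
  by (rule integrable_power_of_fourth[OF Z_measurable Z4])

lemma integrable_tail_moment:
  "k \<le> 4 \<Longrightarrow> integrable M (\<lambda>\<omega>. Z n \<omega> ^ k * indicator {\<omega> \<in> space M. Z n \<omega> > real J} \<omega>)"
  by (rule Bochner_Integration.integrable_bound[OF integrable_Z_power[of k n]]) (auto simp: indicator_def)

lemma integrable_atom: "integrable M (indicat_real {\<omega> \<in> space M. Z n \<omega> = y})"
  by (intro integrable_real_indicator) (simp_all add: emeasure_eq_measure)

lemma moment_split:
  assumes "k \<le> 4"
  shows "moment M k (Z n) = (\<Sum>j\<le>J. real j ^ k * weight n j) + tail_moment k n J"
proof -
  have "moment M k (Z n) = (\<integral>\<omega>. (\<Sum>j\<le>J. real j ^ k * indicat_real {\<omega> \<in> space M. Z n \<omega> = real j} \<omega>)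
      + Z n \<omega> ^ k * indicator {\<omega> \<in> space M. Z n \<omega> > real J} \<omega> \<partial>M)"
    unfolding moment_def
  proof (rule integral_cong_AE)
    show "AE \<omega> in M. Z n \<omega> ^ k = (\<Sum>j\<le>J. real j ^ k * indicat_real {\<omega> \<in> space M. Z n \<omega> = real j} \<omega>)
      + Z n \<omega> ^ k * indicator {\<omega> \<in> space M. Z n \<omega> > real J} \<omega>"
      using Z_nat[of n] AE_space
    proof eventually_elim
      case (elim \<omega>)
      then obtain i :: nat where i: "Z n \<omega> = real i" by (auto elim: Nats_cases)
      have "(\<Sum>j\<le>J. real j ^ k * indicat_real {\<omega> \<in> space M. Z n \<omega> = real j} \<omega>) = (\<Sum>j\<le>J. if j = i then real i ^ k else 0)"
        using elim(2) by (intro sum.cong refl) (auto simp: i)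
      then show ?case using elim(2) by (cases "i \<le> J") (auto simp: i)
    qed
  qed measurable
  also have "\<dots> = (\<Sum>j\<le>J. real j ^ k * weight n j) + tail_moment k n J"
  proof (subst Bochner_Integration.integral_add)
    show "integrable M (\<lambda>\<omega>. \<Sum>j\<le>J. real j ^ k * indicat_real {\<omega> \<in> space M. Z n \<omega> = real j} \<omega>)"
      by (intro Bochner_Integration.integrable_sum integrable_mult_right integrable_atom)
    have "(\<integral>\<omega>. (\<Sum>j\<le>J. real j ^ k * indicat_real {\<omega> \<in> space M. Z n \<omega> = real j} \<omega>) \<partial>M)
        = (\<Sum>j\<le>J. real j ^ k * (\<integral>\<omega>. indicat_real {\<omega> \<in> space M. Z n \<omega> = real j} \<omega> \<partial>M))"
      by (subst Bochner_Integration.integral_sum)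
         (intro integrable_mult_right integrable_atom, simp only: integral_mult_right_zero)
    also have "\<dots> = (\<Sum>j\<le>J. real j ^ k * weight n j)" unfolding weight_def by simp
    finally show "(\<integral>\<omega>. (\<Sum>j\<le>J. real j ^ k * indicat_real {\<omega> \<in> space M. Z n \<omega> = real j} \<omega>) \<partial>M)
        + (\<integral>\<omega>. Z n \<omega> ^ k * indicat_real {\<omega> \<in> space M. real J < Z n \<omega>} \<omega> \<partial>M) = (\<Sum>j\<le>J. real j ^ k * weight n j) + tail_moment k n J"
      by (simp only: tail_moment_def)
  qed (rule integrable_tail_moment[OF assms])
  finally show ?thesis .
qed

lemma tail_moment_nonneg: "0 \<le> tail_moment k n J"
  unfolding tail_moment_def by (intro Bochner_Integration.integral_nonneg) (auto simp: indicator_def)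

lemma AE_tail_moment_point: "AE \<omega> in M. Z n \<omega> > real J \<longrightarrow> Z n \<omega> \<ge> real (Suc J)"
  using Z_nat[of n] by eventually_elim (auto elim!: Nats_cases)

lemma tail_moment_le_tail_moment4:
  assumes "k \<le> 4" shows "tail_moment k n J \<le> tail_moment 4 n J"
  unfolding tail_moment_def
proof (rule integral_mono_AE[OF integrable_tail_moment[OF assms] integrable_tail_moment])
  show "AE \<omega> in M. Z n \<omega> ^ k * indicator {\<omega> \<in> space M. Z n \<omega> > real J} \<omega>
      \<le> Z n \<omega> ^ 4 * indicator {\<omega> \<in> space M. Z n \<omega> > real J} \<omega>"
    using AE_tail_moment_point[of J n]
  proof eventually_elim
    case (elim \<omega>)
    show ?case using elim assms by (auto simp: indicator_def intro!: power_increasing)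
  qed
qed simp

lemma tail_moment0_eq: "tail_moment 0 n J = 1 - (\<Sum>j\<le>J. weight n j)"
  using moment_split[of 0 n J] by (simp add: moment_def prob_space)

lemma tail_moment0_le: "tail_moment 0 n J \<le> moment M 2 (Z n) / real (Suc J)"
proof -
  have "tail_moment 0 n J \<le> (\<integral>\<omega>. Z n \<omega> ^ 2 / real (Suc J) \<partial>M)"
    unfolding tail_moment_def
  proof (rule integral_mono_AE)
    show "integrable M (\<lambda>\<omega>. Z n \<omega> ^ 0 * indicator {\<omega> \<in> space M. Z n \<omega> > real J} \<omega>)" by (rule integrable_tail_moment) simp
    show "integrable M (\<lambda>\<omega>. Z n \<omega> ^ 2 / real (Suc J))" using integrable_Z_power[of 2 n] by simp
    show "AE \<omega> in M. Z n \<omega> ^ 0 * indicator {\<omega> \<in> space M. Z n \<omega> > real J} \<omega> \<le> Z n \<omega> ^ 2 / real (Suc J)"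
      using AE_tail_moment_point[of J n]
    proof eventually_elim
      case (elim \<omega>)
      show ?case
      proof (cases "\<omega> \<in> space M \<and> Z n \<omega> > real J")
        case True
        then have z: "real (Suc J) \<le> Z n \<omega>" using elim by simp
        have "real (Suc J) * 1 \<le> Z n \<omega> * Z n \<omega>" using z by (intro mult_mono) auto
        then show ?thesis using True by (simp add: power2_eq_square)
      next
        case False
        then have "\<omega> \<notin> {\<omega> \<in> space M. Z n \<omega> > real J}" by blast
        then show ?thesis by simp
      qed
    qed
  qed
  then show ?thesis by (simp add: moment_def)
qed

lemma tail_moment4_tendsto_0: "(\<lambda>J. tail_moment 4 n J) \<longlonglongrightarrow> 0"
proof -
  have "(\<lambda>J. tail_moment 4 n J) \<longlonglongrightarrow> (\<integral>\<omega>. 0 \<partial>M)"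
    unfolding tail_moment_def
  proof (rule integral_dominated_convergence[where w = "\<lambda>\<omega>. Z n \<omega> ^ 4"])
    show "AE \<omega> in M. (\<lambda>J. Z n \<omega> ^ 4 * indicator {\<omega> \<in> space M. Z n \<omega> > real J} \<omega>) \<longlonglongrightarrow> 0"
    proof (rule AE_I2)
      fix \<omega>
      obtain J0 :: nat where "Z n \<omega> \<le> real J0" using real_arch_simple by blast
      then have "Z n \<omega> ^ 4 * indicator {\<omega> \<in> space M. Z n \<omega> > real J} \<omega> = 0" if "J0 \<le> J" for J
        using that by (auto simp: indicator_def)
      then show "(\<lambda>J. Z n \<omega> ^ 4 * indicator {\<omega> \<in> space M. Z n \<omega> > real J} \<omega>) \<longlonglongrightarrow> 0"
        by (intro tendsto_eventually eventually_sequentiallyI[of J0]) auto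
    qed
  qed (use Z4 in \<open>auto simp: indicator_def\<close>)
  then show ?thesis by simp
qed

text \<open>
  The balance between births and deaths determines the limit law up to the mass at the origin, which
  is fixed by tightness.
\<close>

lemma weights_converge_of_balance:
  assumes l: "0 < l"
    and bal: "\<And>j. (\<lambda>n. real (Suc j) * weight n (Suc j) - l * weight n j) \<longlonglongrightarrow> 0"
    and bdd: "\<And>n. moment M 2 (Z n) \<le> C"
  shows "(\<lambda>n. weight n j) \<longlonglongrightarrow> poisson_weight l j"
proof -
  define v where "v j = l ^ j / fact j" for j
  have v_Suc: "v (Suc j) = l / real (Suc j) * v j" for j by (simp add: v_def)
  have ratio: "(\<lambda>n. weight n j - v j * weight n 0) \<longlonglongrightarrow> 0" for j
  proof (induction j)
    case 0
    then show ?case by (simp add: v_def)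
  next
    case (Suc j)
    have "(\<lambda>n. 1 / real (Suc j) * (real (Suc j) * weight n (Suc j) - l * weight n j) + l / real (Suc j) * (weight n j - v j * weight n 0))
        \<longlonglongrightarrow> 1 / real (Suc j) * 0 + l / real (Suc j) * 0"
      by (intro tendsto_intros bal Suc.IH)
    moreover have "1 / real (Suc j) * (real (Suc j) * weight n (Suc j) - l * weight n j) + l / real (Suc j) * (weight n j - v j * weight n 0)
        = weight n (Suc j) - v (Suc j) * weight n 0" for n
    proof -
      have "1 / real (Suc j) * (real (Suc j) * weight n (Suc j) - l * weight n j) = weight n (Suc j) - l / real (Suc j) * weight n j"
        by (simp add: right_diff_distrib)
      then show ?thesis unfolding v_Suc by (simp only: right_diff_distrib mult.assoc)
    qed
    ultimately show ?case by simp
  qed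
  have v_sums: "v sums exp l"
    using exp_converges[of l] by (simp add: v_def[abs_def] divide_inverse mult.commute)
  have v0: "0 \<le> v j" for j using l by (simp add: v_def)
  have "(\<lambda>n. weight n 0 * exp l - 1) \<longlonglongrightarrow> 0"
  proof (rule LIMSEQ_I)
    fix e :: real assume e: "0 < e"
    have "(\<lambda>J. (exp l - (\<Sum>j\<le>J. v j)) + C / real (Suc J)) \<longlonglongrightarrow> (exp l - exp l) + 0"
      using v_sums
      by (intro tendsto_intros LIMSEQ_Suc[OF lim_const_over_n]) (simp add: sums_def_le)
    then have "(\<lambda>J. (exp l - (\<Sum>j\<le>J. v j)) + C / real (Suc J)) \<longlonglongrightarrow> 0" by simp
    from LIMSEQ_D[OF this, of "e / 2"] e obtain J where "norm ((exp l - (\<Sum>j\<le>J. v j)) + C / real (Suc J) - 0) < e / 2"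
      by (auto dest: spec)
    then have J: "(exp l - (\<Sum>j\<le>J. v j)) + C / real (Suc J) < e / 2"
      unfolding real_norm_def diff_0_right abs_less_iff by (rule conjunct1)
    have "(\<lambda>n. \<Sum>j\<le>J. weight n j - v j * weight n 0) \<longlonglongrightarrow> (\<Sum>j\<le>J. 0)" by (intro tendsto_sum ratio)
    then have "(\<lambda>n. \<Sum>j\<le>J. weight n j - v j * weight n 0) \<longlonglongrightarrow> 0" by simp
    from LIMSEQ_D[OF this, of "e / 2"] e obtain n0 where n0: "\<And>n. n \<ge> n0 \<Longrightarrow> \<bar>\<Sum>j\<le>J. weight n j - v j * weight n 0\<bar> < e / 2"
      by fastforce
    show "\<exists>n0. \<forall>n\<ge>n0. norm (weight n 0 * exp l - 1 - 0) < e"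
    proof (intro exI allI impI)
      fix n assume n: "n0 \<le> n"
      define W where "W = exp l - (\<Sum>j\<le>J. v j)"
      have "(\<Sum>j\<le>J. weight n j - v j * weight n 0) = (\<Sum>j\<le>J. weight n j) - (\<Sum>j\<le>J. v j) * weight n 0"
        by (simp add: sum_subtractf sum_distrib_right)
      also have "\<dots> = 1 - tail_moment 0 n J - (\<Sum>j\<le>J. v j) * weight n 0" by (simp add: tail_moment0_eq)
      finally have eq: "weight n 0 * exp l - 1 = weight n 0 * W - tail_moment 0 n J - (\<Sum>j\<le>J. weight n j - v j * weight n 0)"
        by (simp add: W_def algebra_simps)
      have "(\<Sum>j\<le>J. v j) \<le> exp l"
        using sum_le_suminf[OF sums_summable[OF v_sums], of "{..J}"] v0 sums_unique[OF v_sums] by simp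
      then have "0 \<le> W" by (simp add: W_def)
      then have W: "0 \<le> weight n 0 * W" "weight n 0 * W \<le> W"
        using weight_nonneg[of n 0] mult_right_mono[OF weight_le_1[of n 0], of W] by simp_all
      have t: "tail_moment 0 n J \<le> C / real (Suc J)"
        using tail_moment0_le[of n J] divide_right_mono[OF bdd[of n], of "real (Suc J)"] by simp
      have lin: "\<bar>a - b - r\<bar> < e"
        if "0 \<le> a" "a \<le> w" "b \<le> u" "0 \<le> b" "\<bar>r\<bar> < e / 2" "w + u < e / 2" for a b r w u :: real
        using that by linarith
      have "\<bar>weight n 0 * exp l - 1\<bar> < e"
        unfolding eq by (rule lin[OF W t tail_moment_nonneg n0[OF n] J[folded W_def]])
      then show "norm (weight n 0 * exp l - 1 - 0) < e" by simp
    qed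
  qed
  then have "(\<lambda>n. exp (- l) * ((weight n 0 * exp l - 1) + 1)) \<longlonglongrightarrow> exp (- l) * (0 + 1)" by (intro tendsto_intros)
  moreover have "(\<lambda>n. exp (- l) * ((weight n 0 * exp l - 1) + 1)) = (\<lambda>n. weight n 0)"
    by (auto simp: exp_minus field_simps)
  ultimately have "(\<lambda>n. weight n 0) \<longlonglongrightarrow> exp (- l)" by (simp only: add_0 mult_1_right)
  then have "(\<lambda>n. (weight n j - v j * weight n 0) + v j * weight n 0) \<longlonglongrightarrow> 0 + v j * exp (- l)" by (intro tendsto_intros ratio)
  then show ?thesis by (simp add: poisson_weight_def v_def)
qed

lemma prob_image_split:
  "\<exists>t. 0 \<le> t \<and> t \<le> tail_moment 0 n J \<and> prob {\<omega> \<in> space M. Z n \<omega> \<in> real ` A} = (\<Sum>j | j \<le> J \<and> j \<in> A. weight n j) + t"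
proof -
  define B where "B = {\<omega> \<in> space M. Z n \<omega> \<in> real ` A \<and> Z n \<omega> > real J}"
  have [measurable]: "real ` A \<in> sets borel"
    by (rule sets.countable) auto
  have [measurable]: "B \<in> events" unfolding B_def by measurable
  have fin: "finite {j. j \<le> J \<and> j \<in> A}" by (rule finite_subset[of _ "{..J}"]) auto
  have "prob {\<omega> \<in> space M. Z n \<omega> \<in> real ` A} = prob ((\<Union>j\<in>{j. j \<le> J \<and> j \<in> A}. {\<omega> \<in> space M. Z n \<omega> = real j}) \<union> B)"
    by (rule arg_cong[where f = prob]) (auto simp: B_def not_le)
  also have "\<dots> = prob (\<Union>j\<in>{j. j \<le> J \<and> j \<in> A}. {\<omega> \<in> space M. Z n \<omega> = real j}) + prob B"
    by (rule finite_measure_Union) (auto simp: B_def fin)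
  also have "prob (\<Union>j\<in>{j. j \<le> J \<and> j \<in> A}. {\<omega> \<in> space M. Z n \<omega> = real j}) = (\<Sum>j | j \<le> J \<and> j \<in> A. weight n j)"
    unfolding weight_def by (rule finite_measure_finite_Union[OF fin]) (auto simp: disjoint_family_on_def)
  finally have 1: "prob {\<omega> \<in> space M. Z n \<omega> \<in> real ` A} = (\<Sum>j | j \<le> J \<and> j \<in> A. weight n j) + prob B" .
  have "prob B \<le> prob {\<omega> \<in> space M. Z n \<omega> > real J}" by (rule finite_measure_mono) (auto simp: B_def)
  also have "\<dots> = tail_moment 0 n J" by (simp add: tail_moment_def)
  finally show ?thesis using 1 by (intro exI[of _ "prob B"]) simp
qed

end

lemma measure_pmf_image_split:
  fixes P :: "nat pmf"
  shows "\<exists>t. 0 \<le> t \<and> t \<le> 1 - (\<Sum>j\<le>J. pmf P j) \<and> measure (measure_pmf P) A = (\<Sum>j | j \<le> J \<and> j \<in> A. pmf P j) + t"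
proof -
  have split: "measure (measure_pmf P) A' = (\<Sum>j | j \<le> J \<and> j \<in> A'. pmf P j) + measure (measure_pmf P) (A' \<inter> {J<..})" for A'
  proof -
    have fin: "finite {j. j \<le> J \<and> j \<in> A'}" by (rule finite_subset[of _ "{..J}"]) auto
    have "A' = {j. j \<le> J \<and> j \<in> A'} \<union> (A' \<inter> {J<..})" by auto
    then have "measure (measure_pmf P) A' = measure (measure_pmf P) ({j. j \<le> J \<and> j \<in> A'} \<union> (A' \<inter> {J<..}))" by simp
    also have "\<dots> = measure (measure_pmf P) {j. j \<le> J \<and> j \<in> A'} + measure (measure_pmf P) (A' \<inter> {J<..})"
      by (rule measure_pmf.finite_measure_Union) auto
    finally show ?thesis using measure_measure_pmf_finite[OF fin] by simp
  qed
  have "measure (measure_pmf P) (UNIV \<inter> {J<..}) = 1 - (\<Sum>j\<le>J. pmf P j)"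
    using split[of UNIV] by (simp add: atMost_def)
  moreover have "measure (measure_pmf P) (A \<inter> {J<..}) \<le> measure (measure_pmf P) (UNIV \<inter> {J<..})"
    by (rule measure_pmf.finite_measure_mono) auto
  ultimately show ?thesis using split[of A] by (intro exI[of _ "measure (measure_pmf P) (A \<inter> {J<..})"]) simp
qed

context nat_valued_sequence
begin

lemma tv_difference_bdd:
  "\<bar>prob {\<omega> \<in> space M. Z n \<omega> \<in> real ` A} - measure (measure_pmf P) {x. real x \<in> real ` A}\<bar> \<le> 1"
proof -
  have "0 \<le> prob E \<and> prob E \<le> 1" "0 \<le> measure (measure_pmf P) E' \<and> measure (measure_pmf P) E' \<le> 1" for E E'
    by simp_all
  then show ?thesis by (smt (verit))
qed

lemma tv_dist_eq:
  "tv_dist M (Z n) (measure_pmf P) real =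
    (SUP A. \<bar>prob {\<omega> \<in> space M. Z n \<omega> \<in> real ` A} - measure (measure_pmf P) A\<bar>)"
  unfolding tv_dist_def by (simp add: inj_image_mem_iff[OF inj_of_nat])

text \<open>
  Outside \<open>{..J}\<close> the two laws are compared through their total masses, which are determined by the
  weights on \<open>{..J}\<close>.
\<close>
lemma tv_dist_upper:
  "tv_dist M (Z n) (measure_pmf P) real \<le> 2 * (\<Sum>j\<le>J. \<bar>weight n j - pmf P j\<bar>) + 2 * (1 - (\<Sum>j\<le>J. pmf P j))"
  unfolding tv_dist_eq
proof (rule cSUP_least)
  fix A :: "nat set"
  obtain t where t: "0 \<le> t" "t \<le> tail_moment 0 n J" "prob {\<omega> \<in> space M. Z n \<omega> \<in> real ` A} = (\<Sum>j | j \<le> J \<and> j \<in> A. weight n j) + t"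
    using prob_image_split by blast
  obtain u where u: "0 \<le> u" "u \<le> 1 - (\<Sum>j\<le>J. pmf P j)" "measure (measure_pmf P) A = (\<Sum>j | j \<le> J \<and> j \<in> A. pmf P j) + u"
    using measure_pmf_image_split by blast
  have "\<bar>(\<Sum>j | j \<le> J \<and> j \<in> A. weight n j) - (\<Sum>j | j \<le> J \<and> j \<in> A. pmf P j)\<bar> \<le> (\<Sum>j | j \<le> J \<and> j \<in> A. \<bar>weight n j - pmf P j\<bar>)"
    unfolding sum_subtractf[symmetric] by (rule sum_abs)
  also have "\<dots> \<le> (\<Sum>j\<le>J. \<bar>weight n j - pmf P j\<bar>)" by (intro sum_mono2) auto
  finally have 1: "\<bar>(\<Sum>j | j \<le> J \<and> j \<in> A. weight n j) - (\<Sum>j | j \<le> J \<and> j \<in> A. pmf P j)\<bar> \<le> (\<Sum>j\<le>J. \<bar>weight n j - pmf P j\<bar>)" .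
  have "\<bar>(\<Sum>j\<le>J. weight n j) - (\<Sum>j\<le>J. pmf P j)\<bar> \<le> (\<Sum>j\<le>J. \<bar>weight n j - pmf P j\<bar>)"
    unfolding sum_subtractf[symmetric] by (rule sum_abs)
  then have 2: "tail_moment 0 n J \<le> 1 - (\<Sum>j\<le>J. pmf P j) + (\<Sum>j\<le>J. \<bar>weight n j - pmf P j\<bar>)"
    unfolding tail_moment0_eq by linarith
  show "\<bar>prob {\<omega> \<in> space M. Z n \<omega> \<in> real ` A} - measure (measure_pmf P) A\<bar>
      \<le> 2 * (\<Sum>j\<le>J. \<bar>weight n j - pmf P j\<bar>) + 2 * (1 - (\<Sum>j\<le>J. pmf P j))"
  proof -
    have lin: "\<bar>(S + t) - (T + u)\<bar> \<le> 2 * D + 2 * W"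
      if "\<bar>S - T\<bar> \<le> D" "0 \<le> t" "t \<le> r" "r \<le> W + D" "0 \<le> u" "u \<le> W" for S T D W t u r :: real
      using that by linarith
    show ?thesis unfolding t(3) u(3) by (rule lin[OF 1 t(1,2) 2 u(1,2)])
  qed
qed simp

lemma tv_dist_nonneg: "0 \<le> tv_dist M (Z n) (measure_pmf P) real"
proof -
  have "\<bar>prob {\<omega> \<in> space M. Z n \<omega> \<in> real ` {}} - measure (measure_pmf P) {}\<bar> \<le> tv_dist M (Z n) (measure_pmf P) real"
    unfolding tv_dist_eq using tv_difference_bdd[of n _ P]
    by (intro cSUP_upper) (auto intro!: bdd_aboveI[of _ 1] simp: inj_image_mem_iff[OF inj_of_nat])
  then show ?thesis by simp
qed

lemma weight_difference_le_tv_dist: "\<bar>weight n j - pmf P j\<bar> \<le> tv_dist M (Z n) (measure_pmf P) real"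
proof -
  have "\<bar>prob {\<omega> \<in> space M. Z n \<omega> \<in> real ` {j}} - measure (measure_pmf P) {j}\<bar> \<le> tv_dist M (Z n) (measure_pmf P) real"
    unfolding tv_dist_eq using tv_difference_bdd[of n _ P]
    by (intro cSUP_upper) (auto intro!: bdd_aboveI[of _ 1] simp: inj_image_mem_iff[OF inj_of_nat])
  then show ?thesis by (simp add: weight_def measure_pmf_single)
qed

lemma tv_dist_tendsto_0_iff:
  assumes l: "0 < l"
  shows "(\<lambda>n. tv_dist M (Z n) (measure_pmf (poisson_pmf l)) real) \<longlonglongrightarrow> 0 \<longleftrightarrow> (\<forall>j. (\<lambda>n. weight n j) \<longlonglongrightarrow> poisson_weight l j)"
proof
  assume tv: "(\<lambda>n. tv_dist M (Z n) (measure_pmf (poisson_pmf l)) real) \<longlonglongrightarrow> 0"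
  show "\<forall>j. (\<lambda>n. weight n j) \<longlonglongrightarrow> poisson_weight l j"
  proof
    fix j
    show "(\<lambda>n. weight n j) \<longlonglongrightarrow> poisson_weight l j"
    proof (rule LIM_zero_cancel, rule Lim_null_comparison[OF _ tv], rule always_eventually, rule allI)
      show "norm (weight n j - poisson_weight l j) \<le> tv_dist M (Z n) (measure_pmf (poisson_pmf l)) real" for n
        using weight_difference_le_tv_dist[of n j "poisson_pmf l"] poisson_weight_pmf[OF l] by simp
    qed
  qed
next
  assume conv: "\<forall>j. (\<lambda>n. weight n j) \<longlonglongrightarrow> poisson_weight l j"
  show "(\<lambda>n. tv_dist M (Z n) (measure_pmf (poisson_pmf l)) real) \<longlonglongrightarrow> 0"
  proof (rule LIMSEQ_I)
    fix e :: real assume e: "0 < e"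
    have "(\<lambda>J. 2 * (1 - (\<Sum>j\<le>J. poisson_weight l j))) \<longlonglongrightarrow> 2 * (1 - 1)"
      using poisson_weight_sums[of l] by (intro tendsto_intros) (simp add: sums_def_le)
    then have "(\<lambda>J. 2 * (1 - (\<Sum>j\<le>J. poisson_weight l j))) \<longlonglongrightarrow> 0" by simp
    from LIMSEQ_D[OF this, of "e / 2"] e obtain J where "norm (2 * (1 - (\<Sum>j\<le>J. poisson_weight l j)) - 0) < e / 2"
      by (auto dest: spec)
    then have J: "2 * (1 - (\<Sum>j\<le>J. poisson_weight l j)) < e / 2"
      unfolding real_norm_def diff_0_right abs_less_iff by (rule conjunct1)
    have "(\<lambda>n. 2 * (\<Sum>j\<le>J. \<bar>weight n j - poisson_weight l j\<bar>)) \<longlonglongrightarrow> 2 * (\<Sum>j\<le>J. \<bar>poisson_weight l j - poisson_weight l j\<bar>)"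
      using conv by (intro tendsto_intros) auto
    then have "(\<lambda>n. 2 * (\<Sum>j\<le>J. \<bar>weight n j - poisson_weight l j\<bar>)) \<longlonglongrightarrow> 0" by simp
    from LIMSEQ_D[OF this, of "e / 2"] e obtain n0 where n0: "\<And>n. n \<ge> n0 \<Longrightarrow> 2 * (\<Sum>j\<le>J. \<bar>weight n j - poisson_weight l j\<bar>) < e / 2"
      by fastforce
    show "\<exists>n0. \<forall>n\<ge>n0. norm (tv_dist M (Z n) (measure_pmf (poisson_pmf l)) real - 0) < e"
    proof (intro exI allI impI)
      fix n assume "n0 \<le> n"
      then have "tv_dist M (Z n) (measure_pmf (poisson_pmf l)) real < e"
        using tv_dist_upper[of n "poisson_pmf l" J] n0[of n] J unfolding poisson_weight_pmf[OF l] by linarith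
      then show "norm (tv_dist M (Z n) (measure_pmf (poisson_pmf l)) real - 0) < e"
        using tv_dist_nonneg[of n "poisson_pmf l"] by simp
    qed
  qed
qed

lemma AE_Z4_gt_iff: "AE \<omega> in M. \<bar>Z n \<omega> ^ 4\<bar> > real J ^ 4 \<longleftrightarrow> Z n \<omega> > real J"
  using Z_nat[of n]
proof eventually_elim
  case (elim \<omega>)
  then have "0 \<le> Z n \<omega>" by (auto elim: Nats_cases)
  then have "real J ^ 4 < Z n \<omega> ^ 4 \<longleftrightarrow> real J < Z n \<omega>"
    by (meson of_nat_0_le_iff power_less_imp_less_base power_strict_mono zero_less_numeral)
  then show ?case by simp
qed

lemma nn_integral_tail_moment4:
  "(\<integral>\<^sup>+\<omega>. ennreal \<bar>Z n \<omega> ^ 4\<bar> * indicator {\<omega>. \<bar>Z n \<omega> ^ 4\<bar> > real J ^ 4} \<omega> \<partial>M) = ennreal (tail_moment 4 n J)"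
proof -
  have "(\<integral>\<^sup>+\<omega>. ennreal \<bar>Z n \<omega> ^ 4\<bar> * indicator {\<omega>. \<bar>Z n \<omega> ^ 4\<bar> > real J ^ 4} \<omega> \<partial>M)
      = (\<integral>\<^sup>+\<omega>. ennreal (Z n \<omega> ^ 4 * indicator {\<omega> \<in> space M. Z n \<omega> > real J} \<omega>) \<partial>M)"
    using AE_Z4_gt_iff[of J n] AE_space
    by (intro nn_integral_cong_AE, eventually_elim) (auto simp: indicator_def)
  also have "\<dots> = ennreal (tail_moment 4 n J)"
    unfolding tail_moment_def using integrable_tail_moment[of 4 n J]
    by (intro nn_integral_eq_integral) (auto simp: indicator_def)
  finally show ?thesis .
qed

lemma tail_moment4_antimono: "J \<le> J' \<Longrightarrow> tail_moment 4 n J' \<le> tail_moment 4 n J"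
  unfolding tail_moment_def by (intro integral_mono integrable_tail_moment) (auto simp: indicator_def)

text \<open>For natural numbers the levels \<open>J\<^sup>4\<close> are cofinal, so truncation of \<open>Z\<close> itself suffices.\<close>
lemma uniformly_integrable_iff:
  "uniformly_integrable M UNIV (\<lambda>n \<omega>. Z n \<omega> ^ 4) \<longleftrightarrow> (\<forall>e>0. \<exists>J. \<forall>n. tail_moment 4 n J \<le> e)"
proof
  assume ui: "uniformly_integrable M UNIV (\<lambda>n \<omega>. Z n \<omega> ^ 4)"
  show "\<forall>e>0. \<exists>J. \<forall>n. tail_moment 4 n J \<le> e"
  proof (intro allI impI)
    fix e :: real assume e: "0 < e"
    have "\<forall>\<^sub>F K in at_top. (SUP n. \<integral>\<^sup>+\<omega>. ennreal \<bar>Z n \<omega> ^ 4\<bar> * indicator {\<omega>. \<bar>Z n \<omega> ^ 4\<bar> > K} \<omega> \<partial>M) < ennreal e"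
      using ui e unfolding uniformly_integrable_def by (intro order_tendstoD) auto
    then obtain K0 where K0: "\<And>K. K0 \<le> K \<Longrightarrow> (SUP n. \<integral>\<^sup>+\<omega>. ennreal \<bar>Z n \<omega> ^ 4\<bar> * indicator {\<omega>. \<bar>Z n \<omega> ^ 4\<bar> > K} \<omega> \<partial>M) < ennreal e"
      by (auto simp: eventually_at_top_linorder)
    obtain J :: nat where J: "K0 \<le> real J" "1 \<le> J"
      using real_arch_simple[of "max K0 1"] by auto
    have "K0 \<le> real J ^ 1" using J(1) by simp
    also have "\<dots> \<le> real J ^ 4" using J(2) by (intro power_increasing) auto
    finally have "K0 \<le> real J ^ 4" .
    have "tail_moment 4 n J \<le> e" for n
    proof -
      have "ennreal (tail_moment 4 n J) \<le> (SUP n. \<integral>\<^sup>+\<omega>. ennreal \<bar>Z n \<omega> ^ 4\<bar> * indicator {\<omega>. \<bar>Z n \<omega> ^ 4\<bar> > real J ^ 4} \<omega> \<partial>M)"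
        unfolding nn_integral_tail_moment4[symmetric] by (rule SUP_upper) simp
      also have "\<dots> < ennreal e" by (rule K0) fact
      finally show ?thesis using e tail_moment_nonneg by (simp add: ennreal_less_iff less_imp_le)
    qed
    then show "\<exists>J. \<forall>n. tail_moment 4 n J \<le> e" by blast
  qed
next
  assume t: "\<forall>e>0. \<exists>J. \<forall>n. tail_moment 4 n J \<le> e"
  have "((\<lambda>K::real. SUP n. \<integral>\<^sup>+\<omega>. ennreal \<bar>Z n \<omega> ^ 4\<bar> * indicator {\<omega>. \<bar>Z n \<omega> ^ 4\<bar> > K} \<omega> \<partial>M) \<longlongrightarrow> 0) at_top"
  proof (rule order_tendstoI)
    fix a :: ennreal assume "0 < a"
    then obtain c where c: "0 < c" "c < a" using dense by blast
    then have c_top: "c \<noteq> \<top>" by auto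
    define e where "e = enn2real c"
    have ce: "c = ennreal e" "0 < e" using c c_top by (auto simp: e_def enn2real_positive_iff less_top)
    then obtain J where J: "\<And>n. tail_moment 4 n J \<le> e" using t by blast
    show "\<forall>\<^sub>F K in at_top. (SUP n. \<integral>\<^sup>+\<omega>. ennreal \<bar>Z n \<omega> ^ 4\<bar> * indicator {\<omega>. \<bar>Z n \<omega> ^ 4\<bar> > K} \<omega> \<partial>M) < a"
      using eventually_ge_at_top[of "real J ^ 4"]
    proof eventually_elim
      case (elim K)
      have "(SUP n. \<integral>\<^sup>+\<omega>. ennreal \<bar>Z n \<omega> ^ 4\<bar> * indicator {\<omega>. \<bar>Z n \<omega> ^ 4\<bar> > K} \<omega> \<partial>M) \<le> c"
      proof (rule SUP_least)
        fix n
        have "(\<integral>\<^sup>+\<omega>. ennreal \<bar>Z n \<omega> ^ 4\<bar> * indicator {\<omega>. \<bar>Z n \<omega> ^ 4\<bar> > K} \<omega> \<partial>M)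
            \<le> (\<integral>\<^sup>+\<omega>. ennreal \<bar>Z n \<omega> ^ 4\<bar> * indicator {\<omega>. \<bar>Z n \<omega> ^ 4\<bar> > real J ^ 4} \<omega> \<partial>M)"
          using elim by (intro nn_integral_mono) (auto simp: indicator_def)
        also have "\<dots> = ennreal (tail_moment 4 n J)" by (rule nn_integral_tail_moment4)
        also have "\<dots> \<le> c" unfolding ce using J by (intro ennreal_leI)
        finally show "(\<integral>\<^sup>+\<omega>. ennreal \<bar>Z n \<omega> ^ 4\<bar> * indicator {\<omega>. \<bar>Z n \<omega> ^ 4\<bar> > K} \<omega> \<partial>M) \<le> c" .
      qed
      then show ?case using c(2) by (rule le_less_trans)
    qed
  qed simp
  then show "uniformly_integrable M UNIV (\<lambda>n \<omega>. Z n \<omega> ^ 4)"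
    unfolding uniformly_integrable_def by simp
qed

lemma moments_converge:
  assumes l: "0 < l" and conv: "\<And>j. (\<lambda>n. weight n j) \<longlonglongrightarrow> poisson_weight l j"
    and tails: "\<And>e. 0 < e \<Longrightarrow> \<exists>J. \<forall>n. tail_moment 4 n J \<le> e"
    and k: "k \<le> 4" and \<mu>: "(\<lambda>j. real j ^ k * poisson_weight l j) sums \<mu>"
  shows "(\<lambda>n. moment M k (Z n)) \<longlonglongrightarrow> \<mu>"
proof (rule LIMSEQ_I)
  fix e :: real assume e: "0 < e"
  obtain J1 where J1: "\<And>n. tail_moment 4 n J1 \<le> e / 4" using tails[of "e / 4"] e by auto
  have "(\<lambda>J. \<Sum>j\<le>J. real j ^ k * poisson_weight l j) \<longlonglongrightarrow> \<mu>"
    using \<mu> by (simp add: sums_def_le)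
  from LIMSEQ_D[OF this, of "e / 4"] e obtain J2
    where J2: "\<And>J. J \<ge> J2 \<Longrightarrow> \<bar>(\<Sum>j\<le>J. real j ^ k * poisson_weight l j) - \<mu>\<bar> < e / 4" by fastforce
  define J where "J = max J1 J2"
  have "(\<lambda>n. \<Sum>j\<le>J. real j ^ k * weight n j) \<longlonglongrightarrow> (\<Sum>j\<le>J. real j ^ k * poisson_weight l j)"
    by (intro tendsto_intros conv)
  from LIMSEQ_D[OF this, of "e / 4"] e obtain n0
    where n0: "\<And>n. n \<ge> n0 \<Longrightarrow> \<bar>(\<Sum>j\<le>J. real j ^ k * weight n j) - (\<Sum>j\<le>J. real j ^ k * poisson_weight l j)\<bar> < e / 4" by fastforce
  show "\<exists>n0. \<forall>n\<ge>n0. norm (moment M k (Z n) - \<mu>) < e"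
  proof (intro exI allI impI)
    fix n assume n: "n0 \<le> n"
    have "tail_moment k n J \<le> tail_moment 4 n J1"
      using tail_moment_le_tail_moment4[OF k, of n J] tail_moment4_antimono[of J1 J n] by (simp add: J_def)
    then have "tail_moment k n J \<le> e / 4" using J1[of n] by simp
    moreover have "0 \<le> tail_moment k n J" by (rule tail_moment_nonneg)
    ultimately have "\<bar>moment M k (Z n) - \<mu>\<bar> < e"
      using moment_split[OF k, of n J] n0[OF n] J2[of J] unfolding J_def by linarith
    then show "norm (moment M k (Z n) - \<mu>) < e" by simp
  qed
qed

text \<open>
  The tail is the fourth moment minus a finite sum over the weights, so it converges as well; the
  finitely many indices not covered by this are treated one by one.
\<close>
lemma tails_uniformly_small:
  assumes l: "0 < l" and conv: "\<And>j. (\<lambda>n. weight n j) \<longlonglongrightarrow> poisson_weight l j"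
    and \<mu>: "(\<lambda>j. real j ^ 4 * poisson_weight l j) sums \<mu>"
    and m4: "(\<lambda>n. moment M 4 (Z n)) \<longlonglongrightarrow> \<mu>" and e: "0 < e"
  shows "\<exists>J. \<forall>n. tail_moment 4 n J \<le> e"
proof -
  have "(\<lambda>J. \<Sum>j\<le>J. real j ^ 4 * poisson_weight l j) \<longlonglongrightarrow> \<mu>"
    using \<mu> by (simp add: sums_def_le)
  from LIMSEQ_D[OF this, of "e / 2"] e obtain J1
    where J1: "\<bar>(\<Sum>j\<le>J1. real j ^ 4 * poisson_weight l j) - \<mu>\<bar> < e / 2" by fastforce
  have "(\<lambda>n. moment M 4 (Z n) - (\<Sum>j\<le>J1. real j ^ 4 * weight n j)) \<longlonglongrightarrow> \<mu> - (\<Sum>j\<le>J1. real j ^ 4 * poisson_weight l j)"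
    by (intro tendsto_intros m4 conv)
  then have "(\<lambda>n. tail_moment 4 n J1) \<longlonglongrightarrow> \<mu> - (\<Sum>j\<le>J1. real j ^ 4 * poisson_weight l j)"
    using moment_split[of 4 _ J1] by simp
  from LIMSEQ_D[OF this, of "e / 2"] e obtain n0
    where n0: "\<And>n. n \<ge> n0 \<Longrightarrow> \<bar>tail_moment 4 n J1 - (\<mu> - (\<Sum>j\<le>J1. real j ^ 4 * poisson_weight l j))\<bar> < e / 2" by fastforce
  have "\<exists>J. tail_moment 4 n J \<le> e" for n
    using LIMSEQ_D[OF tail_moment4_tendsto_0[of n] e] by (metis abs_le_D1 diff_zero less_imp_le order_refl real_norm_def)
  then obtain Jn where Jn: "\<And>n. tail_moment 4 n (Jn n) \<le> e" by metis
  define J where "J = Max (insert J1 (Jn ` {..<n0}))"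
  have "tail_moment 4 n J \<le> e" for n
  proof (cases "n < n0")
    case True
    then have "Jn n \<le> J" unfolding J_def by (intro Max_ge) auto
    then show ?thesis using tail_moment4_antimono[of "Jn n" J n] Jn[of n] by simp
  next
    case False
    have "J1 \<le> J" unfolding J_def by (intro Max_ge) auto
    then have "tail_moment 4 n J \<le> tail_moment 4 n J1" by (rule tail_moment4_antimono)
    also have "\<dots> \<le> e" using n0[of n] False J1 by linarith
    finally show ?thesis .
  qed
  then show ?thesis by blast
qed

end

section \<open>The fourth moment theorem\<close>

lemma (in prob_space) shifted_moments:
  fixes F :: "'a \<Rightarrow> real"
  assumes F [measurable]: "F \<in> borel_measurable M" and F4: "integrable M (\<lambda>\<omega>. F \<omega> ^ 4)" and mean: "moment M 1 F = 0"
  shows "moment M 1 (\<lambda>\<omega>. F \<omega> + t) = t"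
    and "moment M 2 (\<lambda>\<omega>. F \<omega> + t) = moment M 2 F + t\<^sup>2"
    and "moment M 3 (\<lambda>\<omega>. F \<omega> + t) = moment M 3 F + 3 * t * moment M 2 F + t ^ 3"
    and "moment M 4 (\<lambda>\<omega>. F \<omega> + t) = moment M 4 F + 4 * t * moment M 3 F + 6 * t\<^sup>2 * moment M 2 F + t ^ 4"
    and "integrable M (\<lambda>\<omega>. (F \<omega> + t) ^ 4)"
proof -
  have i: "integrable M F" "integrable M (\<lambda>\<omega>. (F \<omega>)\<^sup>2)" "integrable M (\<lambda>\<omega>. F \<omega> ^ 3)"
    using integrable_power_of_fourth[OF F F4, of 1] integrable_power_of_fourth[OF F F4, of 2]
      integrable_power_of_fourth[OF F F4, of 3] by simp_all
  have m1: "(\<integral>\<omega>. F \<omega> \<partial>M) = 0" using mean by (simp add: moment_def)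
  have e2: "(F \<omega> + t)\<^sup>2 = (F \<omega>)\<^sup>2 + 2 * t * F \<omega> + t\<^sup>2" for \<omega>
    by (simp add: power2_eq_square algebra_simps)
  have e3: "(F \<omega> + t) ^ 3 = F \<omega> ^ 3 + 3 * t * (F \<omega>)\<^sup>2 + 3 * t\<^sup>2 * F \<omega> + t ^ 3" for \<omega>
    by (simp add: power2_eq_square power3_eq_cube algebra_simps)
  have e4: "(F \<omega> + t) ^ 4 = F \<omega> ^ 4 + 4 * t * F \<omega> ^ 3 + 6 * t\<^sup>2 * (F \<omega>)\<^sup>2 + 4 * t ^ 3 * F \<omega> + t ^ 4" for \<omega>
    by (simp add: power2_eq_square power3_eq_cube power4_eq_xxxx algebra_simps)
  show "moment M 1 (\<lambda>\<omega>. F \<omega> + t) = t"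
    using i m1 by (simp add: moment_def prob_space)
  show "moment M 2 (\<lambda>\<omega>. F \<omega> + t) = moment M 2 F + t\<^sup>2"
    unfolding moment_def e2 using i m1 by (simp add: prob_space)
  show "moment M 3 (\<lambda>\<omega>. F \<omega> + t) = moment M 3 F + 3 * t * moment M 2 F + t ^ 3"
    unfolding moment_def e3 using i m1 by (simp add: prob_space)
  show "moment M 4 (\<lambda>\<omega>. F \<omega> + t) = moment M 4 F + 4 * t * moment M 3 F + 6 * t\<^sup>2 * moment M 2 F + t ^ 4"
    unfolding moment_def e4 using i F4 m1 by (simp add: prob_space)
  show "integrable M (\<lambda>\<omega>. (F \<omega> + t) ^ 4)"
    unfolding e4 using i F4 by simp
qed

lemma tendsto_triple_iff:
  "(\<lambda>n. (a n, b n, c n)) \<longlonglongrightarrow> (x, y, z) \<longleftrightarrow> a \<longlonglongrightarrow> x \<and> b \<longlonglongrightarrow> y \<and> c \<longlonglongrightarrow> z"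
proof
  assume *: "(\<lambda>n. (a n, b n, c n)) \<longlonglongrightarrow> (x, y, z)"
  show "a \<longlonglongrightarrow> x \<and> b \<longlonglongrightarrow> y \<and> c \<longlonglongrightarrow> z"
    using tendsto_fst[OF *] tendsto_snd[OF *] tendsto_fst[OF tendsto_snd[OF *]] tendsto_snd[OF tendsto_snd[OF *]] by simp
qed (auto intro: tendsto_Pair)

theorem theorem1p4:
  fixes M :: "'a measure" and p :: "nat \<Rightarrow> real" and X :: "nat \<Rightarrow> 'a \<Rightarrow> real"
    and d :: nat and lam :: real
    and f :: "nat \<Rightarrow> nat list \<Rightarrow> real" and F :: "nat \<Rightarrow> 'a \<Rightarrow> real" and \<theta> :: "nat \<Rightarrow> real"
  assumes "rademacher_sequence M p X"
    and "d \<ge> 1" and "lam > 0"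
    and "\<And>n. is_chaos M (normalized_rademacher p X) d (f n) (F n)"
    and "\<And>n. integrable M (\<lambda>\<omega>. F n \<omega> ^ 4)"
    and "\<And>n. AE \<omega> in M. F n \<omega> + \<theta> n \<in> \<nat>"
    and "(\<lambda>n. max_influence d (f n)) \<longlonglongrightarrow> 0"
  shows
    "(((\<lambda>n. moment M 1 (\<lambda>\<omega>. F n \<omega> + \<theta> n)) \<longlonglongrightarrow> lam \<and>
       (\<lambda>n. moment M 2 (\<lambda>\<omega>. F n \<omega> + \<theta> n)) \<longlonglongrightarrow> lam ^ 2 + lam \<and>
       (\<lambda>n. moment M 3 (\<lambda>\<omega>. F n \<omega> + \<theta> n)) \<longlonglongrightarrow> lam ^ 3 + 3 * lam ^ 2 + lam \<and>
       (\<lambda>n. moment M 4 (\<lambda>\<omega>. F n \<omega> + \<theta> n)) \<longlonglongrightarrow> lam ^ 4 + 6 * lam ^ 3 + 7 * lam ^ 2 + lam)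
      \<longleftrightarrow> (\<lambda>n. (\<theta> n, moment M 2 (F n), moment_R M (F n))) \<longlonglongrightarrow> (lam, lam, 0))
     \<and>
     ((\<lambda>n. (\<theta> n, moment M 2 (F n), moment_R M (F n))) \<longlonglongrightarrow> (lam, lam, 0)
      \<longleftrightarrow> (\<lambda>n. tv_dist M (\<lambda>\<omega>. F n \<omega> + \<theta> n) (measure_pmf (poisson_pmf lam)) real) \<longlonglongrightarrow> 0 \<and>
          uniformly_integrable M UNIV (\<lambda>n \<omega>. (F n \<omega> + \<theta> n) ^ 4))"
proof -
  interpret R: rademacher_sequence M p X by fact
  note d = assms(2) and l = assms(3) and chaos = assms(4) and F4 = assms(5) and nat = assms(6) and infl = assms(7)
  have F_meas [measurable]: "F n \<in> borel_measurable M" for n using chaos[of n] by (simp add: is_chaos_def)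
  define \<mu> where "\<mu> n = (4 ^ d + 2) * real d * ((fact d)\<^sup>2 * max_influence d (f n))" for n
  define \<rho> where "\<rho> n = moment_R M (F n) + \<mu> n * moment M 2 (F n)" for n
  define m2 m3 m4 where "m2 n = moment M 2 (F n)" and "m3 n = moment M 3 (F n)" and "m4 n = moment M 4 (F n)" for n
  note est = R.chaos_estimates[OF d chaos F4, folded \<mu>_def, folded \<rho>_def, folded m2_def m3_def m4_def]
  note sh = R.shifted_moments[OF F_meas F4 est(1), folded m2_def m3_def m4_def]
  interpret N: nat_valued_sequence M "\<lambda>n \<omega>. F n \<omega> + \<theta> n"
    by unfold_locales (auto intro: nat sh(5))
  have \<mu>0: "\<mu> \<longlonglongrightarrow> 0"
    unfolding \<mu>_def[abs_def] using infl by (intro tendsto_mult_right_zero)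
  have R_eq: "moment_R M (F n) = m4 n - 3 * (m2 n)\<^sup>2 - 2 * m3 n + m2 n" for n
    by (simp add: moment_R_def m2_def m3_def m4_def)
  let ?i = "(\<lambda>n. moment M 1 (\<lambda>\<omega>. F n \<omega> + \<theta> n)) \<longlonglongrightarrow> lam \<and>
       (\<lambda>n. moment M 2 (\<lambda>\<omega>. F n \<omega> + \<theta> n)) \<longlonglongrightarrow> lam ^ 2 + lam \<and>
       (\<lambda>n. moment M 3 (\<lambda>\<omega>. F n \<omega> + \<theta> n)) \<longlonglongrightarrow> lam ^ 3 + 3 * lam ^ 2 + lam \<and>
       (\<lambda>n. moment M 4 (\<lambda>\<omega>. F n \<omega> + \<theta> n)) \<longlonglongrightarrow> lam ^ 4 + 6 * lam ^ 3 + 7 * lam ^ 2 + lam"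
  let ?ii = "\<theta> \<longlonglongrightarrow> lam \<and> m2 \<longlonglongrightarrow> lam \<and> (\<lambda>n. moment_R M (F n)) \<longlonglongrightarrow> 0"
  let ?iii = "(\<lambda>n. tv_dist M (\<lambda>\<omega>. F n \<omega> + \<theta> n) (measure_pmf (poisson_pmf lam)) real) \<longlonglongrightarrow> 0 \<and>
          uniformly_integrable M UNIV (\<lambda>n \<omega>. (F n \<omega> + \<theta> n) ^ 4)"
  have i_ii: ?ii if i: ?i
  proof -
    have \<theta>: "\<theta> \<longlonglongrightarrow> lam" using i unfolding sh(1) by blast
    have i2: "(\<lambda>n. m2 n + (\<theta> n)\<^sup>2) \<longlonglongrightarrow> lam ^ 2 + lam"
      and i3: "(\<lambda>n. m3 n + 3 * \<theta> n * m2 n + \<theta> n ^ 3) \<longlonglongrightarrow> lam ^ 3 + 3 * lam ^ 2 + lam"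
      and i4: "(\<lambda>n. m4 n + 4 * \<theta> n * m3 n + 6 * (\<theta> n)\<^sup>2 * m2 n + \<theta> n ^ 4) \<longlonglongrightarrow> lam ^ 4 + 6 * lam ^ 3 + 7 * lam ^ 2 + lam"
      using i unfolding sh by blast+
    have m2: "m2 \<longlonglongrightarrow> lam"
      using tendsto_diff[OF i2 tendsto_power[OF \<theta>, of 2]] by simp
    have "(\<lambda>n. 3 * \<theta> n * m2 n + \<theta> n ^ 3) \<longlonglongrightarrow> 3 * lam * lam + lam ^ 3"
      by (intro tendsto_intros \<theta> m2)
    from tendsto_diff[OF i3 this] have m3: "m3 \<longlonglongrightarrow> lam" by (simp add: power2_eq_square algebra_simps)
    have "(\<lambda>n. 4 * \<theta> n * m3 n + 6 * (\<theta> n)\<^sup>2 * m2 n + \<theta> n ^ 4) \<longlonglongrightarrow> 4 * lam * lam + 6 * lam\<^sup>2 * lam + lam ^ 4"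
      by (intro tendsto_intros \<theta> m2 m3)
    from tendsto_diff[OF i4 this] have "m4 \<longlonglongrightarrow> (lam ^ 4 + 6 * lam ^ 3 + 7 * lam ^ 2 + lam) - (4 * lam * lam + 6 * lam\<^sup>2 * lam + lam ^ 4)"
      by (simp add: algebra_simps)
    also have "(lam ^ 4 + 6 * lam ^ 3 + 7 * lam ^ 2 + lam) - (4 * lam * lam + 6 * lam\<^sup>2 * lam + lam ^ 4) = 3 * lam\<^sup>2 + lam"
      by (simp add: power2_eq_square power3_eq_cube)
    finally have m4: "m4 \<longlonglongrightarrow> 3 * lam\<^sup>2 + lam" .
    have "(\<lambda>n. m4 n - 3 * (m2 n)\<^sup>2 - 2 * m3 n + m2 n) \<longlonglongrightarrow> (3 * lam\<^sup>2 + lam) - 3 * lam\<^sup>2 - 2 * lam + lam"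
      by (intro tendsto_intros m2 m3 m4)
    then have "(\<lambda>n. moment_R M (F n)) \<longlonglongrightarrow> 0" by (simp add: R_eq)
    with \<theta> m2 show ?thesis by blast
  qed
  have ii_i_iii: "?i \<and> ?iii" if ii: ?ii
  proof -
    have \<theta>: "\<theta> \<longlonglongrightarrow> lam" and m2: "m2 \<longlonglongrightarrow> lam" and R0: "(\<lambda>n. moment_R M (F n)) \<longlonglongrightarrow> 0" using ii by auto
    have "(\<lambda>n. moment_R M (F n) + \<mu> n * m2 n) \<longlonglongrightarrow> 0 + 0 * lam" by (intro tendsto_intros R0 \<mu>0 m2)
    then have \<rho>0: "\<rho> \<longlonglongrightarrow> 0" by (simp add: \<rho>_def[abs_def] m2_def)
    have "(\<lambda>n. 2 * (sqrt (m2 n) * sqrt (\<rho> n))) \<longlonglongrightarrow> 2 * (sqrt lam * sqrt 0)" by (intro tendsto_intros m2 \<rho>0)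
    \<comment> \<open>The hypothesis involves the third and fourth moments only in combination; the estimate of the third moment separates them.\<close>
    then have lim: "(\<lambda>n. 2 * (sqrt (m2 n) * sqrt (\<rho> n))) \<longlonglongrightarrow> 0" by simp
    have "(\<lambda>n. m3 n - m2 n) \<longlonglongrightarrow> 0"
      by (rule Lim_null_comparison[OF always_eventually lim]) (simp add: est(3))
    from tendsto_add[OF this m2] have m3: "m3 \<longlonglongrightarrow> lam" by simp
    have "(\<lambda>n. moment_R M (F n) + 3 * (m2 n)\<^sup>2 + 2 * m3 n - m2 n) \<longlonglongrightarrow> 0 + 3 * lam\<^sup>2 + 2 * lam - lam"
      by (intro tendsto_intros R0 m2 m3)
    then have m4: "m4 \<longlonglongrightarrow> 3 * lam\<^sup>2 + lam" by (simp add: R_eq add.commute)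
    have i2: "(\<lambda>n. moment M 2 (\<lambda>\<omega>. F n \<omega> + \<theta> n)) \<longlonglongrightarrow> lam ^ 2 + lam"
      unfolding sh using tendsto_add[OF m2 tendsto_power[OF \<theta>, of 2]] by (simp add: add.commute)
    have "(\<lambda>n. m3 n + 3 * \<theta> n * m2 n + \<theta> n ^ 3) \<longlonglongrightarrow> lam + 3 * lam * lam + lam ^ 3"
      by (intro tendsto_intros m2 m3 \<theta>)
    then have i3: "(\<lambda>n. moment M 3 (\<lambda>\<omega>. F n \<omega> + \<theta> n)) \<longlonglongrightarrow> lam ^ 3 + 3 * lam ^ 2 + lam"
      unfolding sh by (simp add: power2_eq_square algebra_simps)
    have "(\<lambda>n. m4 n + 4 * \<theta> n * m3 n + 6 * (\<theta> n)\<^sup>2 * m2 n + \<theta> n ^ 4) \<longlonglongrightarrow> (3 * lam\<^sup>2 + lam) + 4 * lam * lam + 6 * lam\<^sup>2 * lam + lam ^ 4"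
      by (intro tendsto_add m4) (intro tendsto_intros m2 m3 \<theta>)+
    also have "(3 * lam\<^sup>2 + lam) + 4 * lam * lam + 6 * lam\<^sup>2 * lam + lam ^ 4 = lam ^ 4 + 6 * lam ^ 3 + 7 * lam ^ 2 + lam"
      by (simp add: power2_eq_square power3_eq_cube)
    finally have i4: "(\<lambda>n. moment M 4 (\<lambda>\<omega>. F n \<omega> + \<theta> n)) \<longlonglongrightarrow> lam ^ 4 + 6 * lam ^ 3 + 7 * lam ^ 2 + lam"
      unfolding sh .
    have bal: "(\<lambda>n. real (Suc j) * N.weight n (Suc j) - lam * N.weight n j) \<longlonglongrightarrow> 0" for j
    proof -
      define \<beta> where "\<beta> n = sqrt (\<rho> n) + 12 * (sqrt (m4 n) * sqrt (\<rho> n)) + 4 * (sqrt (m2 n) * sqrt (\<rho> n)) + 4 * (\<mu> n * m2 n)" for n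
      have "\<beta> \<longlonglongrightarrow> sqrt 0 + 12 * (sqrt (3 * lam\<^sup>2 + lam) * sqrt 0) + 4 * (sqrt lam * sqrt 0) + 4 * (0 * lam)"
        unfolding \<beta>_def[abs_def] by (intro tendsto_intros \<rho>0 m2 m4 \<mu>0)
      then have \<beta>0: "\<beta> \<longlonglongrightarrow> 0" by simp
      have le: "norm (real (Suc j) * N.weight n (Suc j) - lam * N.weight n j) \<le> \<bar>m2 n - \<theta> n\<bar> + \<bar>m2 n - lam\<bar> + \<beta> n" for n
      proof -
        define x y where "x = N.weight n (Suc j)" and "y = N.weight n j"
        have b: "\<bar>(m2 n + (real (Suc j) - \<theta> n)) * x - m2 n * y\<bar> \<le> \<beta> n"
          using est(4)[OF nat, of n j] unfolding \<beta>_def x_def y_def N.weight_def .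
        have "real (Suc j) * x - lam * y = ((m2 n + (real (Suc j) - \<theta> n)) * x - m2 n * y) - (m2 n - \<theta> n) * x + (m2 n - lam) * y"
          by (simp add: algebra_simps)
        moreover have "\<bar>(m2 n - \<theta> n) * x\<bar> \<le> \<bar>m2 n - \<theta> n\<bar>" "\<bar>(m2 n - lam) * y\<bar> \<le> \<bar>m2 n - lam\<bar>"
          using N.weight_nonneg[of n] N.weight_le_1[of n] by (auto simp: abs_mult x_def y_def intro!: mult_right_le_one_le)
        moreover have "\<bar>t - u + v\<bar> \<le> r + s + q" if "\<bar>t\<bar> \<le> q" "\<bar>u\<bar> \<le> r" "\<bar>v\<bar> \<le> s" for t u v q r s :: real
          using that by linarith
        ultimately show ?thesis using b unfolding x_def[symmetric] y_def[symmetric] real_norm_def by metis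
      qed
      have "(\<lambda>n. \<bar>m2 n - \<theta> n\<bar> + \<bar>m2 n - lam\<bar> + \<beta> n) \<longlonglongrightarrow> \<bar>lam - lam\<bar> + \<bar>lam - lam\<bar> + 0"
        by (intro tendsto_intros m2 \<theta> \<beta>0)
      then have "(\<lambda>n. \<bar>m2 n - \<theta> n\<bar> + \<bar>m2 n - lam\<bar> + \<beta> n) \<longlonglongrightarrow> 0" by simp
      then show ?thesis by (rule Lim_null_comparison[OF always_eventually[OF allI[OF le]]])
    qed
    obtain C where C: "\<And>n. moment M 2 (\<lambda>\<omega>. F n \<omega> + \<theta> n) \<le> C"
    proof -
      have "Bseq (\<lambda>n. moment M 2 (\<lambda>\<omega>. F n \<omega> + \<theta> n))" using i2 by (intro convergent_imp_Bseq convergentI)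
      then obtain K where "\<And>n. norm (moment M 2 (\<lambda>\<omega>. F n \<omega> + \<theta> n)) \<le> K"
        unfolding Bseq_def by blast
      then have "moment M 2 (\<lambda>\<omega>. F n \<omega> + \<theta> n) \<le> K" for n
        unfolding real_norm_def abs_le_iff by blast
      then show ?thesis by (rule that)
    qed
    have conv: "(\<lambda>n. N.weight n j) \<longlonglongrightarrow> poisson_weight lam j" for j
      by (rule N.weights_converge_of_balance[OF l bal C])
    have tv: "(\<lambda>n. tv_dist M (\<lambda>\<omega>. F n \<omega> + \<theta> n) (measure_pmf (poisson_pmf lam)) real) \<longlonglongrightarrow> 0"
      using N.tv_dist_tendsto_0_iff[OF l] conv by blast
    have ui: "uniformly_integrable M UNIV (\<lambda>n \<omega>. (F n \<omega> + \<theta> n) ^ 4)"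
      unfolding N.uniformly_integrable_iff
      using N.tails_uniformly_small[OF l conv poisson_moments(4) i4] by blast
    show ?thesis unfolding sh(1) using tv ui i2 i3 i4 \<theta> by blast
  qed
  have iii_i: ?i if iii: ?iii
  proof -
    have conv: "\<And>j. (\<lambda>n. N.weight n j) \<longlonglongrightarrow> poisson_weight lam j" using iii N.tv_dist_tendsto_0_iff[OF l] by blast
    have tails: "\<And>e. 0 < e \<Longrightarrow> \<exists>J. \<forall>n. N.tail_moment 4 n J \<le> e" using iii N.uniformly_integrable_iff by blast
    show ?thesis
      using N.moments_converge[OF l conv tails _ poisson_moments(1)] N.moments_converge[OF l conv tails _ poisson_moments(2)]
        N.moments_converge[OF l conv tails _ poisson_moments(3)] N.moments_converge[OF l conv tails _ poisson_moments(4)]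
      by simp
  qed
  show ?thesis
    unfolding tendsto_triple_iff m2_def[symmetric] using i_ii ii_i_iii iii_i by blast
qed

end
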